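(* Let $\mathcal M$ and $\widetilde{\mathcal M}$ be two Hilbert modules in $\mathfrak B_1(\Omega^* )$ consisting of holomorphic functions on a bounded domain $\Omega\subset\mathbb C^m$. Assume that the dimension of the zero set of these modules is at most $m-2$. Suppose there exists a polynomial ideal $\mathcal I$ such that $\mathcal M$ and $\widetilde{\mathcal M}$ are the completions of $\mathcal I$ with respect to different inner products. Let $w_0\in Z(\mathcal M)$, and let $\Delta(w_0;r)$, $g_1,\ldots,g_t$, $Z$, the monoidal transform $\widehat\Delta(w_0;r)$ and the line bundles $\mathcal L(\mathcal M)$, $\mathcal L(\widetilde{\mathcal M})$ be as defined in the context, where $Z$ is assumed to be a singularity free analytic subset of codimension $t$. Then $\mathcal M$ and $\widetilde{\mathcal M}$ are equivalent if and only if the line bundles $\mathcal L(\mathcal M)$ and $\mathcal L(\widetilde{\mathcal M})$ are equivalent as Hermitian holomorphic line bundles on $\widehat\Delta(w_0;r)^*$.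
   Context: $\Omega^*=\{\bar z:z\in\Omega\}$, $\mathbb C[\underline z]=\mathbb C[z_1,\ldots,z_m]$, and $\mathfrak m_w$ is the maximal ideal of $\mathbb C[\underline z]$ at $w$. Hilbert modules here are Hilbert spaces of holomorphic functions on $\Omega$ on which multiplication $M_j$ by each $z_j$ is bounded. $\mathcal M$ is in the class $\mathfrak B_1(\Omega^* )$ if it possesses a reproducing kernel $K$ (it is allowed that $K(w,w)=0$ on a closed subset of $\Omega$) and $\dim\mathcal M/\mathfrak m_w\mathcal M<\infty$ for all $w\in\Omega$. Its zero set is $Z(\mathcal M)=\{w\in\Omega: f(w)=0\ \forall f\in\mathcal M\}$. Two Hilbert modules are equivalent if there is a unitary operator between them intertwining multiplication by all polynomials. The analytic sheaf $\mathcal S^{\mathcal M}\subset\mathcal O_\Omega$ has stalk at $w$ the ideal of $\mathcal O_w$ generated by the germs at $w$ of the functions in $\mathcal M$; for two completions $\mathcal M,\widetilde{\mathcal M}$ of the same ideal $\mathcal I$ these stalks coincide. Let $K,\widetilde K$ be the reproducing kernels of $\mathcal M,\widetilde{\mathcal M}$. Fix $w_0\in Z(\mathcal M)$, put $t=\dim\mathcal S^{\mathcal M}_{w_0}/\mathfrak m_{w_0}\mathcal S^{\mathcal M}_{w_0}=\dim\bigcap_{j=1}^m\ker(M_j-w_{0j})^*$, and fix a minimal set of generators $g_1,\ldots,g_t$ of the common stalk at $w_0$. By a known decomposition theorem, for some polydisc $\Delta(w_0;r)\subset\Omega$ (with $r>0$ small, on which the $g_j$ are defined) there are anti-holomorphic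 maps $K^{(j)}(\cdot,w):\Delta(w_0;r)\to\mathcal M$, $w\mapsto K^{(j)}(\cdot,w)$, $1\le j\le t$, linearly independent at each $w\in\Delta(w_0;r)$, with $$K(\cdot,w)=\sum_{j=1}^t\overline{g_j(w)}\,K^{(j)}(\cdot,w),\qquad w\in\Delta(w_0;r),$$ and likewise $\widetilde K(\cdot,w)=\sum_j\overline{g_j(w)}\,\widetilde K^{(j)}(\cdot,w)$ in $\widetilde{\mathcal M}$ with the same $g_j$. Let $Z$ be the common zero set of $g_1,\ldots,g_t$ in $\Delta(w_0;r)$; it is assumed to be a singularity free analytic subset of codimension $t$. With $\pi(u)=(u_1:\cdots:u_t)\in\mathbb P^{t-1}$ for $u\in\mathbb C^t\setminus\{0\}$, the monoidal transform with center $Z$ is $$\widehat\Delta(w_0;r)=\{(w,\pi(u))\in\Delta(w_0;r)\times\mathbb P^{t-1}: u_ig_j(w)-u_jg_i(w)=0,\ 1\le i,j\le t\},$$ and $\widehat\Delta(w_0;r)^*=\{(\bar w,\pi(\bar u)):(w,\pi(u))\in\widehat\Delta(w_0;r)\}$. On the chart $\{u_i\ne0\}$ put $\theta^i_j=u_j/u_i$. $\mathcal L(\mathcal M)$ is the line bundle whose fibre over the point of $\widehat\Delta(w_0;r)^*$ corresponding to $(w,\pi(u))$ with $u_i\ne 0$ is the line in $\mathcal M$ spanned by $$s_i(w,\theta)=K^{(i)}(\cdot,w)+\sum_{j\ne i}\overline{\theta^i_j}\,K^{(j)}(\cdot,w);$$ the $s_i$ are anti-holomorphic on $\widehat\Delta(w_0;r)$,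 hence holomorphic local frames on $\widehat\Delta(w_0;r)^*$, and the Hermitian metric is the one induced by the norm of $\mathcal M$. (Since $s_i=K(\cdot,w)/\overline{g_i(w)}$ wherever $g_i(w)\neq0$, this bundle does not depend on the choice of the $K^{(j)}$.) $\mathcal L(\widetilde{\mathcal M})$ is defined in the same way from $\widetilde K^{(j)}$. Equivalence of Hermitian holomorphic line bundles means an isometric holomorphic bundle isomorphism over the identity of the base. *)

theory Defs
  imports "HOL-Analysis.Analysis" "HOL-Library.Poly_Mapping" "HOL-Library.Function_Algebras"
begin

section \<open>Complex-valued functions as a complex vector space\<close>

definition cscale :: "complex \<Rightarrow> ('a \<Rightarrow> complex) \<Rightarrow> 'a \<Rightarrow> complex"
  where "cscale c f = (\<lambda>z. c * f z)"

global_interpretation cfun: vector_space "cscale :: complex \<Rightarrow> ('a \<Rightarrow> complex) \<Rightarrow> 'a \<Rightarrow> complex"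
  by unfold_locales (auto simp: cscale_def fun_eq_iff algebra_simps)

text \<open>For subspaces \<open>W \<subseteq> V\<close>: the quotient \<open>V / W\<close> has dimension \<open>n\<close>; the set \<open>B\<close>
  represents a basis of the quotient.\<close>

definition has_quot_dim :: "('a \<Rightarrow> complex) set \<Rightarrow> ('a \<Rightarrow> complex) set \<Rightarrow> nat \<Rightarrow> bool"
  where "has_quot_dim V W n \<longleftrightarrow>
    (\<exists>B. finite B \<and> card B = n \<and> B \<subseteq> V \<and> cfun.span (W \<union> B) = V \<and>
       (\<forall>c. (\<Sum>b\<in>B. cscale (c b) b) \<in> W \<longrightarrow> (\<forall>b\<in>B. c b = 0)))"


section \<open>Holomorphic functions of several variables\<close>

text \<open>The first argument is the complex scalar multiplication of the domain: \<open>(*s)\<close> on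
  \<open>\<complex>\<^sup>m\<close> and \<open>pscale\<close> on \<open>\<complex>\<^sup>m \<times> \<complex>\<^sup>t\<close>.\<close>

definition hol_wrt :: "(complex \<Rightarrow> 'a \<Rightarrow> 'a) \<Rightarrow> ('a::real_normed_vector \<Rightarrow> complex) \<Rightarrow> 'a set \<Rightarrow> bool"
  where "hol_wrt sc f S \<longleftrightarrow>
    (\<forall>x\<in>S. \<exists>D. (f has_derivative D) (at x) \<and> (\<forall>c v. D (sc c v) = c * D v))"

definition pscale :: "complex \<Rightarrow> (complex^'m) \<times> (complex^'t) \<Rightarrow> (complex^'m) \<times> (complex^'t)"
  where "pscale c p = (c *s fst p, c *s snd p)"

abbreviation hol_on :: "(complex^'m::finite \<Rightarrow> complex) \<Rightarrow> (complex^'m) set \<Rightarrow> bool"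
  where "hol_on f S \<equiv> hol_wrt (*s) f S"

definition hol_near :: "complex^'m::finite \<Rightarrow> (complex^'m \<Rightarrow> complex) \<Rightarrow> bool"
  where "hol_near w f \<longleftrightarrow> (\<exists>N. open N \<and> w \<in> N \<and> hol_on f N)"

definition hol_map_on :: "(complex^'m::finite \<Rightarrow> complex^'n::finite) \<Rightarrow> (complex^'m) set \<Rightarrow> bool"
  where "hol_map_on F S \<longleftrightarrow> (\<forall>j. hol_on (\<lambda>z. F z $ j) S)"

definition polydisc :: "complex^'m::finite \<Rightarrow> real \<Rightarrow> (complex^'m) set"
  where "polydisc w r = {z. \<forall>j. norm (z $ j - w $ j) < r}"

definition submanifold_at :: "(complex^'m::finite) set \<Rightarrow> complex^'m \<Rightarrow> nat \<Rightarrow> bool"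
  where "submanifold_at A p k \<longleftrightarrow>
    (\<exists>N V (\<phi> :: complex^'m \<Rightarrow> complex^'m) \<psi> J. open N \<and> p \<in> N \<and> open V \<and> homeomorphism N V \<phi> \<psi> \<and>
       hol_map_on \<phi> N \<and> hol_map_on \<psi> V \<and> card J = k \<and>
       \<phi> ` (A \<inter> N) = {z \<in> V. \<forall>j\<in>J. z $ j = 0})"

definition singularity_free_codim :: "(complex^'m::finite) set \<Rightarrow> nat \<Rightarrow> bool"
  where "singularity_free_codim A k \<longleftrightarrow> (\<forall>p\<in>A. submanifold_at A p k)"

text \<open>The dimension of an analytic set is the largest of the dimensions at its regular points.
  The bound is an integer, so that a negative bound forces the set to be empty.\<close>

definition analytic_dim_le :: "(complex^'m::finite) set \<Rightarrow> int \<Rightarrow> bool"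
  where "analytic_dim_le A n \<longleftrightarrow>
    (\<forall>p\<in>A. \<forall>k. submanifold_at A p k \<longrightarrow> int CARD('m) - int k \<le> n)"


section \<open>Polynomials\<close>

type_synonym 'm cpoly = "('m \<Rightarrow>\<^sub>0 nat) \<Rightarrow>\<^sub>0 complex"

definition peval :: "'m::finite cpoly \<Rightarrow> complex^'m \<Rightarrow> complex"
  where "peval p z =
    (\<Sum>\<alpha>\<in>Poly_Mapping.keys p. Poly_Mapping.lookup p \<alpha> * (\<Prod>j\<in>UNIV. (z $ j) ^ Poly_Mapping.lookup \<alpha> j))"

definition poly_ideal :: "'m::finite cpoly set \<Rightarrow> bool"
  where "poly_ideal I \<longleftrightarrow> 0 \<in> I \<and> (\<forall>p\<in>I. \<forall>q\<in>I. p + q \<in> I) \<and> (\<forall>p\<in>I. \<forall>q. q * p \<in> I)"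

definition max_ideal :: "complex^'m::finite \<Rightarrow> 'm cpoly set"
  where "max_ideal w = {p. peval p w = 0}"

definition pmult :: "'m::finite cpoly \<Rightarrow> (complex^'m \<Rightarrow> complex) \<Rightarrow> complex^'m \<Rightarrow> complex"
  where "pmult p f = (\<lambda>z. peval p z * f z)"

definition max_ideal_mult :: "complex^'m::finite \<Rightarrow> (complex^'m \<Rightarrow> complex) set \<Rightarrow> (complex^'m \<Rightarrow> complex) set"
  where "max_ideal_mult w V = cfun.span {pmult p f |p f. p \<in> max_ideal w \<and> f \<in> V}"


section \<open>Hilbert modules of holomorphic functions\<close>

text \<open>A function on \<open>\<Omega>\<close> is represented by its extension by zero outside \<open>\<Omega>\<close>, so that equality
  of functions is equality on \<open>\<Omega>\<close>. The inner product is linear in its first argument; its values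
  off the carrier are irrelevant.\<close>

record ('m::finite) hilb =
  carr :: "(complex^'m \<Rightarrow> complex) set"
  ip :: "(complex^'m \<Rightarrow> complex) \<Rightarrow> (complex^'m \<Rightarrow> complex) \<Rightarrow> complex"

definition hnorm :: "'m::finite hilb \<Rightarrow> (complex^'m \<Rightarrow> complex) \<Rightarrow> real"
  where "hnorm M f = sqrt (Re (ip M f f))"

definition hilbert_space :: "'m::finite hilb \<Rightarrow> bool"
  where "hilbert_space M \<longleftrightarrow>
    cfun.subspace (carr M) \<and>
    (\<forall>f\<in>carr M. \<forall>g\<in>carr M. ip M g f = cnj (ip M f g)) \<and>
    (\<forall>f\<in>carr M. \<forall>g\<in>carr M. \<forall>h\<in>carr M. ip M (f + g) h = ip M f h + ip M g h) \<and>
    (\<forall>c. \<forall>f\<in>carr M. \<forall>g\<in>carr M. ip M (cscale c f) g = c * ip M f g) \<and>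
    (\<forall>f\<in>carr M. f \<noteq> 0 \<longrightarrow> Re (ip M f f) > 0) \<and>
    (\<forall>X. (\<forall>n::nat. X n \<in> carr M) \<and>
         (\<forall>e>0. \<exists>n0. \<forall>n\<ge>n0. \<forall>k\<ge>n0. hnorm M (X n - X k) < e) \<longrightarrow>
         (\<exists>f\<in>carr M. (\<lambda>n. hnorm M (X n - f)) \<longlonglongrightarrow> 0))"

definition hilbert_module :: "(complex^'m::finite) set \<Rightarrow> 'm hilb \<Rightarrow> bool"
  where "hilbert_module \<Omega> M \<longleftrightarrow>
    hilbert_space M \<and>
    (\<forall>f\<in>carr M. hol_on f \<Omega> \<and> (\<forall>z. z \<notin> \<Omega> \<longrightarrow> f z = 0)) \<and>
    (\<forall>j. (\<forall>f\<in>carr M. (\<lambda>z. z $ j * f z) \<in> carr M) \<and>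
         (\<exists>C. \<forall>f\<in>carr M. hnorm M (\<lambda>z. z $ j * f z) \<le> C * hnorm M f))"

text \<open>\<open>K z w\<close> stands for \<open>K(z, w)\<close>; it may vanish on the diagonal.\<close>

definition reproducing_kernel ::
    "(complex^'m::finite) set \<Rightarrow> 'm hilb \<Rightarrow> (complex^'m \<Rightarrow> complex^'m \<Rightarrow> complex) \<Rightarrow> bool"
  where "reproducing_kernel \<Omega> M K \<longleftrightarrow>
    (\<forall>w\<in>\<Omega>. (\<lambda>z. K z w) \<in> carr M \<and> (\<forall>f\<in>carr M. f w = ip M f (\<lambda>z. K z w)))"

definition class_B1 :: "(complex^'m::finite) set \<Rightarrow> 'm hilb \<Rightarrow> bool"
  where "class_B1 \<Omega> M \<longleftrightarrow>
    hilbert_module \<Omega> M \<and> (\<exists>K. reproducing_kernel \<Omega> M K) \<and>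
    (\<forall>w\<in>\<Omega>. \<exists>n. has_quot_dim (carr M) (max_ideal_mult w (carr M)) n)"

definition zero_set :: "(complex^'m::finite) set \<Rightarrow> 'm hilb \<Rightarrow> (complex^'m) set"
  where "zero_set \<Omega> M = {w\<in>\<Omega>. \<forall>f\<in>carr M. f w = 0}"

definition restr_poly :: "(complex^'m::finite) set \<Rightarrow> 'm cpoly \<Rightarrow> complex^'m \<Rightarrow> complex"
  where "restr_poly \<Omega> p = (\<lambda>z. if z \<in> \<Omega> then peval p z else 0)"

definition completion_of :: "(complex^'m::finite) set \<Rightarrow> 'm cpoly set \<Rightarrow> 'm hilb \<Rightarrow> bool"
  where "completion_of \<Omega> I M \<longleftrightarrow>
    (\<forall>p\<in>I. restr_poly \<Omega> p \<in> carr M) \<and>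
    (\<forall>f\<in>carr M. \<forall>e>0. \<exists>p\<in>I. hnorm M (f - restr_poly \<Omega> p) < e)"

definition module_equivalent :: "'m::finite hilb \<Rightarrow> 'm hilb \<Rightarrow> bool"
  where "module_equivalent M M' \<longleftrightarrow>
    (\<exists>U. bij_betw U (carr M) (carr M') \<and>
       (\<forall>f\<in>carr M. \<forall>g\<in>carr M. U (f + g) = U f + U g) \<and>
       (\<forall>c. \<forall>f\<in>carr M. U (cscale c f) = cscale c (U f)) \<and>
       (\<forall>f\<in>carr M. \<forall>g\<in>carr M. ip M' (U f) (U g) = ip M f g) \<and>
       (\<forall>p. \<forall>f\<in>carr M. U (pmult p f) = pmult p (U f)))"


section \<open>Stalks and their generators\<close>

text \<open>An ideal of the ring \<open>\<O>\<^sub>w\<close> of germs is represented by the set of all functions whose germ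
  at \<open>w\<close> belongs to it; two functions have the same germ at \<open>w\<close> when they agree eventually in
  \<open>nhds w\<close>. All ideals contain every function with germ zero, so that quotients of such sets
  are the quotients of the ideals of germs.\<close>

definition germ_ideal :: "complex^'m::finite \<Rightarrow> (complex^'m \<Rightarrow> complex) set \<Rightarrow> (complex^'m \<Rightarrow> complex) set"
  where "germ_ideal w F = {h. \<exists>A a. finite A \<and> A \<subseteq> F \<and> (\<forall>f\<in>A. hol_near w (a f)) \<and>
    hol_near w h \<and> (\<forall>\<^sub>F z in nhds w. h z = (\<Sum>f\<in>A. a f z * f z))}"

definition stalk :: "'m::finite hilb \<Rightarrow> complex^'m \<Rightarrow> (complex^'m \<Rightarrow> complex) set"
  where "stalk M w = germ_ideal w (carr M)"

definition minimal_generators ::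
    "complex^'m::finite \<Rightarrow> (complex^'m \<Rightarrow> complex) set \<Rightarrow> ('t::finite \<Rightarrow> complex^'m \<Rightarrow> complex) \<Rightarrow> bool"
  where "minimal_generators w S g \<longleftrightarrow>
    (\<forall>j. hol_near w (g j)) \<and> germ_ideal w (range g) = S \<and>
    (\<forall>J. J \<noteq> UNIV \<longrightarrow> germ_ideal w (g ` J) \<noteq> S)"


section \<open>The decomposition of the kernel\<close>

definition antihol_into :: "'m::finite hilb \<Rightarrow> (complex^'m \<Rightarrow> complex^'m \<Rightarrow> complex) \<Rightarrow> (complex^'m) set \<Rightarrow> bool"
  where "antihol_into M F S \<longleftrightarrow>
    (\<forall>w\<in>S. F w \<in> carr M) \<and>
    (\<forall>w\<in>S. \<exists>D. (\<forall>j. D j \<in> carr M) \<and>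
       ((\<lambda>h. hnorm M (F (w + h) - F w - (\<Sum>j\<in>UNIV. cscale (cnj (h $ j)) (D j))) / norm h) \<longlongrightarrow> 0) (at 0))"

text \<open>\<open>Kd j w\<close> stands for \<open>K\<^sup>(\<^sup>j\<^sup>)(\<cdot>, w)\<close>.\<close>

definition kernel_decomposition ::
    "'m::finite hilb \<Rightarrow> (complex^'m \<Rightarrow> complex^'m \<Rightarrow> complex) \<Rightarrow> (complex^'m) set \<Rightarrow>
     ('t::finite \<Rightarrow> complex^'m \<Rightarrow> complex) \<Rightarrow> ('t \<Rightarrow> complex^'m \<Rightarrow> complex^'m \<Rightarrow> complex) \<Rightarrow> bool"
  where "kernel_decomposition M K \<Delta> g Kd \<longleftrightarrow>
    (\<forall>j. antihol_into M (Kd j) \<Delta>) \<and>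
    (\<forall>w\<in>\<Delta>. \<forall>c. (\<Sum>j\<in>UNIV. cscale (c j) (Kd j w)) = 0 \<longrightarrow> (\<forall>j. c j = 0)) \<and>
    (\<forall>w\<in>\<Delta>. (\<lambda>z. K z w) = (\<Sum>j\<in>UNIV. cscale (cnj (g j w)) (Kd j w)))"


section \<open>Projective space and the monoidal transform\<close>

text \<open>A point of \<open>\<P>\<^sup>t\<^sup>-\<^sup>1\<close> is the set of all its homogeneous coordinate vectors.\<close>

definition proj :: "complex^'t::finite \<Rightarrow> (complex^'t) set"
  where "proj u = {c *s u |c. c \<noteq> 0}"

definition in_chart :: "'t::finite \<Rightarrow> (complex^'t) set \<Rightarrow> bool"
  where "in_chart i l \<longleftrightarrow> (\<exists>u\<in>l. u $ i \<noteq> 0)"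

text \<open>The affine coordinates \<open>\<theta>\<^sup>i\<^sub>j = u\<^sub>j / u\<^sub>i\<close>, including \<open>\<theta>\<^sup>i\<^sub>i = 1\<close>.\<close>

definition theta :: "'t::finite \<Rightarrow> (complex^'t) set \<Rightarrow> complex^'t"
  where "theta i l = (THE u. u \<in> l \<and> u $ i = 1)"

lemma in_chart_proj [simp]: "in_chart i (proj u) \<longleftrightarrow> u $ i \<noteq> 0"
  by (auto simp: in_chart_def proj_def intro: exI[of _ 1])

lemma theta_proj:
  assumes "u $ i \<noteq> 0"
  shows "theta i (proj u) $ j = u $ j / u $ i"
proof -
  have "theta i (proj u) = inverse (u $ i) *s u"
    unfolding theta_def
  proof (rule the_equality)
    show "inverse (u $ i) *s u \<in> proj u \<and> (inverse (u $ i) *s u) $ i = 1"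
      using assms by (auto simp: proj_def intro!: exI[of _ "inverse (u $ i)"])
  next
    fix v assume "v \<in> proj u \<and> v $ i = 1"
    then obtain c where "v = c *s u" "c * u $ i = 1"
      unfolding proj_def by force
    moreover from this assms have "c = inverse (u $ i)"
      by (simp add: field_simps)
    ultimately show "v = inverse (u $ i) *s u"
      by simp
  qed
  then show ?thesis
    by (simp add: field_simps)
qed

type_synonym ('m, 't) bpoint = "(complex^'m) \<times> (complex^'t) set"

definition vcnj :: "complex^'n::finite \<Rightarrow> complex^'n"
  where "vcnj u = (\<chi> j. cnj (u $ j))"

definition conj_pt :: "('m::finite, 't::finite) bpoint \<Rightarrow> ('m, 't) bpoint"
  where "conj_pt x = (vcnj (fst x), vcnj ` snd x)"

lemma conj_pt_proj: "conj_pt (w, proj u) = (vcnj w, proj (vcnj u))"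
proof -
  have *: "vcnj (c *s u) = cnj c *s vcnj u" for c
    by (simp add: vcnj_def vec_eq_iff)
  have "c *s vcnj u \<in> vcnj ` proj u" if "c \<noteq> 0" for c
  proof -
    have "c *s vcnj u = vcnj (cnj c *s u)" "cnj c *s u \<in> proj u"
      using that by (auto simp: * proj_def)
    then show ?thesis by (rule image_eqI)
  qed
  then have "vcnj ` proj u = proj (vcnj u)"
    by (auto simp: proj_def *)
  then show ?thesis
    by (simp add: conj_pt_def)
qed

definition monoidal_transform ::
    "(complex^'m::finite) set \<Rightarrow> ('t::finite \<Rightarrow> complex^'m \<Rightarrow> complex) \<Rightarrow> ('m, 't) bpoint set"
  where "monoidal_transform \<Delta> g =
    {(w, proj u) |w u. w \<in> \<Delta> \<and> u \<noteq> 0 \<and> (\<forall>i j. u $ i * g j w - u $ j * g i w = 0)}"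

definition monoidal_transform_conj ::
    "(complex^'m::finite) set \<Rightarrow> ('t::finite \<Rightarrow> complex^'m \<Rightarrow> complex) \<Rightarrow> ('m, 't) bpoint set"
  where "monoidal_transform_conj \<Delta> g = conj_pt ` monoidal_transform \<Delta> g"

text \<open>Holomorphic functions on a (relatively open part of a) locally closed analytic subset of
  \<open>\<complex>\<^sup>m \<times> \<P>\<^sup>t\<^sup>-\<^sup>1\<close>: in every affine chart they are locally restrictions of holomorphic functions
  of the coordinates. On a complex submanifold these are the holomorphic functions in the usual
  sense. The chart \<open>i\<close> is the hyperplane \<open>{\<theta>. \<theta>\<^sub>i = 1}\<close> of \<open>\<complex>\<^sup>t\<close>, and extending the local
  functions to the ambient \<open>\<complex>\<^sup>t\<close> is no restriction.\<close>

definition hol_fun_on :: "('m::finite, 't::finite) bpoint set \<Rightarrow> (('m, 't) bpoint \<Rightarrow> complex) \<Rightarrow> bool"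
  where "hol_fun_on V a \<longleftrightarrow>
    (\<forall>(z, l)\<in>V. \<forall>i. in_chart i l \<longrightarrow>
      (\<exists>N F. open N \<and> (z, theta i l) \<in> N \<and> hol_wrt pscale F N \<and>
        (\<forall>(z', l')\<in>V. in_chart i l' \<and> (z', theta i l') \<in> N \<longrightarrow> a (z', l') = F (z', theta i l'))))"


section \<open>Hermitian holomorphic line bundles\<close>

text \<open>The fibres are lines in a space of functions, and the holomorphic structure is given by
  local frames, which are declared to be holomorphic.\<close>

record ('m::finite, 't::finite) line_bundle =
  base :: "('m, 't) bpoint set"
  fibre :: "('m, 't) bpoint \<Rightarrow> (complex^'m \<Rightarrow> complex) set"
  metric :: "('m, 't) bpoint \<Rightarrow> (complex^'m \<Rightarrow> complex) \<Rightarrow> (complex^'m \<Rightarrow> complex) \<Rightarrow> complex"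
  frame_dom :: "'t \<Rightarrow> ('m, 't) bpoint set"
  frame :: "'t \<Rightarrow> ('m, 't) bpoint \<Rightarrow> complex^'m \<Rightarrow> complex"

text \<open>An isometric holomorphic bundle isomorphism over the identity of the base; holomorphy of
  the map means that its coefficients with respect to the frames are holomorphic.\<close>

definition bundle_equivalent ::
    "('m::finite, 't::finite) line_bundle \<Rightarrow> ('m, 't) line_bundle \<Rightarrow> bool"
  where "bundle_equivalent L L' \<longleftrightarrow> base L = base L' \<and>
    (\<exists>\<Phi>. (\<forall>x\<in>base L.
            bij_betw (\<Phi> x) (fibre L x) (fibre L' x) \<and>
            (\<forall>v\<in>fibre L x. \<forall>v'\<in>fibre L x. \<Phi> x (v + v') = \<Phi> x v + \<Phi> x v') \<and>
            (\<forall>c. \<forall>v\<in>fibre L x. \<Phi> x (cscale c v) = cscale c (\<Phi> x v)) \<and>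
            (\<forall>v\<in>fibre L x. \<forall>v'\<in>fibre L x. metric L' x (\<Phi> x v) (\<Phi> x v') = metric L x v v')) \<and>
         (\<forall>i j. \<exists>a. hol_fun_on (frame_dom L i \<inter> frame_dom L' j) a \<and>
            (\<forall>x\<in>frame_dom L i \<inter> frame_dom L' j. \<Phi> x (frame L i x) = cscale (a x) (frame L' j x))))"

definition sect ::
    "('t::finite \<Rightarrow> complex^'m::finite \<Rightarrow> complex^'m \<Rightarrow> complex) \<Rightarrow> 't \<Rightarrow> ('m, 't) bpoint \<Rightarrow> complex^'m \<Rightarrow> complex"
  where "sect Kd i x =
    Kd i (fst x) + (\<Sum>j\<in>UNIV - {i}. cscale (cnj (theta i (snd x) $ j)) (Kd j (fst x)))"

text \<open>The frame at a point of the conjugated base is the section \<open>sect Kd i\<close>, antiholomorphic on the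
  monoidal transform, at the corresponding point. On chart overlaps these sections differ by nonzero scalar factors, so the union over
  \<open>i\<close> that defines a fibre is a union of equal lines.\<close>

definition kernel_bundle ::
    "'m::finite hilb \<Rightarrow> (complex^'m) set \<Rightarrow> ('t::finite \<Rightarrow> complex^'m \<Rightarrow> complex) \<Rightarrow>
     ('t \<Rightarrow> complex^'m \<Rightarrow> complex^'m \<Rightarrow> complex) \<Rightarrow> ('m, 't) line_bundle"
  where "kernel_bundle M \<Delta> g Kd =
    \<lparr>base = monoidal_transform_conj \<Delta> g,
     fibre = (\<lambda>x. \<Union>i\<in>{i. in_chart i (snd x)}. cfun.span {sect Kd i (conj_pt x)}),
     metric = (\<lambda>x. ip M),
     frame_dom = (\<lambda>i. {x \<in> monoidal_transform_conj \<Delta> g. in_chart i (snd x)}),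
     frame = (\<lambda>i x. sect Kd i (conj_pt x))\<rparr>"

end

theory Submission
  imports Defs "HOL-Complex_Analysis.Conformal_Mappings"
begin

text \<open>
  The bundles consist of lines inside the Hilbert spaces. Over a point \<open>w\<close> off the zero set
  \<open>Z\<close> of the generators the line is spanned by the kernel function \<open>K(\<cdot>, w)\<close>, and over the
  exceptional set by the limits of these lines. So both directions compare how an operator acts on
  kernel functions.

  Let the bundles be equivalent. On a ball off \<open>Z\<close> the isometry gives
  \<open>K(w, w) = \<bar>c w\<bar>\<^sup>2 K'(w, w)\<close> for an antiholomorphic function \<open>c\<close> without zeros. By polarization
  \<open>K(z, w) = cnj (c z) * c w * K'(z, w)\<close>. As the kernel functions at points of a ball span a dense
  subspace, \<open>K(\<cdot>, w) \<mapsto> c w * K'(\<cdot>, w)\<close> extends to a unitary operator. On the ball this operator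
  is division by \<open>cnj c\<close>, so by the identity theorem it commutes with multiplication by polynomials
  (\<open>module_equivalent_if_kernels_rescaled\<close>, \<open>module_equivalent_if_bundle_equivalent\<close>).

  Conversely let \<open>U\<close> be a unitary module map. For \<open>p\<close> and \<open>q\<close> in the ideal
  \<open>p * U q = U (p * q) = q * U p\<close>, so by density \<open>U\<close> is multiplication by a function off \<open>Z\<close>, and it
  maps \<open>K(\<cdot>, w)\<close> to a multiple of \<open>K'(\<cdot>, w)\<close> (\<open>U_kernel\<close>). Hence \<open>U\<close> maps fibres to
  fibres off the exceptional set. The exceptional set is reached by continuity, provided that every
  \<open>(p, \<pi>(u))\<close> with \<open>p \<in> Z\<close> is the limit of points \<open>(w, \<pi>(u))\<close> of the monoidal transform with
  \<open>w \<notin> Z\<close> (\<open>zero_set_direction\<close>). This is where smoothness of \<open>Z\<close> and its codimension \<open>t\<close> enter: the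
  condition that \<open>g w\<close> is proportional to \<open>u\<close>, together with equations that cut \<open>Z\<close> down to \<open>p\<close>, is a
  system of \<open>m - 1\<close> equations in \<open>m\<close> unknowns, and the solution \<open>p\<close> of such a system is never isolated.
  The latter fact (\<open>common_zero_on_sphere\<close>) is proved by the maximum principle for a
  function that is strictly subharmonic along suitable complex lines. Finally the coefficient of \<open>U\<close>
  with respect to the frames is a quotient of inner products that depend holomorphically on the
  coordinates of the monoidal transform (\<open>bundle_equivalent_if_fibrewise\<close>).
\<close>

section \<open>Holomorphic functions of several variables\<close>

lemma norm_cmult_vec: "norm (c *s (v :: complex^'n)) = cmod c * norm v"
proof -
  have "(\<Sum>i\<in>UNIV. (cmod c * cmod (v $ i))\<^sup>2) = (cmod c)\<^sup>2 * (\<Sum>i\<in>UNIV. (cmod (v $ i))\<^sup>2)"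
    by (simp add: power_mult_distrib sum_distrib_left)
  then show ?thesis
    by (simp add: norm_vec_def L2_set_def norm_mult real_sqrt_mult)
qed

lemma bounded_linear_cmult_vec: "bounded_linear (\<lambda>c. c *s (v :: complex^'n))"
  by (rule bounded_linear_intro[where K="norm v"])
     (auto simp: norm_cmult_vec vec_eq_iff algebra_simps)

lemma continuous_on_cmult_vec [continuous_intros]:
  "continuous_on S f \<Longrightarrow> continuous_on S (\<lambda>x. f x *s (v :: complex^'n))"
  by (rule bounded_linear.continuous_on[OF bounded_linear_cmult_vec])

lemma hol_wrt_subset: "hol_wrt sc f S \<Longrightarrow> T \<subseteq> S \<Longrightarrow> hol_wrt sc f T"
  by (auto simp: hol_wrt_def)

lemma hol_wrt_imp_continuous_on: "hol_wrt sc f S \<Longrightarrow> continuous_on S f"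
  unfolding hol_wrt_def
  by (meson continuous_at_imp_continuous_on has_derivative_continuous)

lemma hol_wrt_const: "hol_wrt sc (\<lambda>x. a) S"
  unfolding hol_wrt_def by (intro ballI exI[of _ "\<lambda>h. 0"]) auto

lemma hol_wrt_add:
  assumes "hol_wrt sc f S" "hol_wrt sc g S"
  shows "hol_wrt sc (\<lambda>x. f x + g x) S"
  unfolding hol_wrt_def
proof
  fix x assume "x \<in> S"
  then obtain D D' where "(f has_derivative D) (at x)" "(g has_derivative D') (at x)"
    "\<forall>c v. D (sc c v) = c * D v" "\<forall>c v. D' (sc c v) = c * D' v"
    using assms unfolding hol_wrt_def by metis
  then show "\<exists>D. ((\<lambda>x. f x + g x) has_derivative D) (at x) \<and> (\<forall>c v. D (sc c v) = c * D v)"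
    by (intro exI[of _ "\<lambda>h. D h + D' h"]) (auto intro!: derivative_eq_intros simp: algebra_simps)
qed

lemma hol_wrt_sum:
  assumes "\<And>i. i \<in> A \<Longrightarrow> hol_wrt sc (f i) S"
  shows "hol_wrt sc (\<lambda>x. \<Sum>i\<in>A. f i x) S"
  using assms
proof (induction A rule: infinite_finite_induct)
  case (insert i A)
  then have "hol_wrt sc (\<lambda>x. f i x + (\<Sum>i\<in>A. f i x)) S"
    by (intro hol_wrt_add) auto
  with insert show ?case by simp
qed (auto simp: hol_wrt_const)

lemma hol_wrt_mult:
  assumes "hol_wrt sc f S" "hol_wrt sc g S"
  shows "hol_wrt sc (\<lambda>x. f x * g x) S"
  unfolding hol_wrt_def
proof
  fix x assume "x \<in> S"
  then obtain D D' where "(f has_derivative D) (at x)" "(g has_derivative D') (at x)"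
    "\<forall>c v. D (sc c v) = c * D v" "\<forall>c v. D' (sc c v) = c * D' v"
    using assms unfolding hol_wrt_def by metis
  then show "\<exists>D. ((\<lambda>x. f x * g x) has_derivative D) (at x) \<and> (\<forall>c v. D (sc c v) = c * D v)"
    by (intro exI[of _ "\<lambda>h. f x * D' h + D h * g x"])
       (auto intro!: derivative_eq_intros simp: algebra_simps)
qed

lemma hol_wrt_inverse:
  assumes "hol_wrt sc f S" "\<And>x. x \<in> S \<Longrightarrow> f x \<noteq> 0"
  shows "hol_wrt sc (\<lambda>x. inverse (f x)) S"
  unfolding hol_wrt_def
proof
  fix x assume "x \<in> S"
  then obtain D where "(f has_derivative D) (at x)" "\<forall>c v. D (sc c v) = c * D v" "f x \<noteq> 0"
    using assms unfolding hol_wrt_def by metis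
  then show "\<exists>D. ((\<lambda>x. inverse (f x)) has_derivative D) (at x) \<and> (\<forall>c v. D (sc c v) = c * D v)"
    by (intro exI[of _ "\<lambda>h. - (inverse (f x) * D h * inverse (f x))"])
       (auto intro!: derivative_eq_intros simp: algebra_simps)
qed

lemma hol_wrt_divide:
  assumes "hol_wrt sc f S" "hol_wrt sc g S" "\<And>x. x \<in> S \<Longrightarrow> g x \<noteq> 0"
  shows "hol_wrt sc (\<lambda>x. f x / g x) S"
  unfolding divide_inverse using assms by (intro hol_wrt_mult hol_wrt_inverse)

lemma hol_on_line_derivative:
  fixes f :: "complex^'n \<Rightarrow> complex"
  assumes "(f has_derivative D) (at (a + \<tau> *s v))" "\<forall>c v. D (c *s v) = c * D v"
  shows "((\<lambda>\<tau>. f (a + \<tau> *s v)) has_field_derivative D v) (at \<tau>)"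
proof -
  have "((\<lambda>\<tau>. a + \<tau> *s v) has_derivative (\<lambda>h. h *s v)) (at \<tau>)"
    using has_derivative_add[OF has_derivative_const bounded_linear_imp_has_derivative[OF bounded_linear_cmult_vec]]
    by simp
  from has_derivative_compose[OF this assms(1)] assms(2) show ?thesis
    by (simp add: has_field_derivative_def mult.commute[of "D v"] fun_eq_iff mult_commute_abs)
qed

lemma holomorphic_on_line:
  assumes "hol_on f S"
  shows "(\<lambda>\<tau>. f (a + \<tau> *s v)) holomorphic_on {\<tau>. a + \<tau> *s v \<in> S}"
  unfolding holomorphic_on_def
proof
  fix \<tau> assume "\<tau> \<in> {\<tau>. a + \<tau> *s v \<in> S}"
  then obtain D where D: "(f has_derivative D) (at (a + \<tau> *s v))" "\<forall>c v. D (c *s v) = c * D v"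
    using assms unfolding hol_wrt_def by blast
  have "(\<lambda>\<tau>. f (a + \<tau> *s v)) field_differentiable at \<tau>"
    using hol_on_line_derivative[OF D] by (auto simp: field_differentiable_def)
  then show "(\<lambda>\<tau>. f (a + \<tau> *s v)) field_differentiable at \<tau> within {\<tau>. a + \<tau> *s v \<in> S}"
    by (rule field_differentiable_at_within)
qed

lemma holomorphic_on_cnj_line:
  fixes f :: "complex^'n \<Rightarrow> complex"
  assumes "hol_on f S"
  shows "(\<lambda>\<tau>. cnj (f (a + cnj \<tau> *s v))) holomorphic_on {\<tau>. a + cnj \<tau> *s v \<in> S}"
  unfolding holomorphic_on_def
proof
  fix \<tau> assume "\<tau> \<in> {\<tau>. a + cnj \<tau> *s v \<in> S}"
  then obtain D where D: "(f has_derivative D) (at (a + cnj \<tau> *s v))" "\<forall>c v. D (c *s v) = c * D v"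
    using assms unfolding hol_wrt_def by blast
  have "((\<lambda>\<tau>. a + cnj \<tau> *s v) has_derivative (\<lambda>h. cnj h *s v)) (at \<tau>)"
    using has_derivative_add[OF has_derivative_const bounded_linear_imp_has_derivative[OF
        bounded_linear_compose[OF bounded_linear_cmult_vec bounded_linear_cnj]], of a v "at \<tau>"] by simp
  from bounded_linear.has_derivative[OF bounded_linear_cnj has_derivative_compose[OF this D(1)]]
  have "((\<lambda>\<tau>. cnj (f (a + cnj \<tau> *s v))) has_field_derivative cnj (D v)) (at \<tau>)"
    using D(2) by (simp add: has_field_derivative_def mult_commute_abs)
  then have "(\<lambda>\<tau>. cnj (f (a + cnj \<tau> *s v))) field_differentiable at \<tau>"
    by (auto simp: field_differentiable_def)
  then show "(\<lambda>\<tau>. cnj (f (a + cnj \<tau> *s v))) field_differentiable at \<tau> within {\<tau>. a + cnj \<tau> *s v \<in> S}"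
    by (rule field_differentiable_at_within)
qed

lemma open_line_preimage: "open S \<Longrightarrow> open {\<tau>. a + \<tau> *s (v::complex^'n) \<in> S}"
  using open_vimage[of S "\<lambda>\<tau>. a + \<tau> *s v"]
  by (simp add: vimage_def continuous_on_add continuous_on_cmult_vec continuous_on_id)

lemma convex_line_preimage:
  assumes "convex S"
  shows "convex {\<tau>. a + \<tau> *s (v::complex^'n) \<in> S}"
proof (rule convexI)
  fix x y and u w :: real
  assume *: "x \<in> {\<tau>. a + \<tau> *s v \<in> S}" "y \<in> {\<tau>. a + \<tau> *s v \<in> S}" "0 \<le> u" "0 \<le> w" "u + w = 1"
  have "a + (u *\<^sub>R x + w *\<^sub>R y) *s v = u *\<^sub>R (a + x *s v) + w *\<^sub>R (a + y *s v)"
  proof -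
    have w: "complex_of_real w = 1 - complex_of_real u"
      using *(5) by (metis add_diff_cancel_left' of_real_1 of_real_diff)
    show ?thesis
      by (simp only: vec_eq_iff vector_scaleR_component vector_add_component vector_smult_component
          scaleR_conv_of_real[where 'a=complex] w) (simp add: algebra_simps)
  qed
  then show "u *\<^sub>R x + w *\<^sub>R y \<in> {\<tau>. a + \<tau> *s v \<in> S}"
    using convexD[OF assms, of "a + x *s v" "a + y *s v" u w] * by simp
qed

text \<open>The interior of the zero set spreads over every ball in the domain that it meets, because any
  two points of a ball lie on a complex line whose trace on the ball is convex, and there the
  one-variable identity theorem applies. Hence this interior is closed in \<open>\<Omega>\<close>.\<close>

lemma hol_on_identity:
  assumes f: "hol_on f \<Omega>" and \<Omega>: "open \<Omega>" "connected \<Omega>"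
    and W: "open W" "W \<noteq> {}" "W \<subseteq> \<Omega>" "\<And>z. z \<in> W \<Longrightarrow> f z = 0"
    and z: "z \<in> \<Omega>"
  shows "f z = 0"
proof -
  define A where "A = interior {z \<in> \<Omega>. f z = 0}"
  have ball_A: "ball q e \<subseteq> A" if q: "ball q e \<subseteq> \<Omega>" and x: "x \<in> ball q e" "x \<in> A" for q x e
  proof -
    have "f y = 0" if y: "y \<in> ball q e" for y
    proof -
      define T where "T = {\<tau>. x + \<tau> *s (y - x) \<in> ball q e}"
      have T: "open T" "connected T"
        unfolding T_def by (intro open_line_preimage convex_connected convex_line_preimage open_ball convex_ball)+
      have hol: "(\<lambda>\<tau>. f (x + \<tau> *s (y - x))) holomorphic_on T"
        unfolding T_def using f q by (intro holomorphic_on_line) (auto intro: hol_wrt_subset)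
      have "open {\<tau>. x + \<tau> *s (y - x) \<in> A \<inter> ball q e}"
        by (intro open_line_preimage) (auto simp: A_def)
      then have "(\<lambda>\<tau>. f (x + \<tau> *s (y - x))) 1 = 0"
      proof (rule analytic_continuation_open[OF _ T(1) _ T(2) _ hol, where g = "\<lambda>_. 0"])
        have "0 \<in> {\<tau>. x + \<tau> *s (y - x) \<in> A \<inter> ball q e}" using x by simp
        then show "{\<tau>. x + \<tau> *s (y - x) \<in> A \<inter> ball q e} \<noteq> {}" by blast
        show "1 \<in> T" using y by (simp add: T_def)
        show "{\<tau>. x + \<tau> *s (y - x) \<in> A \<inter> ball q e} \<subseteq> T" by (auto simp: T_def)
        fix \<tau> assume "\<tau> \<in> {\<tau>. x + \<tau> *s (y - x) \<in> A \<inter> ball q e}"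
        then show "f (x + \<tau> *s (y - x)) = 0"
          using interior_subset[of "{z \<in> \<Omega>. f z = 0}"] unfolding A_def by blast
      qed simp
      then show ?thesis by simp
    qed
    with q show ?thesis unfolding A_def by (intro interior_maximal) auto
  qed
  have "W \<subseteq> A"
    using W unfolding A_def by (intro interior_maximal) auto
  moreover have "open A" by (simp add: A_def)
  moreover have "open (\<Omega> - A)"
    unfolding open_contains_ball
  proof
    fix q assume q: "q \<in> \<Omega> - A"
    then obtain e where e: "e > 0" "ball q e \<subseteq> \<Omega>"
      using \<Omega>(1) open_contains_ball by blast
    have "x \<notin> A" if "x \<in> ball q e" for x
    proof
      assume "x \<in> A"
      from ball_A[OF e(2) that this] e(1) have "q \<in> A" by auto
      with q show False by simp
    qed
    with e show "\<exists>e>0. ball q e \<subseteq> \<Omega> - A" by blast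
  qed
  moreover have "A \<subseteq> \<Omega>" using interior_subset[of "{z \<in> \<Omega>. f z = 0}"] by (auto simp: A_def)
  ultimately have "A = \<Omega>"
    using \<Omega>(2) W(2) connectedD[of \<Omega> A "\<Omega> - A"] by blast
  with z show ?thesis
    using interior_subset[of "{z \<in> \<Omega>. f z = 0}"] by (auto simp: A_def)
qed

section \<open>Systems with fewer equations than unknowns\<close>

text \<open>The functionals are placed as rows of a square matrix; as there are fewer of them than
  coordinates, some row is zero, so the matrix is singular.\<close>

lemma common_kernel_vector:
  fixes D :: "'i \<Rightarrow> complex^'n \<Rightarrow> complex"
  assumes S: "finite S" "card S < CARD('n)"
    and D: "\<And>i. i \<in> S \<Longrightarrow> linear (D i)" "\<And>i c v. i \<in> S \<Longrightarrow> D i (c *s v) = c * D i v"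
  shows "\<exists>v. v \<noteq> 0 \<and> (\<forall>i\<in>S. D i v = 0)"
proof -
  obtain e :: "'i \<Rightarrow> 'n" where e: "inj_on e S"
    using S by (metis card_le_inj finite less_imp_le subset_UNIV)
  define A :: "complex^'n^'n" where
    "A = (\<chi> k j. if k \<in> e ` S then D (the_inv_into S e k) (axis j 1) else 0)"
  have Av: "(A *v v) $ (e i) = D i v" if "i \<in> S" for i v
  proof -
    have "v = (\<Sum>j\<in>UNIV. v $ j *s axis j 1)"
      by (simp add: basis_expansion)
    then have "D i v = (\<Sum>j\<in>UNIV. v $ j * D i (axis j 1))"
      by (subst (1) \<open>v = _\<close>, subst linear_sum[OF D(1)[OF that]]) (simp add: D(2)[OF that])
    then show ?thesis
      using that e by (simp add: A_def matrix_vector_mult_def the_inv_into_f_f mult.commute)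
  qed
  have "card (e ` S) < CARD('n)" using S(2) e by (simp add: card_image)
  then obtain k where k: "k \<notin> e ` S" by (metis UNIV_eq_I less_irrefl)
  have "(A *v v) $ k = 0" for v
    using k by (simp add: A_def matrix_vector_mult_def)
  then have "A *v v \<noteq> axis k 1" for v
    by (metis axis_nth zero_neq_one)
  then have "\<not> (\<exists>B. A ** B = mat 1)"
    by (metis matrix_vector_mul_assoc matrix_vector_mul_lid)
  then have "\<not> (\<forall>v. A *v v = 0 \<longrightarrow> v = 0)"
    by (metis matrix_left_invertible_ker matrix_left_right_inverse)
  then obtain v where "v \<noteq> 0" "A *v v = 0" by blast
  with Av show ?thesis by (metis zero_index)
qed

text \<open>At a critical point one has \<open>\<phi> z = \<phi> 0 + z\<^sup>2 * \<psi> z\<close> with \<open>\<psi>\<close> holomorphic. Averaging over the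
  four points \<open>\<i>\<^sup>k * s\<close> cancels the quadratic term, since \<open>(\<i>\<^sup>k)\<^sup>2 = (-1)\<^sup>k\<close>, so that the
  mean of \<open>\<bar>\<phi>\<bar>\<^sup>2\<close> exceeds its central value by \<open>o(s\<^sup>2)\<close> only. This is the vanishing of the Levi
  form of \<open>\<bar>\<phi>\<bar>\<^sup>2\<close>, in a version that needs no integrals.\<close>

lemma critical_four_point_average:
  fixes \<phi> :: "complex \<Rightarrow> complex"
  assumes hol: "\<phi> holomorphic_on S" and S: "open S" "0 \<in> S" and crit: "deriv \<phi> 0 = 0"
  shows "((\<lambda>s::real. ((\<Sum>k<4. (cmod (\<phi> (\<i>^k * s)))\<^sup>2) - 4 * (cmod (\<phi> 0))\<^sup>2) / s\<^sup>2) \<longlongrightarrow> 0) (at_right 0)"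
proof -
  define \<phi>1 where "\<phi>1 = (\<lambda>z. if z = 0 then deriv \<phi> 0 else (\<phi> z - \<phi> 0) / (z - 0))"
  define \<psi> where "\<psi> = (\<lambda>z. if z = 0 then deriv \<phi>1 0 else (\<phi>1 z - \<phi>1 0) / (z - 0))"
  have "\<psi> holomorphic_on S"
    unfolding \<psi>_def \<phi>1_def by (intro pole_lemma_open hol S)
  then have "isCont \<psi> 0"
    using S holomorphic_on_imp_continuous_on continuous_on_eq_continuous_at by blast
  then have lim: "((\<lambda>s::real. \<psi> (\<i>^k * s)) \<longlongrightarrow> \<psi> 0) (at_right 0)" for k
    by (intro isCont_tendsto_compose[where g=\<psi>]) (auto intro!: tendsto_eq_intros)
  have \<phi>: "\<phi> z = \<phi> 0 + z\<^sup>2 * \<psi> z" for z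
    using crit by (simp add: \<psi>_def \<phi>1_def power2_eq_square field_simps)
  have expand: "(cmod (\<phi> z))\<^sup>2 = (cmod (\<phi> 0))\<^sup>2 + 2 * Re (cnj (\<phi> 0) * z\<^sup>2 * \<psi> z) + (cmod z ^ 2 * cmod (\<psi> z))\<^sup>2" for z
  proof -
    have "(cmod (a + b))\<^sup>2 = (cmod a)\<^sup>2 + 2 * Re (cnj a * b) + (cmod b)\<^sup>2" for a b
      unfolding cmod_power2 by (simp add: power2_eq_square algebra_simps)
    from this[of "\<phi> 0" "z\<^sup>2 * \<psi> z"] show ?thesis
      unfolding \<phi>[of z, symmetric] by (simp add: norm_mult norm_power mult.assoc)
  qed
  have ipow: "(\<i>^k * complex_of_real s)\<^sup>2 = (-1)^k * of_real s^2" for k s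
  proof -
    have "(\<i>^k)\<^sup>2 = (\<i>\<^sup>2)^k" by (simp only: power_mult[symmetric] mult.commute[of k 2])
    then show ?thesis by (simp add: power_mult_distrib)
  qed
  have eq: "((\<Sum>k<4. (cmod (\<phi> (\<i>^k * s)))\<^sup>2) - 4 * (cmod (\<phi> 0))\<^sup>2) / s\<^sup>2 =
     (\<Sum>k<4. 2 * Re (cnj (\<phi> 0) * (-1)^k * \<psi> (\<i>^k * s)) + (s * cmod (\<psi> (\<i>^k * s)))\<^sup>2)"
    if "s > 0" for s :: real
  proof -
    have "(cmod (\<phi> (\<i>^k * s)))\<^sup>2 = (cmod (\<phi> 0))\<^sup>2 +
       s\<^sup>2 * (2 * Re (cnj (\<phi> 0) * (-1)^k * \<psi> (\<i>^k * s)) + (s * cmod (\<psi> (\<i>^k * s)))\<^sup>2)" for k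
    proof -
      have "Re (cnj (\<phi> 0) * ((-1)^k * of_real s^2) * \<psi> (\<i>^k * s)) = s\<^sup>2 * Re (cnj (\<phi> 0) * (-1)^k * \<psi> (\<i>^k * s))"
      proof -
        have "cnj (\<phi> 0) * ((-1)^k * of_real s^2) * \<psi> (\<i>^k * s) = of_real (s^2) * (cnj (\<phi> 0) * (-1)^k * \<psi> (\<i>^k * s))"
          by simp
        then show ?thesis
          by (simp only: times_complex.sel Re_complex_of_real Im_complex_of_real)
      qed
      then show ?thesis
        unfolding expand[of "\<i>^k * s"] ipow
        by (simp add: norm_mult norm_power algebra_simps power_mult_distrib)
    qed
    then show ?thesis
      using that by (simp add: sum.distrib flip: sum_distrib_left)
  qed
  have "((\<lambda>s::real. \<Sum>k<4. 2 * Re (cnj (\<phi> 0) * (-1)^k * \<psi> (\<i>^k * s)) + (s * cmod (\<psi> (\<i>^k * s)))\<^sup>2)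
     \<longlongrightarrow> (\<Sum>k<4. 2 * Re (cnj (\<phi> 0) * (-1)^k * \<psi> 0) + (0 * cmod (\<psi> 0))\<^sup>2)) (at_right 0)"
    by (intro tendsto_intros lim)
  moreover have "(\<Sum>k<4. 2 * Re (cnj (\<phi> 0) * (-1)^k * \<psi> 0) + (0 * cmod (\<psi> 0))\<^sup>2) = 0"
    by (simp add: eval_nat_numeral)
  ultimately have "((\<lambda>s::real. \<Sum>k<4. 2 * Re (cnj (\<phi> 0) * (-1)^k * \<psi> (\<i>^k * s)) + (s * cmod (\<psi> (\<i>^k * s)))\<^sup>2)
     \<longlongrightarrow> 0) (at_right 0)" by simp
  then show ?thesis
    by (rule tendsto_cong[THEN iffD1, rotated])
       (auto simp: eq eventually_at_right_less intro!: eventually_at_rightI[of 0 1])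
qed


lemma four_point_average_norm:
  fixes x v :: "complex^'n"
  shows "(\<Sum>k<4. (norm (x + (\<i>^k * complex_of_real s) *s v))\<^sup>2) = 4 * (norm x)\<^sup>2 + 4 * s\<^sup>2 * (norm v)\<^sup>2"
proof -
  have par: "(norm (x + a))\<^sup>2 + (norm (x - a))\<^sup>2 = 2 * (norm x)\<^sup>2 + 2 * (norm a)\<^sup>2" for a :: "complex^'n"
    by (simp add: dot_square_norm[symmetric] algebra_simps inner_commute)
  have "(- \<i> * s) *s v = - ((\<i> * s) *s v)" "(- complex_of_real s) *s v = - (s *s v)"
    by (simp_all add: vec_eq_iff)
  then have "(\<Sum>k<4. (norm (x + (\<i>^k * complex_of_real s) *s v))\<^sup>2) =
      ((norm (x + complex_of_real s *s v))\<^sup>2 + (norm (x - complex_of_real s *s v))\<^sup>2) +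
      ((norm (x + (\<i> * complex_of_real s) *s v))\<^sup>2 + (norm (x - (\<i> * complex_of_real s) *s v))\<^sup>2)"
    by (simp add: eval_nat_numeral)
  then show ?thesis
    unfolding par by (simp add: norm_cmult_vec norm_mult power_mult_distrib)
qed

text \<open>A substitute for the dimension theory of analytic sets. If the \<open>f i\<close> had no common zero on the
  sphere, then for a large constant \<open>A\<close> the function \<open>\<Psi> w = \<bar>w - p\<bar>\<^sup>2 - A * (\<Sum>i. \<bar>f i w\<bar>\<^sup>2)\<close> would be negative on the sphere
  while \<open>\<Psi> p = 0\<close>, so it would be maximal at an interior point \<open>x\<close>. There are too few differentials
  to separate directions, so they all vanish in some direction \<open>v \<noteq> 0\<close> at \<open>x\<close>. Along the complex
  line through \<open>x\<close> in direction \<open>v\<close> the functions \<open>\<bar>f i\<bar>\<^sup>2\<close> do not change to second order on average,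
  whereas \<open>\<bar>w - p\<bar>\<^sup>2\<close> is strictly subharmonic, and this contradicts maximality.\<close>

theorem common_zero_on_sphere:
  fixes f :: "'i \<Rightarrow> complex^'n \<Rightarrow> complex"
  assumes S: "finite S" "card S < CARD('n)"
    and N: "cball p \<rho> \<subseteq> N" "\<rho> > 0"
    and f: "\<And>i. i \<in> S \<Longrightarrow> hol_on (f i) N" "\<And>i. i \<in> S \<Longrightarrow> f i p = 0"
  shows "\<exists>w. dist w p = \<rho> \<and> (\<forall>i\<in>S. f i w = 0)"
proof (rule ccontr)
  assume none: "\<not> ?thesis"
  define F where "F = (\<lambda>w. \<Sum>i\<in>S. (cmod (f i w))\<^sup>2)"
  have "continuous_on (cball p \<rho>) (f i)" if "i \<in> S" for i
    using hol_wrt_imp_continuous_on[OF f(1)[OF that]] N(1) by (rule continuous_on_subset)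
  then have F_cont: "continuous_on (cball p \<rho>) F"
    unfolding F_def by (intro continuous_intros)
  have "sphere p \<rho> \<noteq> {}" using N(2) by (simp add: not_less)
  moreover have "continuous_on (sphere p \<rho>) F"
    using F_cont by (rule continuous_on_subset) auto
  ultimately have "\<exists>w1\<in>sphere p \<rho>. \<forall>w\<in>sphere p \<rho>. F w1 \<le> F w"
    using continuous_attains_inf[OF compact_sphere] by blast
  then obtain w1 where w1: "w1 \<in> sphere p \<rho>" "\<And>w. w \<in> sphere p \<rho> \<Longrightarrow> F w1 \<le> F w"
    by blast
  have "\<exists>i\<in>S. f i w1 \<noteq> 0" using none w1(1) by (auto simp: dist_commute)
  then have pos: "F w1 > 0"
    unfolding F_def using S(1) by (auto intro!: sum_pos2)
  \<comment> \<open>Large enough to make \<open>A * F\<close> exceed \<open>\<rho>\<^sup>2\<close> on the whole sphere.\<close>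
  define A where "A = (\<rho>\<^sup>2 + 1) / F w1"
  have A: "A > 0" using pos by (auto simp: A_def intro!: divide_pos_pos add_nonneg_pos)
  define \<Psi> where "\<Psi> = (\<lambda>w. (norm (w - p))\<^sup>2 - A * F w)"
  have "continuous_on (cball p \<rho>) \<Psi>"
    unfolding \<Psi>_def by (intro continuous_intros F_cont)
  moreover have "p \<in> cball p \<rho>" using N(2) by simp
  ultimately have "\<exists>x\<in>cball p \<rho>. \<forall>w\<in>cball p \<rho>. \<Psi> w \<le> \<Psi> x"
    by (intro continuous_attains_sup) auto
  then obtain x where x: "x \<in> cball p \<rho>" "\<And>w. w \<in> cball p \<rho> \<Longrightarrow> \<Psi> w \<le> \<Psi> x"
    by blast
  have "\<Psi> p = 0" using f(2) by (simp add: \<Psi>_def F_def)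
  with x(2)[OF \<open>p \<in> cball p \<rho>\<close>] have x_nonneg: "\<Psi> x \<ge> 0" by simp
  have "x \<notin> sphere p \<rho>"
  proof
    assume xs: "x \<in> sphere p \<rho>"
    have "A * F w1 = \<rho>\<^sup>2 + 1" using pos by (simp add: A_def)
    moreover have "A * F w1 \<le> A * F x" using A w1(2)[OF xs] by simp
    moreover have "norm (x - p) = \<rho>" using xs by (simp add: dist_norm norm_minus_commute)
    ultimately have "\<Psi> x < 0" by (simp add: \<Psi>_def)
    with x_nonneg show False by simp
  qed
  with x(1) have xb: "x \<in> ball p \<rho>" by auto
  have xN: "x \<in> N" using x(1) N(1) by blast
  have "\<forall>i\<in>S. \<exists>D. (f i has_derivative D) (at x) \<and> (\<forall>c v. D (c *s v) = c * D v)"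
    using f(1) xN unfolding hol_wrt_def by blast
  then obtain D where D: "\<And>i. i \<in> S \<Longrightarrow> (f i has_derivative D i) (at x)"
      "\<And>i c v. i \<in> S \<Longrightarrow> D i (c *s v) = c * D i v"
    by metis
  obtain v where v: "v \<noteq> 0" "\<And>i. i \<in> S \<Longrightarrow> D i v = 0"
    using common_kernel_vector[OF S, of D] D has_derivative_linear by metis
  define T where "T = {\<tau>. x + \<tau> *s v \<in> ball p \<rho>}"
  have T: "open T" "0 \<in> T"
    using xb open_line_preimage[OF open_ball] by (auto simp: T_def)
  have lim_i: "((\<lambda>s::real. ((\<Sum>k<4. (cmod (f i (x + (\<i>^k * s) *s v)))\<^sup>2) - 4 * (cmod (f i x))\<^sup>2) / s\<^sup>2) \<longlongrightarrow> 0) (at_right 0)"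
    if i: "i \<in> S" for i
  proof -
    have "hol_on (f i) (ball p \<rho>)"
      by (rule hol_wrt_subset[OF f(1)[OF i]]) (use N(1) in auto)
    then have "(\<lambda>\<tau>. f i (x + \<tau> *s v)) holomorphic_on T"
      unfolding T_def by (rule holomorphic_on_line)
    moreover have "deriv (\<lambda>\<tau>. f i (x + \<tau> *s v)) 0 = 0"
      using hol_on_line_derivative[of "f i" "D i" x 0 v] D(1)[OF i] D(2)[OF i] v(2)[OF i]
      by (intro DERIV_imp_deriv) simp
    ultimately show ?thesis
      using critical_four_point_average[of "\<lambda>\<tau>. f i (x + \<tau> *s v)" T] T by simp
  qed
  have "((\<lambda>s::real. \<Sum>i\<in>S. ((\<Sum>k<4. (cmod (f i (x + (\<i>^k * s) *s v)))\<^sup>2) - 4 * (cmod (f i x))\<^sup>2) / s\<^sup>2) \<longlongrightarrow> (\<Sum>i\<in>S. 0)) (at_right 0)"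
    by (intro tendsto_sum lim_i)
  then have limF: "((\<lambda>s::real. ((\<Sum>k<4. F (x + (\<i>^k * s) *s v)) - 4 * F x) / s\<^sup>2) \<longlongrightarrow> 0) (at_right 0)"
    by (simp add: F_def sum_divide_distrib[symmetric] sum_subtractf sum_distrib_left sum.swap[of _ S "{..<4}"])
  \<comment> \<open>What \<open>\<bar>w - p\<bar>\<^sup>2\<close> gains per \<open>s\<^sup>2\<close> at the four points together, divided by the weight of \<open>F\<close>
    in \<open>\<Psi>\<close>.\<close>
  define c where "c = 4 * (norm v)\<^sup>2 / A"
  have c: "c > 0" using v(1) A by (simp add: c_def)
  have "\<forall>\<^sub>F s::real in at_right 0. ((\<Sum>k<4. F (x + (\<i>^k * s) *s v)) - 4 * F x) / s\<^sup>2 < c"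
    using limF c by (rule order_tendstoD)
  moreover have "\<forall>\<^sub>F s::real in at_right 0. (\<i>^k * s) \<in> T" for k
  proof -
    have "((\<lambda>s::real. \<i>^k * s) \<longlongrightarrow> \<i>^k * of_real 0) (at_right 0)"
      by (intro tendsto_intros)
    then show ?thesis using T topological_tendstoD by fastforce
  qed
  then have "\<forall>\<^sub>F s::real in at_right 0. \<forall>k\<in>{..<4::nat}. (\<i>^k * s) \<in> T"
    by (intro eventually_ball_finite) auto
  moreover have "\<forall>\<^sub>F s::real in at_right 0. s > 0"
    by (simp add: eventually_at_right_less)
  ultimately have "\<forall>\<^sub>F s::real in at_right 0. s > 0 \<and> (\<forall>k\<in>{..<4::nat}. (\<i>^k * s) \<in> T) \<and>
      ((\<Sum>k<4. F (x + (\<i>^k * s) *s v)) - 4 * F x) / s\<^sup>2 < c"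
    by eventually_elim auto
  from eventually_happens'[OF trivial_limit_at_right_real this]
  obtain s :: real where s: "s > 0" "\<And>k. k < 4 \<Longrightarrow> (\<i>^k * s) \<in> T"
    "((\<Sum>k<4. F (x + (\<i>^k * s) *s v)) - 4 * F x) / s\<^sup>2 < c"
    unfolding Ball_def lessThan_iff by (elim exE conjE) blast
  have sumF: "(\<Sum>k<4. F (x + (\<i>^k * s) *s v)) - 4 * F x < c * s\<^sup>2"
    using s(1,3) by (simp add: divide_less_eq)
  have "(\<Sum>k<4. \<Psi> (x + (\<i>^k * s) *s v)) \<le> (\<Sum>k<(4::nat). \<Psi> x)"
    using s(2) by (intro sum_mono x(2)) (auto simp: T_def less_imp_le)
  moreover have "(\<Sum>k<4. \<Psi> (x + (\<i>^k * s) *s v)) =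
      4 * (norm (x - p))\<^sup>2 + 4 * s\<^sup>2 * (norm v)\<^sup>2 - A * (\<Sum>k<4. F (x + (\<i>^k * s) *s v))"
    using four_point_average_norm[of "x - p" s v]
    by (simp add: \<Psi>_def sum_subtractf sum_distrib_left algebra_simps)
  moreover have "(\<Sum>k<(4::nat). \<Psi> x) = 4 * (norm (x - p))\<^sup>2 - A * (4 * F x)"
    by (simp add: \<Psi>_def)
  ultimately have "4 * s\<^sup>2 * (norm v)\<^sup>2 \<le> A * ((\<Sum>k<4. F (x + (\<i>^k * s) *s v)) - 4 * F x)"
    by (simp add: algebra_simps)
  also have "\<dots> < A * (c * s\<^sup>2)" using sumF A by simp
  also have "\<dots> = 4 * s\<^sup>2 * (norm v)\<^sup>2" using A by (simp add: c_def)
  finally show False by simp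
qed

section \<open>Hilbert spaces of functions\<close>

lemma
  assumes "hilbert_space M"
  shows carr_0: "0 \<in> carr M"
    and carr_add: "f \<in> carr M \<Longrightarrow> g \<in> carr M \<Longrightarrow> f + g \<in> carr M"
    and carr_diff: "f \<in> carr M \<Longrightarrow> g \<in> carr M \<Longrightarrow> f - g \<in> carr M"
    and carr_cscale: "f \<in> carr M \<Longrightarrow> cscale c f \<in> carr M"
    and carr_sum: "(\<And>i. i \<in> A \<Longrightarrow> F i \<in> carr M) \<Longrightarrow> (\<Sum>i\<in>A. F i) \<in> carr M"
  using assms cfun.subspace_sum[of "carr M" A F]
  by (auto simp: hilbert_space_def cfun.subspace_0 cfun.subspace_add cfun.subspace_diff cfun.subspace_scale)

lemma ip_cnj: "hilbert_space M \<Longrightarrow> f \<in> carr M \<Longrightarrow> g \<in> carr M \<Longrightarrow> ip M g f = cnj (ip M f g)"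
  unfolding hilbert_space_def by blast

lemma ip_add_left:
  "hilbert_space M \<Longrightarrow> f \<in> carr M \<Longrightarrow> g \<in> carr M \<Longrightarrow> h \<in> carr M \<Longrightarrow> ip M (f + g) h = ip M f h + ip M g h"
  unfolding hilbert_space_def by blast

lemma ip_cscale_left:
  "hilbert_space M \<Longrightarrow> f \<in> carr M \<Longrightarrow> g \<in> carr M \<Longrightarrow> ip M (cscale c f) g = c * ip M f g"
  unfolding hilbert_space_def by blast

lemma ip_add_right:
  "hilbert_space M \<Longrightarrow> f \<in> carr M \<Longrightarrow> g \<in> carr M \<Longrightarrow> h \<in> carr M \<Longrightarrow> ip M h (f + g) = ip M h f + ip M h g"
  by (simp add: ip_cnj[of M _ h] carr_add ip_add_left)

lemma ip_cscale_right:
  "hilbert_space M \<Longrightarrow> f \<in> carr M \<Longrightarrow> g \<in> carr M \<Longrightarrow> ip M g (cscale c f) = cnj c * ip M g f"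
  by (simp add: ip_cnj[of M _ g] carr_cscale ip_cscale_left)

lemma ip_0_left: "hilbert_space M \<Longrightarrow> g \<in> carr M \<Longrightarrow> ip M 0 g = 0"
  using ip_add_left[of M 0 0 g] carr_0[of M] by simp

lemma diff_eq_add_cscale: "f - g = f + cscale (-1) g"
  by (simp add: cscale_def fun_eq_iff)

lemma ip_diff_left:
  "hilbert_space M \<Longrightarrow> f \<in> carr M \<Longrightarrow> g \<in> carr M \<Longrightarrow> h \<in> carr M \<Longrightarrow> ip M (f - g) h = ip M f h - ip M g h"
  unfolding diff_eq_add_cscale by (simp add: ip_add_left ip_cscale_left carr_cscale del: cfun.scale_minus_left)

lemma ip_diff_right:
  "hilbert_space M \<Longrightarrow> f \<in> carr M \<Longrightarrow> g \<in> carr M \<Longrightarrow> h \<in> carr M \<Longrightarrow> ip M h (f - g) = ip M h f - ip M h g"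
  unfolding diff_eq_add_cscale by (simp add: ip_add_right ip_cscale_right carr_cscale del: cfun.scale_minus_left)

lemma ip_sum_left:
  assumes "hilbert_space M" "\<And>i. i \<in> A \<Longrightarrow> F i \<in> carr M" "h \<in> carr M"
  shows "ip M (\<Sum>i\<in>A. F i) h = (\<Sum>i\<in>A. ip M (F i) h)"
  using assms(2)
  by (induction A rule: infinite_finite_induct) (auto simp: ip_0_left ip_add_left carr_sum assms)

lemma ip_sum_right:
  assumes "hilbert_space M" "\<And>i. i \<in> A \<Longrightarrow> F i \<in> carr M" "h \<in> carr M"
  shows "ip M h (\<Sum>i\<in>A. F i) = (\<Sum>i\<in>A. ip M h (F i))"
  using assms by (simp add: ip_cnj[of M _ h] carr_sum ip_sum_left)

lemma ip_self_pos: "hilbert_space M \<Longrightarrow> f \<in> carr M \<Longrightarrow> f \<noteq> 0 \<Longrightarrow> Re (ip M f f) > 0"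
  unfolding hilbert_space_def by blast

lemma ip_self:
  assumes "hilbert_space M" "f \<in> carr M"
  shows "ip M f f = of_real ((hnorm M f)\<^sup>2)"
proof -
  have "Re (ip M f f) \<ge> 0"
    using ip_0_left[OF assms(1) carr_0[OF assms(1)]] ip_self_pos[OF assms]
    by (cases "f = 0") auto
  moreover have "Im (ip M f f) = 0"
    using arg_cong[OF ip_cnj[OF assms(1,2,2)], of Im] by simp
  ultimately show ?thesis by (simp add: hnorm_def complex_eq_iff)
qed

lemma hnorm_nonneg:
  assumes "hilbert_space M" "f \<in> carr M"
  shows "hnorm M f \<ge> 0"
proof -
  have "Re (ip M f f) \<ge> 0" using ip_self[OF assms] by simp
  then show ?thesis by (simp add: hnorm_def)
qed

lemma hnorm_eq_0_iff:
  assumes "hilbert_space M" "f \<in> carr M"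
  shows "hnorm M f = 0 \<longleftrightarrow> f = 0"
proof
  assume "hnorm M f = 0"
  then have "Re (ip M f f) = 0" using ip_self[OF assms] by simp
  with ip_self_pos[OF assms] show "f = 0" by auto
next
  assume "f = 0"
  then show "hnorm M f = 0" using assms by (simp add: hnorm_def ip_0_left)
qed

lemma ip_self_eq_0_iff: "hilbert_space M \<Longrightarrow> f \<in> carr M \<Longrightarrow> ip M f f = 0 \<longleftrightarrow> f = 0"
  by (simp add: ip_self hnorm_eq_0_iff)

lemma hnorm_cscale:
  assumes "hilbert_space M" "f \<in> carr M"
  shows "hnorm M (cscale c f) = cmod c * hnorm M f"
proof -
  have "ip M (cscale c f) (cscale c f) = (c * cnj c) * ip M f f"
    using assms by (simp add: ip_cscale_left ip_cscale_right carr_cscale)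
  then have "ip M (cscale c f) (cscale c f) = of_real ((cmod c)\<^sup>2 * (hnorm M f)\<^sup>2)"
    unfolding ip_self[OF assms] by (simp add: complex_norm_square[symmetric])
  then show ?thesis
    using hnorm_nonneg[OF assms] by (simp add: hnorm_def[of M "cscale c f"] real_sqrt_mult del: of_real_mult)
qed

lemma hnorm_minus_commute:
  assumes "hilbert_space M" "f \<in> carr M" "g \<in> carr M"
  shows "hnorm M (f - g) = hnorm M (g - f)"
proof -
  have "f - g = cscale (-1) (g - f)" by (simp add: cscale_def fun_eq_iff)
  then show ?thesis using assms hnorm_cscale[of M "g - f" "-1"] by (simp add: carr_diff)
qed

text \<open>Expand the square of the norm of \<open>\<parallel>g\<parallel>\<^sup>2 f - \<langle>f, g\<rangle> g\<close>.\<close>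

lemma cauchy_schwarz:
  assumes M: "hilbert_space M" and f: "f \<in> carr M" and g: "g \<in> carr M"
  shows "cmod (ip M f g) \<le> hnorm M f * hnorm M g"
proof (cases "g = 0")
  case True
  then have "ip M f g = 0" using ip_cnj[OF M g f] by (simp add: ip_0_left M f)
  then show ?thesis by (simp add: M f g hnorm_nonneg)
next
  case False
  define a where "a = hnorm M g"
  have a: "a > 0" using False hnorm_nonneg[OF M g] hnorm_eq_0_iff[OF M g] by (simp add: a_def)
  define h where "h = cscale (of_real (a\<^sup>2)) f - cscale (ip M f g) g"
  have h: "h \<in> carr M" by (simp add: h_def M f g carr_diff carr_cscale)
  have "ip M h h = of_real (a\<^sup>2 * (a\<^sup>2 * (hnorm M f)\<^sup>2 - (cmod (ip M f g))\<^sup>2))"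
    using M f g ip_self[OF M g] ip_cnj[OF M f g] 
    by (simp add: h_def ip_diff_left ip_diff_right ip_cscale_left ip_cscale_right carr_diff carr_cscale
        ip_self[OF M f] a_def complex_norm_square[unfolded of_real_power] algebra_simps del: ip_cnj)
  then have "0 \<le> a\<^sup>2 * (a\<^sup>2 * (hnorm M f)\<^sup>2 - (cmod (ip M f g))\<^sup>2)"
    using ip_self[OF M h] by (metis of_real_eq_iff zero_le_power2)
  then have "(cmod (ip M f g))\<^sup>2 \<le> (hnorm M f * a)\<^sup>2"
    using a by (simp add: zero_le_mult_iff power_mult_distrib mult.commute)
  then show ?thesis
    using a hnorm_nonneg[OF M f] by (simp add: a_def power2_le_iff_abs_le abs_mult)
qed

lemma hnorm_triangle:
  assumes M: "hilbert_space M" and f: "f \<in> carr M" and g: "g \<in> carr M"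
  shows "hnorm M (f + g) \<le> hnorm M f + hnorm M g"
proof -
  have "(hnorm M (f + g))\<^sup>2 = Re (ip M (f + g) (f + g))"
    using ip_self[OF M carr_add[OF M f g]] by simp
  also have "\<dots> = (hnorm M f)\<^sup>2 + (hnorm M g)\<^sup>2 + 2 * Re (ip M f g)"
    using M f g ip_cnj[OF M f g]
    by (simp add: ip_add_left ip_add_right carr_add ip_self[OF M f] ip_self[OF M g])
  also have "\<dots> \<le> (hnorm M f + hnorm M g)\<^sup>2"
    using cauchy_schwarz[OF M f g] complex_Re_le_cmod[of "ip M f g"] by (simp add: power2_sum)
  finally show ?thesis
    by (rule power2_le_imp_le) (simp add: hnorm_nonneg M f g)
qed

lemma hnorm_triangle_diff:
  assumes "hilbert_space M" "f \<in> carr M" "g \<in> carr M" "h \<in> carr M"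
  shows "hnorm M (f - h) \<le> hnorm M (f - g) + hnorm M (g - h)"
proof -
  have "(f - g) + (g - h) = f - h" by simp
  with hnorm_triangle[of M "f - g" "g - h"] assms show ?thesis by (simp add: carr_diff)
qed

text \<open>Membership in the carrier is only required eventually, because the maps to which this is
  applied take their values in the carrier on a neighbourhood of the limit point only.\<close>

definition hconv :: "'m::finite hilb \<Rightarrow> ('x \<Rightarrow> complex^'m \<Rightarrow> complex) \<Rightarrow> (complex^'m \<Rightarrow> complex) \<Rightarrow> 'x filter \<Rightarrow> bool"
  where "hconv M X f F \<longleftrightarrow> f \<in> carr M \<and> (\<forall>\<^sub>F x in F. X x \<in> carr M) \<and> ((\<lambda>x. hnorm M (X x - f)) \<longlongrightarrow> 0) F"

lemma hconv_ip:
  assumes M: "hilbert_space M" and X: "hconv M X f F" and Y: "hconv M Y g F"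
  shows "((\<lambda>x. ip M (X x) (Y x)) \<longlongrightarrow> ip M f g) F"
proof -
  have fg: "f \<in> carr M" "g \<in> carr M" using X Y by (auto simp: hconv_def)
  have ev: "\<forall>\<^sub>F x in F. X x \<in> carr M" "\<forall>\<^sub>F x in F. Y x \<in> carr M" using X Y by (auto simp: hconv_def)
  have lim: "((\<lambda>x. hnorm M (X x - f) * hnorm M (Y x - g) + hnorm M (X x - f) * hnorm M g
          + hnorm M f * hnorm M (Y x - g)) \<longlongrightarrow> 0 * 0 + 0 * hnorm M g + hnorm M f * 0) F"
    using X Y by (intro tendsto_intros) (auto simp: hconv_def)
  have "\<forall>\<^sub>F x in F. cmod (ip M (X x) (Y x) - ip M f g) \<le> hnorm M (X x - f) * hnorm M (Y x - g)
      + hnorm M (X x - f) * hnorm M g + hnorm M f * hnorm M (Y x - g)"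
    using ev
  proof eventually_elim
    case (elim x)
    have eq: "ip M (X x) (Y x) - ip M f g = ip M (X x - f) (Y x - g) + ip M (X x - f) g + ip M f (Y x - g)"
      using elim fg by (simp add: ip_diff_left ip_diff_right M carr_diff)
    have "cmod (ip M (X x) (Y x) - ip M f g)
        \<le> cmod (ip M (X x - f) (Y x - g)) + cmod (ip M (X x - f) g) + cmod (ip M f (Y x - g))"
      unfolding eq by (intro order_trans[OF norm_triangle_ineq] add_right_mono norm_triangle_ineq)
    also have "\<dots> \<le> hnorm M (X x - f) * hnorm M (Y x - g)
      + hnorm M (X x - f) * hnorm M g + hnorm M f * hnorm M (Y x - g)"
      using elim fg by (intro add_mono cauchy_schwarz) (auto simp: M carr_diff)
    finally show ?case .
  qed
  moreover have "((\<lambda>x. hnorm M (X x - f) * hnorm M (Y x - g) + hnorm M (X x - f) * hnorm M g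
          + hnorm M f * hnorm M (Y x - g)) \<longlongrightarrow> 0) F"
    using lim by simp
  ultimately have "((\<lambda>x. ip M (X x) (Y x) - ip M f g) \<longlongrightarrow> 0) F"
    by (rule Lim_null_comparison)
  then show ?thesis by (simp add: LIM_zero_iff)
qed

lemma hconv_const: "hilbert_space M \<Longrightarrow> f \<in> carr M \<Longrightarrow> hconv M (\<lambda>_. f) f F"
  using hnorm_eq_0_iff[of M 0] by (simp add: hconv_def carr_0)

lemma hconv_add:
  assumes M: "hilbert_space M" and X: "hconv M X f F" and Y: "hconv M Y g F"
  shows "hconv M (\<lambda>x. X x + Y x) (f + g) F"
proof -
  have fg: "f \<in> carr M" "g \<in> carr M" using X Y by (auto simp: hconv_def)
  have ev: "\<forall>\<^sub>F x in F. X x \<in> carr M \<and> Y x \<in> carr M" using X Y by (auto simp: hconv_def eventually_conj)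
  have "((\<lambda>x. hnorm M (X x - f) + hnorm M (Y x - g)) \<longlongrightarrow> 0 + 0) F"
    using X Y by (intro tendsto_intros) (auto simp: hconv_def)
  then have lim: "((\<lambda>x. hnorm M (X x - f) + hnorm M (Y x - g)) \<longlongrightarrow> 0) F" by simp
  have "\<forall>\<^sub>F x in F. norm (hnorm M (X x + Y x - (f + g))) \<le> hnorm M (X x - f) + hnorm M (Y x - g)"
    using ev
  proof eventually_elim
    case (elim x)
    then have "hnorm M ((X x - f) + (Y x - g)) \<le> hnorm M (X x - f) + hnorm M (Y x - g)"
      using fg by (intro hnorm_triangle) (auto simp: M carr_diff)
    moreover have "(X x - f) + (Y x - g) = X x + Y x - (f + g)" by simp
    moreover have "hnorm M (X x + Y x - (f + g)) \<ge> 0"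
      using elim fg by (intro hnorm_nonneg) (auto simp: M carr_diff carr_add)
    ultimately show ?case by simp
  qed
  from Lim_null_comparison[OF this lim] show ?thesis
    using fg ev by (auto simp: hconv_def carr_add M elim: eventually_mono)
qed

lemma hconv_cscale:
  assumes M: "hilbert_space M" and a: "(a \<longlongrightarrow> c) F" and X: "hconv M X f F"
  shows "hconv M (\<lambda>x. cscale (a x) (X x)) (cscale c f) F"
proof -
  have f: "f \<in> carr M" using X by (auto simp: hconv_def)
  have ev: "\<forall>\<^sub>F x in F. X x \<in> carr M" using X by (auto simp: hconv_def)
  have "((\<lambda>x. cmod (a x) * hnorm M (X x - f) + cmod (a x - c) * hnorm M f)
      \<longlongrightarrow> cmod c * 0 + cmod (c - c) * hnorm M f) F"
    using X by (intro tendsto_intros a) (auto simp: hconv_def)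
  then have lim: "((\<lambda>x. cmod (a x) * hnorm M (X x - f) + cmod (a x - c) * hnorm M f) \<longlongrightarrow> 0) F"
    by simp
  have "\<forall>\<^sub>F x in F. norm (hnorm M (cscale (a x) (X x) - cscale c f))
      \<le> cmod (a x) * hnorm M (X x - f) + cmod (a x - c) * hnorm M f"
    using ev
  proof eventually_elim
    case (elim x)
    have "cscale (a x) (X x) - cscale c f = cscale (a x) (X x - f) + cscale (a x - c) f"
      by (simp add: cscale_def fun_eq_iff algebra_simps)
    moreover have "hnorm M (cscale (a x) (X x) - cscale c f) \<ge> 0"
      using elim f by (intro hnorm_nonneg) (auto simp: M carr_diff carr_cscale)
    ultimately show ?case
      using hnorm_triangle[OF M, of "cscale (a x) (X x - f)" "cscale (a x - c) f"] elim f
      by (simp add: M carr_diff carr_cscale hnorm_cscale)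
  qed
  from Lim_null_comparison[OF this lim] show ?thesis
    using f ev by (auto simp: hconv_def carr_cscale M elim: eventually_mono)
qed

lemma hconv_sum:
  assumes "hilbert_space M" "\<And>i. i \<in> A \<Longrightarrow> hconv M (X i) (f i) F"
  shows "hconv M (\<lambda>x. \<Sum>i\<in>A. X i x) (\<Sum>i\<in>A. f i) F"
  using assms(2)
  by (induction A rule: infinite_finite_induct) (auto simp: hconv_const carr_0 hconv_add assms(1))

lemma hilbert_complete:
  assumes M: "hilbert_space M" and X: "\<And>n::nat. X n \<in> carr M"
    and C: "\<And>e. e > 0 \<Longrightarrow> \<exists>n0. \<forall>n\<ge>n0. \<forall>k\<ge>n0. hnorm M (X n - X k) < e"
  shows "\<exists>f. hconv M X f sequentially"
proof -
  have "\<exists>f\<in>carr M. (\<lambda>n. hnorm M (X n - f)) \<longlonglongrightarrow> 0"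
    using assms unfolding hilbert_space_def by blast
  then show ?thesis using X by (auto simp: hconv_def)
qed

section \<open>Density in a Hilbert space of functions\<close>

lemma parallelogram_law_hnorm:
  assumes M: "hilbert_space M" and f: "f \<in> carr M" and g: "g \<in> carr M"
  shows "(hnorm M (f + g))\<^sup>2 + (hnorm M (f - g))\<^sup>2 = 2 * (hnorm M f)\<^sup>2 + 2 * (hnorm M g)\<^sup>2"
proof -
  have "complex_of_real ((hnorm M (f + g))\<^sup>2 + (hnorm M (f - g))\<^sup>2) = ip M (f + g) (f + g) + ip M (f - g) (f - g)"
    by (simp add: ip_self M f g carr_add carr_diff)
  also have "\<dots> = 2 * ip M f f + 2 * ip M g g"
    by (simp add: ip_add_left ip_add_right ip_diff_left ip_diff_right M f g carr_add carr_diff)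
  also have "\<dots> = complex_of_real (2 * (hnorm M f)\<^sup>2 + 2 * (hnorm M g)\<^sup>2)"
    by (simp add: ip_self M f g)
  finally show ?thesis by (simp only: of_real_eq_iff)
qed

text \<open>The projection theorem: a minimizing sequence in \<open>V\<close> for the distance to \<open>f\<close> is Cauchy by the
  parallelogram law, and \<open>f\<close> minus its limit is orthogonal to \<open>V\<close>.\<close>

lemma orthogonal_complement_trivial_imp_dense:
  assumes M: "hilbert_space M" and V: "cfun.subspace V" "V \<subseteq> carr M"
    and orth: "\<And>h. h \<in> carr M \<Longrightarrow> (\<And>v. v \<in> V \<Longrightarrow> ip M h v = 0) \<Longrightarrow> h = 0"
    and f: "f \<in> carr M"
  shows "\<exists>X. (\<forall>n::nat. X n \<in> V) \<and> hconv M X f sequentially"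
proof -
  define d where "d = (INF v\<in>V. hnorm M (f - v))"
  have V0: "0 \<in> V" using V(1) by (rule cfun.subspace_0)
  have bdd: "bdd_below ((\<lambda>v. hnorm M (f - v)) ` V)"
    using V(2) f by (intro bdd_belowI2[of _ 0]) (auto intro!: hnorm_nonneg M carr_diff)
  have d_le: "d \<le> hnorm M (f - v)" if "v \<in> V" for v
    unfolding d_def by (rule cINF_lower[OF bdd that])
  have d0: "d \<ge> 0"
    unfolding d_def using V0 V(2) f by (intro cINF_greatest) (auto intro!: hnorm_nonneg M carr_diff)
  have "\<exists>v\<in>V. hnorm M (f - v) < d + 1 / Suc n" for n
    using cINF_less_iff[OF _ bdd, of "d + 1 / Suc n"] V0 unfolding d_def[symmetric] by force
  then obtain X where X: "\<And>n. X n \<in> V" "\<And>n. hnorm M (f - X n) < d + 1 / Suc n" by metis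
  have XM: "X n \<in> carr M" for n using X(1) V(2) by blast
  have close: "(hnorm M (X n - X k))\<^sup>2 \<le> 2 * (d + 1 / Suc n)\<^sup>2 + 2 * (d + 1 / Suc k)\<^sup>2 - 4 * d\<^sup>2" for n k
  proof -
    define mid where "mid = cscale (1/2) (X n + X k)"
    have mid: "mid \<in> V" using V(1) X(1) by (simp add: mid_def cfun.subspace_add cfun.subspace_scale)
    have "(f - X n) + (f - X k) = cscale 2 (f - mid)" "(f - X n) - (f - X k) = X k - X n"
      by (auto simp: mid_def cscale_def fun_eq_iff field_simps)
    then have "(2 * hnorm M (f - mid))\<^sup>2 + (hnorm M (X k - X n))\<^sup>2
        = 2 * (hnorm M (f - X n))\<^sup>2 + 2 * (hnorm M (f - X k))\<^sup>2"
      using parallelogram_law_hnorm[OF M, of "f - X n" "f - X k"] hnorm_cscale[OF M, of "f - mid" 2] mid V(2) XM f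
      by (auto simp: carr_diff M)
    moreover have "(2 * d)\<^sup>2 \<le> (2 * hnorm M (f - mid))\<^sup>2"
      using d_le[OF mid] d0 by (intro power_mono) auto
    moreover have "(hnorm M (f - X i))\<^sup>2 \<le> (d + 1 / Suc i)\<^sup>2" for i
      using X(2)[of i] XM f by (intro power_mono) (auto intro!: hnorm_nonneg M carr_diff)
    from this[of n] this[of k] have "2 * (hnorm M (f - X n))\<^sup>2 + 2 * (hnorm M (f - X k))\<^sup>2
        \<le> 2 * (d + 1 / Suc n)\<^sup>2 + 2 * (d + 1 / Suc k)\<^sup>2" by simp
    ultimately show ?thesis
      using hnorm_minus_commute[OF M XM XM, of n k] by (simp add: power_mult_distrib)
  qed
  have "(\<lambda>n. d + 1 / real (Suc n)) \<longlonglongrightarrow> d + 0"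
    by (intro tendsto_intros LIMSEQ_Suc[OF lim_1_over_n])
  then have lim_sq: "(\<lambda>n. (d + 1 / real (Suc n))\<^sup>2) \<longlonglongrightarrow> d\<^sup>2"
    using tendsto_power[of _ d sequentially 2] by simp
  have "\<exists>n0. \<forall>n\<ge>n0. \<forall>k\<ge>n0. hnorm M (X n - X k) < e" if e: "e > 0" for e
  proof -
    have "\<forall>\<^sub>F n in sequentially. (d + 1 / real (Suc n))\<^sup>2 < d\<^sup>2 + e\<^sup>2 / 4"
      using e by (intro order_tendstoD(2)[OF lim_sq]) auto
    then obtain n0 where n0: "\<And>n. n \<ge> n0 \<Longrightarrow> (d + 1 / real (Suc n))\<^sup>2 < d\<^sup>2 + e\<^sup>2 / 4"
      unfolding eventually_sequentially by blast
    have "hnorm M (X n - X k) < e" if "n \<ge> n0" "k \<ge> n0" for n k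
    proof -
      have "(hnorm M (X n - X k))\<^sup>2 < e\<^sup>2"
        using close[of n k] n0[OF that(1)] n0[OF that(2)] by simp
      then show ?thesis using e by (simp add: power_less_imp_less_base)
    qed
    then show ?thesis by blast
  qed
  from hilbert_complete[OF M XM this] obtain g where g: "hconv M X g sequentially" by blast
  then have gM: "g \<in> carr M" by (simp add: hconv_def)
  define h where "h = f - g"
  have hM: "h \<in> carr M" using f gM by (simp add: h_def carr_diff M)
  have lim_h: "(\<lambda>n. (hnorm M (f - X n - v))\<^sup>2) \<longlonglongrightarrow> (hnorm M (h - v))\<^sup>2" if v: "v \<in> carr M" for v
  proof -
    have Y: "hconv M (\<lambda>n. (f - v) + cscale (-1) (X n)) ((f - v) + cscale (-1) g) sequentially"
      using f v by (intro hconv_add hconv_const hconv_cscale tendsto_const g M carr_diff)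
    have eq: "(f - v) + cscale (-1) u = f - u - v" for u
      by (simp add: cscale_def fun_eq_iff)
    have "(\<lambda>n. Re (ip M (f - X n - v) (f - X n - v))) \<longlonglongrightarrow> Re (ip M (f - g - v) (f - g - v))"
      using hconv_ip[OF M Y Y] unfolding eq by (rule tendsto_Re)
    then show ?thesis
      using v f XM hM by (simp add: ip_self M carr_diff h_def gM)
  qed
  have h_le: "(hnorm M h)\<^sup>2 \<le> d\<^sup>2"
  proof (rule LIMSEQ_le[OF _ lim_sq])
    show "(\<lambda>n. (hnorm M (f - X n))\<^sup>2) \<longlonglongrightarrow> (hnorm M h)\<^sup>2"
      using lim_h[OF carr_0[OF M]] by simp
    have "(hnorm M (f - X n))\<^sup>2 \<le> (d + 1 / real (Suc n))\<^sup>2" for n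
      by (rule power_mono[OF less_imp_le[OF X(2)]]) (simp add: hnorm_nonneg M carr_diff f XM)
    then show "\<exists>N. \<forall>n\<ge>N. (hnorm M (f - X n))\<^sup>2 \<le> (d + 1 / real (Suc n))\<^sup>2" by blast
  qed
  have ge_d: "d\<^sup>2 \<le> (hnorm M (h - v))\<^sup>2" if v: "v \<in> V" for v
  proof (rule LIMSEQ_le_const[OF lim_h])
    show "v \<in> carr M" using v V(2) by blast
    have "d\<^sup>2 \<le> (hnorm M (f - X n - v))\<^sup>2" for n
    proof -
      have "X n + v \<in> V" using V(1) X(1) v by (simp add: cfun.subspace_add)
      from d_le[OF this] d0 show ?thesis by (intro power_mono) (simp_all add: diff_diff_eq)
    qed
    then show "\<exists>N. \<forall>n\<ge>N. d\<^sup>2 \<le> (hnorm M (f - X n - v))\<^sup>2" by blast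
  qed
  have "ip M h v = 0" if v: "v \<in> V" for v
  proof (cases "v = 0")
    case True
    then show ?thesis using ip_cnj[OF M carr_0[OF M] hM] ip_0_left[OF M hM] by simp
  next
    case False
    have vM: "v \<in> carr M" using v V(2) by blast
    define b where "b = (hnorm M v)\<^sup>2"
    have b: "b > 0" using False hnorm_eq_0_iff[OF M vM] by (simp add: b_def)
    \<comment> \<open>The multiple of \<open>v\<close> that is nearest to \<open>h\<close>.\<close>
    define c where "c = ip M h v / b"
    have "cscale c v \<in> V" using V(1) v by (rule cfun.subspace_scale)
    have "ip M (h - cscale c v) (h - cscale c v)
        = ip M h h - cnj c * ip M h v - c * cnj (ip M h v) + c * cnj c * ip M v v"
      using ip_cnj[OF M hM vM]
      by (simp add: ip_diff_left ip_diff_right ip_cscale_left ip_cscale_right M hM vM carr_diff carr_cscale algebra_simps)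
    also have "\<dots> = ip M h h - (ip M h v * cnj (ip M h v)) / b"
      using b by (simp add: c_def ip_self[OF M vM] b_def[symmetric] field_simps flip: of_real_power)
    finally have "complex_of_real ((hnorm M (h - cscale c v))\<^sup>2)
        = complex_of_real ((hnorm M h)\<^sup>2 - (cmod (ip M h v))\<^sup>2 / b)"
      by (simp add: ip_self M hM vM carr_diff carr_cscale complex_norm_square[symmetric])
    then have "(hnorm M (h - cscale c v))\<^sup>2 = (hnorm M h)\<^sup>2 - (cmod (ip M h v))\<^sup>2 / b"
      by (simp only: of_real_eq_iff)
    with ge_d[OF \<open>cscale c v \<in> V\<close>] h_le have "(cmod (ip M h v))\<^sup>2 / b \<le> 0" by simp
    then have "(cmod (ip M h v))\<^sup>2 \<le> 0" using b by (simp add: divide_le_0_iff)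
    then show ?thesis by simp
  qed
  then have "h = 0" using orth hM by blast
  then have "f = g" by (simp add: h_def)
  with g X(1) show ?thesis by blast
qed

section \<open>Modules with a reproducing kernel\<close>

lemma hilbert_module_space: "hilbert_module \<Omega> M \<Longrightarrow> hilbert_space M"
  by (simp add: hilbert_module_def)

lemma hilbert_module_hol: "hilbert_module \<Omega> M \<Longrightarrow> f \<in> carr M \<Longrightarrow> hol_on f \<Omega>"
  by (simp add: hilbert_module_def)

lemma hilbert_module_outside: "hilbert_module \<Omega> M \<Longrightarrow> f \<in> carr M \<Longrightarrow> z \<notin> \<Omega> \<Longrightarrow> f z = 0"
  by (simp add: hilbert_module_def)

lemma hilbert_module_mult_coord:
  "hilbert_module \<Omega> M \<Longrightarrow> f \<in> carr M \<Longrightarrow> (\<lambda>z. z $ j * f z) \<in> carr M"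
  by (simp add: hilbert_module_def)

lemma reproducing_kernel_carr: "reproducing_kernel \<Omega> M K \<Longrightarrow> w \<in> \<Omega> \<Longrightarrow> (\<lambda>z. K z w) \<in> carr M"
  by (simp add: reproducing_kernel_def)

lemma reproducing_kernel_ip:
  "reproducing_kernel \<Omega> M K \<Longrightarrow> w \<in> \<Omega> \<Longrightarrow> f \<in> carr M \<Longrightarrow> ip M f (\<lambda>z. K z w) = f w"
  by (simp add: reproducing_kernel_def)

lemma sum_fun_apply: "(\<Sum>i\<in>A. F i) z = (\<Sum>i\<in>A. F i z)"
  by (induction A rule: infinite_finite_induct) auto

lemma pmult_carr:
  assumes M: "hilbert_module \<Omega> M" and f: "f \<in> carr M"
  shows "pmult p f \<in> carr M"
proof -
  have power: "(\<lambda>z. (z $ j) ^ n * g z) \<in> carr M" if "g \<in> carr M" for j n g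
  proof (induction n)
    case (Suc n)
    from hilbert_module_mult_coord[OF M this, of j] show ?case by (simp add: mult.assoc)
  qed (use that in simp)
  have mono: "(\<lambda>z. (\<Prod>j\<in>A. (z $ j) ^ n j) * f z) \<in> carr M" for A and n :: "_ \<Rightarrow> nat"
  proof (induction A rule: infinite_finite_induct)
    case (insert i A)
    from power[OF insert.IH, of i "n i"] insert.hyps show ?case by (simp add: mult.assoc)
  qed (use f in simp_all)
  have "pmult p f = (\<Sum>\<alpha>\<in>Poly_Mapping.keys p. cscale (Poly_Mapping.lookup p \<alpha>)
      (\<lambda>z. (\<Prod>j\<in>UNIV. (z $ j) ^ Poly_Mapping.lookup \<alpha> j) * f z))"
    by (simp add: pmult_def peval_def cscale_def fun_eq_iff sum_distrib_right mult.assoc sum_fun_apply)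
  also have "\<dots> \<in> carr M"
    using hilbert_module_space[OF M] by (intro carr_sum carr_cscale mono)
  finally show ?thesis .
qed

lemma hilbert_module_eqI:
  assumes M: "hilbert_module \<Omega> M" and \<Omega>: "open \<Omega>" "connected \<Omega>"
    and W: "open W" "W \<noteq> {}" "W \<subseteq> \<Omega>"
    and f: "f \<in> carr M" and g: "g \<in> carr M" and eq: "\<And>z. z \<in> W \<Longrightarrow> f z = g z"
  shows "f = g"
proof
  fix z
  have "f - g \<in> carr M" using f g by (simp add: carr_diff hilbert_module_space[OF M])
  then have hol: "hol_on (f - g) \<Omega>" by (rule hilbert_module_hol[OF M])
  have "(f - g) z = 0" if "z \<in> \<Omega>"
    by (rule hol_on_identity[OF hol \<Omega> W _ that]) (simp add: eq)
  then show "f z = g z"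
    using hilbert_module_outside[OF M f, of z] hilbert_module_outside[OF M g, of z] by (cases "z \<in> \<Omega>") auto
qed

lemma hconv_imp_pointwise:
  assumes M: "hilbert_space M" and K: "reproducing_kernel \<Omega> M K" and X: "hconv M X f F" and w: "w \<in> \<Omega>"
  shows "((\<lambda>x. X x w) \<longlongrightarrow> f w) F"
proof -
  have "((\<lambda>x. ip M (X x) (\<lambda>z. K z w)) \<longlongrightarrow> ip M f (\<lambda>z. K z w)) F"
    by (intro hconv_ip[OF M X] hconv_const M reproducing_kernel_carr[OF K w])
  moreover have "\<forall>\<^sub>F x in F. ip M (X x) (\<lambda>z. K z w) = X x w"
    using X by (auto simp: hconv_def reproducing_kernel_ip[OF K w] elim: eventually_mono)
  moreover have "ip M f (\<lambda>z. K z w) = f w"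
    using X by (simp add: hconv_def reproducing_kernel_ip[OF K w])
  ultimately show ?thesis using tendsto_cong by fastforce
qed

text \<open>The graph of multiplication by \<open>1 / cnj c\<close> on \<open>W\<close>. By the identity theorem a function in a
  module is determined by its values on \<open>W\<close>, so this relation is single-valued wherever \<open>c\<close> has no
  zeros, although \<open>c\<close> is only known on \<open>W\<close>.\<close>

definition rescaled_on ::
    "(complex^'m::finite) set \<Rightarrow> (complex^'m \<Rightarrow> complex) \<Rightarrow> 'm hilb \<Rightarrow> 'm hilb \<Rightarrow>
      (complex^'m \<Rightarrow> complex) \<Rightarrow> (complex^'m \<Rightarrow> complex) \<Rightarrow> bool"
  where "rescaled_on W c M M' f f' \<longleftrightarrow>
    f \<in> carr M \<and> f' \<in> carr M' \<and> (\<forall>z\<in>W. f z = cnj (c z) * f' z)"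

text \<open>The kernel functions at points of \<open>W\<close> have partners, namely \<open>c w\<close> times the kernel functions of
  the other module: the relation between the kernels says that these correspond under rescaling,
  and the reproducing property that inner products against them are preserved. Since a function
  orthogonal to all kernel functions at points of \<open>W\<close> vanishes on \<open>W\<close> and so everywhere, their span
  is dense, and partners of limits are found by completeness.\<close>

lemma kernel_rescaling_transfer:
  assumes \<Omega>: "open \<Omega>" "connected \<Omega>"
    and M: "hilbert_module \<Omega> M" "reproducing_kernel \<Omega> M K"
    and M': "hilbert_module \<Omega> M'" "reproducing_kernel \<Omega> M' K'"
    and W: "open W" "W \<noteq> {}" "W \<subseteq> \<Omega>"
    and c: "\<And>z w. z \<in> W \<Longrightarrow> w \<in> W \<Longrightarrow> K z w = cnj (c z) * c w * K' z w"
    and f: "f \<in> carr M"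
  shows "\<exists>f'. rescaled_on W c M M' f f' \<and>
    (\<forall>g g'. rescaled_on W c M M' g g' \<longrightarrow> ip M g f = ip M' g' f')"
proof -
  note H = hilbert_module_space[OF M(1)] and H' = hilbert_module_space[OF M'(1)]
  define S where "S = (\<lambda>f f'. rescaled_on W c M M' f f' \<and>
    (\<forall>g g'. rescaled_on W c M M' g g' \<longrightarrow> ip M g f = ip M' g' f'))"
  have S_carr: "f \<in> carr M" "f' \<in> carr M'" if "S f f'" for f f'
    using that by (auto simp: S_def rescaled_on_def)
  have S_ip: "ip M f g = ip M' f' g'" if "S f f'" "S g g'" for f f' g g'
    using that by (auto simp: S_def)
  have S_add: "S (f + g) (f' + g')" if "S f f'" "S g g'" for f f' g g'
    unfolding S_def
  proof (intro conjI allI impI)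
    show "rescaled_on W c M M' (f + g) (f' + g')"
      using that by (auto simp: S_def rescaled_on_def carr_add H H' algebra_simps)
    fix h h' assume h: "rescaled_on W c M M' h h'"
    then have "ip M h f = ip M' h' f'" "ip M h g = ip M' h' g'" using that by (auto simp: S_def)
    moreover have "h \<in> carr M" "h' \<in> carr M'" using h by (auto simp: rescaled_on_def)
    ultimately show "ip M h (f + g) = ip M' h' (f' + g')"
      using S_carr[OF that(1)] S_carr[OF that(2)] by (simp add: ip_add_right H H')
  qed
  have S_cscale: "S (cscale a f) (cscale a f')" if "S f f'" for f f' a
    unfolding S_def
  proof (intro conjI allI impI)
    show "rescaled_on W c M M' (cscale a f) (cscale a f')"
      using that by (auto simp: S_def rescaled_on_def carr_cscale H H') (simp add: cscale_def)
    fix h h' assume h: "rescaled_on W c M M' h h'"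
    then have "ip M h f = ip M' h' f'" using that by (auto simp: S_def)
    moreover have "h \<in> carr M" "h' \<in> carr M'" using h by (auto simp: rescaled_on_def)
    ultimately show "ip M h (cscale a f) = ip M' h' (cscale a f')"
      using S_carr[OF that] by (simp add: ip_cscale_right H H')
  qed
  have S_diff: "S (f - g) (f' - g')" if "S f f'" "S g g'" for f f' g g'
    using S_add[OF that(1) S_cscale[OF that(2), of "-1"]] unfolding diff_eq_add_cscale .
  have S_norm: "hnorm M f = hnorm M' f'" if "S f f'" for f f'
    using S_ip[OF that that] by (simp add: hnorm_def)
  have S_kernel: "S (\<lambda>z. K z w) (cscale (c w) (\<lambda>z. K' z w))" if w: "w \<in> W" for w
  proof -
    have "w \<in> \<Omega>" using w W by blast
    then show ?thesis
      using w c reproducing_kernel_ip[OF M(2)] reproducing_kernel_ip[OF M'(2)]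
        reproducing_kernel_carr[OF M(2)] reproducing_kernel_carr[OF M'(2)]
      by (auto simp: S_def rescaled_on_def carr_cscale H' ip_cscale_right) (simp add: cscale_def mult.assoc)
  qed
  \<comment> \<open>Inner products against a partner are preserved by definition of \<open>S\<close>, so \<open>S\<close> is an
    isometric relation; it remains to see that its domain is everything.\<close>
  define V where "V = {f. \<exists>f'. S f f'}"
  have "S 0 0"
    using carr_0[OF H] carr_0[OF H']
    by (auto simp: S_def rescaled_on_def ip_cnj[OF H carr_0[OF H]] ip_cnj[OF H' carr_0[OF H']] ip_0_left H H')
  then have V: "cfun.subspace V"
    unfolding V_def by (intro cfun.subspaceI) (use S_add S_cscale in blast)+
  have VM: "V \<subseteq> carr M" using S_carr by (auto simp: V_def)
  have "h = 0" if h: "h \<in> carr M" "\<And>v. v \<in> V \<Longrightarrow> ip M h v = 0" for h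
  proof (rule hilbert_module_eqI[OF M(1) \<Omega> W h(1) carr_0[OF H]])
    fix w assume w: "w \<in> W"
    then have "ip M h (\<lambda>z. K z w) = 0" using S_kernel by (intro h(2)) (auto simp: V_def)
    then show "h w = 0 w" using w W h(1) by (simp add: reproducing_kernel_ip[OF M(2)] subset_iff)
  qed
  from orthogonal_complement_trivial_imp_dense[OF H V VM this f]
  obtain X where X: "\<And>n. X n \<in> V" "hconv M X f sequentially" by blast
  then have "\<forall>n. \<exists>X'. S (X n) X'" by (simp add: V_def)
  from choice[OF this] obtain X' where X': "\<And>n. S (X n) (X' n)" by blast
  have "\<exists>n0. \<forall>n\<ge>n0. \<forall>k\<ge>n0. hnorm M' (X' n - X' k) < e" if e: "e > 0" for e
  proof -
    have "(\<lambda>n. hnorm M (X n - f)) \<longlonglongrightarrow> 0" using X(2) by (simp add: hconv_def)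
    then have "\<forall>\<^sub>F n in sequentially. hnorm M (X n - f) < e / 2"
      using e by (intro order_tendstoD(2)[where y=0]) auto
    then obtain n0 where n0: "\<And>n. n \<ge> n0 \<Longrightarrow> hnorm M (X n - f) < e / 2"
      unfolding eventually_sequentially by blast
    have "hnorm M' (X' n - X' k) < e" if "n \<ge> n0" "k \<ge> n0" for n k
    proof -
      have Xc: "X n \<in> carr M" "X k \<in> carr M" using S_carr X' by blast+
      have "hnorm M' (X' n - X' k) = hnorm M (X n - X k)"
        using S_norm[OF S_diff[OF X' X']] by simp
      also have "\<dots> \<le> hnorm M (X n - f) + hnorm M (X k - f)"
        using hnorm_triangle_diff[OF H Xc(1) f Xc(2)] hnorm_minus_commute[OF H f Xc(2)] by simp
      also have "\<dots> < e" using n0[OF that(1)] n0[OF that(2)] by simp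
      finally show ?thesis .
    qed
    then show ?thesis by blast
  qed
  from hilbert_complete[OF H' S_carr(2)[OF X'] this] obtain f' where f': "hconv M' X' f' sequentially" by blast
  have "f w = cnj (c w) * f' w" if w: "w \<in> W" for w
  proof (rule LIMSEQ_unique)
    have "w \<in> \<Omega>" using w W by blast
    then show "(\<lambda>n. X n w) \<longlonglongrightarrow> f w"
      by (rule hconv_imp_pointwise[OF H M(2) X(2)])
    have "X n w = cnj (c w) * X' n w" for n using X' w by (auto simp: S_def rescaled_on_def)
    then show "(\<lambda>n. X n w) \<longlonglongrightarrow> cnj (c w) * f' w"
      using hconv_imp_pointwise[OF H' M'(2) f' \<open>w \<in> \<Omega>\<close>] by (simp add: tendsto_intros)
  qed
  moreover have "ip M g f = ip M' g' f'" if g: "rescaled_on W c M M' g g'" for g g'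
  proof (rule LIMSEQ_unique)
    have gc: "g \<in> carr M" "g' \<in> carr M'" using g by (auto simp: rescaled_on_def)
    show "(\<lambda>n. ip M g (X n)) \<longlonglongrightarrow> ip M g f"
      by (intro hconv_ip[OF H _ X(2)] hconv_const H gc)
    have "ip M g (X n) = ip M' g' (X' n)" for n using X' g by (auto simp: S_def)
    then show "(\<lambda>n. ip M g (X n)) \<longlonglongrightarrow> ip M' g' f'"
      using hconv_ip[OF H' hconv_const[OF H' gc(2)] f'] by simp
  qed
  moreover have "f' \<in> carr M'" using f' by (simp add: hconv_def)
  ultimately show ?thesis using f by (auto simp: rescaled_on_def)
qed

text \<open>Rescaling is an isometry in both directions, and it commutes with multiplication by
  polynomials because it is itself a multiplication on \<open>W\<close>.\<close>

theorem module_equivalent_if_kernels_rescaled: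
  assumes \<Omega>: "open \<Omega>" "connected \<Omega>"
    and M: "hilbert_module \<Omega> M" "reproducing_kernel \<Omega> M K"
    and M': "hilbert_module \<Omega> M'" "reproducing_kernel \<Omega> M' K'"
    and W: "open W" "W \<noteq> {}" "W \<subseteq> \<Omega>"
    and c: "\<And>z w. z \<in> W \<Longrightarrow> w \<in> W \<Longrightarrow> K z w = cnj (c z) * c w * K' z w" "\<And>z. z \<in> W \<Longrightarrow> c z \<noteq> 0"
  shows "module_equivalent M M'"
proof -
  note H = hilbert_module_space[OF M(1)] and H' = hilbert_module_space[OF M'(1)]
  let ?R = "rescaled_on W c M M'"
  have "\<forall>f\<in>carr M. \<exists>f'. ?R f f' \<and> (\<forall>g g'. ?R g g' \<longrightarrow> ip M g f = ip M' g' f')"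
    using kernel_rescaling_transfer[OF \<Omega> M M' W c(1)] by blast
  then obtain U where U: "\<And>f. f \<in> carr M \<Longrightarrow> ?R f (U f)"
    and U_ip: "\<And>f g g'. f \<in> carr M \<Longrightarrow> ?R g g' \<Longrightarrow> ip M g f = ip M' g' (U f)"
    by metis
  have uniq: "f' = U f" if "?R f f'" for f f'
  proof (rule hilbert_module_eqI[OF M'(1) \<Omega> W])
    have "?R f (U f)" using that U by (auto simp: rescaled_on_def)
    then show "f' \<in> carr M'" "U f \<in> carr M'" "\<And>z. z \<in> W \<Longrightarrow> f' z = U f z"
      using that c(2) by (auto simp: rescaled_on_def)
  qed
  have inj: "inj_on U (carr M)"
  proof (rule inj_onI)
    fix f g assume fg: "f \<in> carr M" "g \<in> carr M" "U f = U g"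
    show "f = g"
      using U[OF fg(1)] U[OF fg(2)] fg(3)
      by (intro hilbert_module_eqI[OF M(1) \<Omega> W fg(1,2)]) (auto simp: rescaled_on_def)
  qed
  have surj: "U ` carr M = carr M'"
  proof
    show "U ` carr M \<subseteq> carr M'" using U by (auto simp: rescaled_on_def)
    show "carr M' \<subseteq> U ` carr M"
    proof
      fix f' assume f': "f' \<in> carr M'"
      have c': "K' z w = cnj (inverse (c z)) * inverse (c w) * K z w" if "z \<in> W" "w \<in> W" for z w
        using c(1)[OF that] c(2)[OF that(1)] c(2)[OF that(2)] by (simp add: field_simps)
      obtain f where "rescaled_on W (\<lambda>z. inverse (c z)) M' M f' f"
        using kernel_rescaling_transfer[OF \<Omega> M' M W c' f'] by blast
      then have "?R f f'" using c(2) by (auto simp: rescaled_on_def field_simps)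
      then have "f' = U f" "f \<in> carr M" by (auto intro: uniq simp: rescaled_on_def)
      then show "f' \<in> U ` carr M" by blast
    qed
  qed
  have "U (f + g) = U f + U g" if "f \<in> carr M" "g \<in> carr M" for f g
    using U[OF that(1)] U[OF that(2)]
    by (intro uniq[symmetric]) (auto simp: rescaled_on_def carr_add H H' algebra_simps)
  moreover have "U (cscale a f) = cscale a (U f)" if "f \<in> carr M" for a f
    using U[OF that] carr_cscale[OF H that] carr_cscale[OF H', of "U f"]
    by (intro uniq[symmetric]) (auto simp: rescaled_on_def cscale_def algebra_simps)
  moreover have "ip M' (U f) (U g) = ip M f g" if "f \<in> carr M" "g \<in> carr M" for f g
    using U_ip[OF that(2) U[OF that(1)]] by simp
  moreover have "U (pmult p f) = pmult p (U f)" if "f \<in> carr M" for p f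
    using U[OF that] pmult_carr[OF M(1) that] pmult_carr[OF M'(1), of "U f"]
    by (intro uniq[symmetric]) (auto simp: rescaled_on_def pmult_def algebra_simps)
  ultimately show ?thesis
    unfolding module_equivalent_def using inj surj by (intro exI[of _ U]) (auto simp: bij_betw_def)
qed

section \<open>Antiholomorphic maps into a Hilbert space\<close>

lemma vcnj_nth [simp]: "vcnj u $ j = cnj (u $ j)"
  by (simp add: vcnj_def)

lemma vcnj_vcnj [simp]: "vcnj (vcnj u) = u"
  by (simp add: vec_eq_iff)

lemma vcnj_add: "vcnj (u + v) = vcnj u + vcnj v"
  by (simp add: vec_eq_iff)

lemma vcnj_cmult: "vcnj (c *s u) = cnj c *s vcnj u"
  by (simp add: vec_eq_iff)

lemma vcnj_eq_0_iff [simp]: "vcnj u = 0 \<longleftrightarrow> u = 0"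
  by (simp add: vec_eq_iff)

lemma norm_vcnj [simp]: "norm (vcnj u) = norm u"
  by (simp add: norm_vec_def L2_set_def)

lemma bounded_linear_vcnj: "bounded_linear vcnj"
  by (rule bounded_linear_intro[where K=1]) (auto simp: vec_eq_iff)

lemma filterlim_vcnj_at_0: "filterlim vcnj (at 0) (at (0 :: complex^'n))"
proof -
  have "(vcnj \<longlongrightarrow> vcnj 0) (at (0 :: complex^'n))"
    using bounded_linear.tendsto[OF bounded_linear_vcnj tendsto_ident_at] .
  moreover have "vcnj (0 :: complex^'n) = 0" by simp
  ultimately show ?thesis
    by (simp add: filterlim_at eventually_at_filter)
qed

lemma antihol_into_carr: "antihol_into M F S \<Longrightarrow> w \<in> S \<Longrightarrow> F w \<in> carr M"
  by (simp add: antihol_into_def)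

lemma antihol_into_hconv:
  assumes M: "hilbert_space M" and F: "antihol_into M F S" and S: "open S" "w \<in> S"
    and X: "(X \<longlongrightarrow> w) Fl"
  shows "hconv M (\<lambda>x. F (X x)) (F w) Fl"
proof -
  obtain D where D: "\<And>j. D j \<in> carr M"
    and lim: "((\<lambda>h. hnorm M (F (w + h) - F w - (\<Sum>j\<in>UNIV. cscale (cnj (h $ j)) (D j))) / norm h) \<longlongrightarrow> 0) (at 0)"
    using F S(2) unfolding antihol_into_def by blast
  have ev: "\<forall>\<^sub>F x in Fl. X x \<in> S" using X S by (auto dest: topological_tendstoD)
  \<comment> \<open>The difference quotient, with the value at \<open>0\<close> that makes it continuous there: \<open>X x = w\<close> is
    possible.\<close>
  define q where "q = (\<lambda>h. if h = 0 then 0 else hnorm M (F (w + h) - F w - (\<Sum>j\<in>UNIV. cscale (cnj (h $ j)) (D j))) / norm h)"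
  define L where "L = (\<lambda>h. \<Sum>j\<in>UNIV. cscale (cnj (h $ j)) (D j))"
  have LM: "L h \<in> carr M" for h unfolding L_def by (intro carr_sum carr_cscale M D)
  have "(q \<longlongrightarrow> 0) (at 0)"
    using lim by (rule tendsto_cong[THEN iffD1, rotated]) (auto simp: q_def eventually_at_filter)
  then have "isCont q 0" by (simp add: isCont_def q_def)
  moreover have h0: "((\<lambda>x. X x - w) \<longlongrightarrow> 0) Fl" using X by (simp add: LIM_zero_iff)
  ultimately have q: "((\<lambda>x. q (X x - w)) \<longlongrightarrow> 0) Fl"
    using isCont_tendsto_compose[of 0 q] by (force simp: q_def)
  have "((\<lambda>x. q (X x - w) * norm (X x - w)) \<longlongrightarrow> 0 * norm (0 :: complex^'a)) Fl"
    by (intro tendsto_intros q h0)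
  moreover have "q h * norm h = hnorm M (F (w + h) - F w - L h)" if "w + h \<in> S" for h
    using hnorm_eq_0_iff[of M 0] carr_0[OF M] M by (auto simp: q_def L_def)
  then have "\<forall>\<^sub>F x in Fl. q (X x - w) * norm (X x - w) = hnorm M (F (X x) - F w - L (X x - w) - 0)"
    using ev by (force elim: eventually_mono)
  ultimately have "((\<lambda>x. hnorm M (F (X x) - F w - L (X x - w) - 0)) \<longlongrightarrow> 0) Fl"
    using tendsto_cong by force
  then have R: "hconv M (\<lambda>x. F (X x) - F w - L (X x - w)) 0 Fl"
    using ev LM antihol_into_carr[OF F] S(2)
    by (auto simp: hconv_def carr_0 M carr_diff elim!: eventually_mono)
  have "hconv M (\<lambda>x. L (X x - w)) (\<Sum>j\<in>UNIV. cscale (cnj (0 $ j)) (D j)) Fl"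
    unfolding L_def by (intro hconv_sum hconv_cscale hconv_const M D tendsto_intros h0)
  from hconv_add[OF M hconv_add[OF M R this] hconv_const[OF M antihol_into_carr[OF F S(2)]]]
  show ?thesis by simp
qed

lemma antihol_into_line:
  fixes e :: "complex^'m::finite"
  assumes M: "hilbert_space M" and F: "antihol_into M F S" and S: "open S" "w \<in> S"
  shows "\<exists>D. hconv M (\<lambda>h. cscale (inverse (cnj h)) (F (w + h *s e) - F w)) D (at 0)"
proof (cases "e = 0")
  case True
  then show ?thesis using hconv_const[OF M carr_0[OF M]] by auto
next
  case False
  obtain D where D: "\<And>j. D j \<in> carr M"
    and lim: "((\<lambda>h. hnorm M (F (w + h) - F w - (\<Sum>j\<in>UNIV. cscale (cnj (h $ j)) (D j))) / norm h) \<longlongrightarrow> 0) (at 0)"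
    using F S(2) unfolding antihol_into_def by blast
  define De where "De = (\<Sum>j\<in>UNIV. cscale (cnj (e $ j)) (D j))"
  have DeM: "De \<in> carr M" unfolding De_def by (intro carr_sum carr_cscale M D)
  have he: "((\<lambda>h. h *s e) \<longlongrightarrow> 0) (at 0)"
    using bounded_linear.tendsto[OF bounded_linear_cmult_vec[of e] tendsto_ident_at[of 0 UNIV]] by simp
  then have "filterlim (\<lambda>h. h *s e) (at 0) (at 0)"
    using False by (auto simp: filterlim_at eventually_at_filter)
  from filterlim_compose[OF lim this] tendsto_mult_right_zero
  have lim': "((\<lambda>h. norm e * (hnorm M (F (w + h *s e) - F w - (\<Sum>j\<in>UNIV. cscale (cnj ((h *s e) $ j)) (D j))) / norm (h *s e))) \<longlongrightarrow> 0) (at 0)"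
    by fast
  have "((\<lambda>h. w + h *s e) \<longlongrightarrow> w + 0) (at 0)" by (intro tendsto_intros he)
  then have ev: "\<forall>\<^sub>F h in at 0. w + h *s e \<in> S"
    using S by (auto dest: topological_tendstoD)
  have ev': "\<forall>\<^sub>F h in at 0. cscale (inverse (cnj h)) (F (w + h *s e) - F w) \<in> carr M"
    using ev by eventually_elim (intro carr_cscale carr_diff M antihol_into_carr[OF F] S(2))
  have "\<forall>\<^sub>F h in at 0. norm e * (hnorm M (F (w + h *s e) - F w - (\<Sum>j\<in>UNIV. cscale (cnj ((h *s e) $ j)) (D j))) / norm (h *s e))
      = hnorm M (cscale (inverse (cnj h)) (F (w + h *s e) - F w) - De)"
    using ev eventually_neq_at_within[of 0 0 UNIV]
  proof eventually_elim
    case (elim h)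
    define R where "R = F (w + h *s e) - F w - (\<Sum>j\<in>UNIV. cscale (cnj ((h *s e) $ j)) (D j))"
    have RM: "R \<in> carr M"
      unfolding R_def using elim by (intro carr_diff carr_sum carr_cscale M antihol_into_carr[OF F] S(2) D) auto
    have "(\<Sum>j\<in>UNIV. cscale (cnj ((h *s e) $ j)) (D j)) = cscale (cnj h) De"
      by (simp add: De_def cfun.scale_sum_right cfun.scale_scale)
    then have "cscale (inverse (cnj h)) (F (w + h *s e) - F w) - De = cscale (inverse (cnj h)) R"
      using elim by (simp add: R_def cscale_def fun_eq_iff field_simps)
    moreover have "hnorm M (cscale (inverse (cnj h)) R) = norm e * (hnorm M R / norm (h *s e))"
      using elim False by (simp add: hnorm_cscale[OF M RM] norm_cmult_vec norm_inverse divide_inverse)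
    ultimately show ?case unfolding R_def by simp
  qed
  from tendsto_cong[THEN iffD1, OF this lim'] ev' DeM show ?thesis
    by (auto simp: hconv_def)
qed

lemma filterlim_cnj_at_0: "filterlim cnj (at 0) (at 0)"
proof -
  have "(cnj \<longlongrightarrow> cnj 0) (at 0)" by (intro tendsto_intros)
  then show ?thesis by (auto simp: filterlim_at eventually_at_filter)
qed

lemma hconv_compose: "hconv M X f F \<Longrightarrow> filterlim g F G \<Longrightarrow> hconv M (\<lambda>x. X (g x)) f G"
  unfolding hconv_def using filterlim_compose[of "\<lambda>x. hnorm M (X x - f)"] eventually_compose_filterlim by fast

text \<open>The difference quotient of the pairing splits as for a product; the conjugation in the
  argument of \<open>F\<close> and the antilinearity of the inner product in its second argument both turn
  antiholomorphic into holomorphic dependence.\<close>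

lemma ip_antihol_field_differentiable:
  assumes M: "hilbert_space M" and FG: "antihol_into M F S" "antihol_into M G S" and S: "open S"
    and \<tau>: "a + cnj \<tau> *s e \<in> S" "b + \<tau> *s e' \<in> S"
  shows "(\<lambda>\<tau>. ip M (F (a + cnj \<tau> *s e)) (G (b + \<tau> *s e'))) field_differentiable at \<tau>"
proof -
  define w where "w = a + cnj \<tau> *s e"
  define z where "z = b + \<tau> *s e'"
  have wz: "w \<in> S" "z \<in> S" using \<tau> by (auto simp: w_def z_def)
  obtain DF where DF: "hconv M (\<lambda>h. cscale (inverse (cnj h)) (F (w + h *s e) - F w)) DF (at 0)"
    using antihol_into_line[OF M FG(1) S wz(1)] by blast
  obtain DG where DG: "hconv M (\<lambda>h. cscale (inverse (cnj h)) (G (z + h *s e') - G z)) DG (at 0)"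
    using antihol_into_line[OF M FG(2) S wz(2)] by blast
  have DF': "hconv M (\<lambda>h. cscale (inverse h) (F (w + cnj h *s e) - F w)) DF (at 0)"
    using hconv_compose[OF DF filterlim_cnj_at_0] by simp
  have lim: "((\<lambda>h. v + u h *s d) \<longlongrightarrow> v) (at 0)" if "(u \<longlongrightarrow> 0) (at 0)" for u :: "complex \<Rightarrow> complex" and v d :: "complex^'a"
    using tendsto_add[OF tendsto_const bounded_linear.tendsto[OF bounded_linear_cmult_vec[of d] that], of v] by simp
  have "hconv M (\<lambda>h. G (z + h *s e')) (G z) (at 0)"
    by (intro antihol_into_hconv[OF M FG(2) S wz(2)] lim tendsto_ident_at)
  from tendsto_add[OF hconv_ip[OF M DF' this] hconv_ip[OF M hconv_const[OF M antihol_into_carr[OF FG(1) wz(1)]] DG]]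
  have sum_lim: "((\<lambda>h. ip M (cscale (inverse h) (F (w + cnj h *s e) - F w)) (G (z + h *s e'))
     + ip M (F w) (cscale (inverse (cnj h)) (G (z + h *s e') - G z))) \<longlongrightarrow> ip M DF (G z) + ip M (F w) DG) (at 0)" .
  have "((\<lambda>h. w + cnj h *s e) \<longlongrightarrow> w) (at 0)" "((\<lambda>h. z + h *s e') \<longlongrightarrow> z) (at 0)"
    using filterlim_cnj_at_0 by (auto intro!: lim simp: filterlim_at)
  then have "\<forall>\<^sub>F h in at 0. w + cnj h *s e \<in> S" "\<forall>\<^sub>F h in at 0. z + h *s e' \<in> S"
    using S wz by (auto dest: topological_tendstoD)
  then have "\<forall>\<^sub>F h in at 0. ip M (cscale (inverse h) (F (w + cnj h *s e) - F w)) (G (z + h *s e'))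
     + ip M (F w) (cscale (inverse (cnj h)) (G (z + h *s e') - G z))
     = (ip M (F (a + cnj (\<tau> + h) *s e)) (G (b + (\<tau> + h) *s e')) - ip M (F (a + cnj \<tau> *s e)) (G (b + \<tau> *s e'))) / h"
  proof eventually_elim
    case (elim h)
    have pts: "a + cnj (\<tau> + h) *s e = w + cnj h *s e" "b + (\<tau> + h) *s e' = z + h *s e'"
      by (auto simp: w_def z_def vec_eq_iff algebra_simps)
    show ?case
      unfolding pts w_def[symmetric] z_def[symmetric]
      using elim wz antihol_into_carr[OF FG(1)] antihol_into_carr[OF FG(2)]
      by (simp add: ip_cscale_left ip_cscale_right ip_diff_left ip_diff_right M carr_diff)
         (simp add: divide_inverse algebra_simps)
  qed
  from tendsto_cong[THEN iffD1, OF this sum_lim] show ?thesis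
    by (auto simp: field_differentiable_def DERIV_def)
qed

lemma ip_antihol_hol_on:
  assumes M: "hilbert_space M" and F: "antihol_into M F S" and S: "open S" and e: "e \<in> carr M"
  shows "hol_on (\<lambda>z. ip M (F (vcnj z)) e) {z. vcnj z \<in> S}"
  unfolding hol_wrt_def
proof
  fix z assume "z \<in> {z. vcnj z \<in> S}"
  then have w: "vcnj z \<in> S" by simp
  then obtain D where D: "\<And>j. D j \<in> carr M"
    and lim: "((\<lambda>h. hnorm M (F (vcnj z + h) - F (vcnj z) - (\<Sum>j\<in>UNIV. cscale (cnj (h $ j)) (D j))) / norm h) \<longlongrightarrow> 0) (at 0)"
    using F unfolding antihol_into_def by blast
  define L where "L = (\<lambda>h :: complex^'a. \<Sum>j\<in>UNIV. h $ j * ip M (D j) e)"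
  have "bounded_linear L"
    unfolding L_def by (intro bounded_linear_sum bounded_linear_mult_const bounded_linear_vec_nth)
  have ev: "\<forall>\<^sub>F h in at 0. vcnj z + vcnj h \<in> S"
  proof -
    have "((\<lambda>h. vcnj z + vcnj h) \<longlongrightarrow> vcnj z + 0) (at 0)"
      using filterlim_vcnj_at_0 by (intro tendsto_intros) (auto simp: filterlim_at)
    then show ?thesis using S w by (auto dest: topological_tendstoD)
  qed
  have "((\<lambda>h. hnorm M (F (vcnj z + vcnj h) - F (vcnj z) - (\<Sum>j\<in>UNIV. cscale (cnj (vcnj h $ j)) (D j))) / norm (vcnj h) * hnorm M e)
      \<longlongrightarrow> 0 * hnorm M e) (at 0)"
    by (intro tendsto_intros filterlim_compose[OF lim filterlim_vcnj_at_0])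
  then have lim': "((\<lambda>h. hnorm M (F (vcnj z + vcnj h) - F (vcnj z) - (\<Sum>j\<in>UNIV. cscale (h $ j) (D j))) / norm h * hnorm M e)
      \<longlongrightarrow> 0) (at 0)" by simp
  have "\<forall>\<^sub>F h in at 0. norm (norm (ip M (F (vcnj (z + h))) e - ip M (F (vcnj z)) e - L h) / norm h)
      \<le> hnorm M (F (vcnj z + vcnj h) - F (vcnj z) - (\<Sum>j\<in>UNIV. cscale (h $ j) (D j))) / norm h * hnorm M e"
    using ev
  proof eventually_elim
    case (elim h)
    have FM: "F (vcnj z + vcnj h) \<in> carr M" "F (vcnj z) \<in> carr M" "(\<Sum>j\<in>UNIV. cscale (h $ j) (D j)) \<in> carr M"
      using elim w D by (auto intro!: antihol_into_carr[OF F] carr_sum carr_cscale M)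
    have "ip M (F (vcnj (z + h))) e - ip M (F (vcnj z)) e - L h
        = ip M (F (vcnj z + vcnj h) - F (vcnj z) - (\<Sum>j\<in>UNIV. cscale (h $ j) (D j))) e"
      using FM e D by (simp add: L_def vcnj_add ip_diff_left ip_sum_left ip_cscale_left M carr_diff carr_cscale)
    then have "cmod (ip M (F (vcnj (z + h))) e - ip M (F (vcnj z)) e - L h)
        \<le> hnorm M (F (vcnj z + vcnj h) - F (vcnj z) - (\<Sum>j\<in>UNIV. cscale (h $ j) (D j))) * hnorm M e"
      using FM e by (simp add: cauchy_schwarz M carr_diff)
    from divide_right_mono[OF this, of "norm h"] show ?case by simp
  qed
  from Lim_null_comparison[OF this lim']
  have "((\<lambda>z. ip M (F (vcnj z)) e) has_derivative L) (at z)"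
    using \<open>bounded_linear L\<close> by (simp add: has_derivative_at)
  moreover have "L (c *s v) = c * L v" for c v
    by (simp add: L_def sum_distrib_left mult.assoc)
  ultimately show "\<exists>D. ((\<lambda>z. ip M (F (vcnj z)) e) has_derivative D) (at z) \<and> (\<forall>c v. D (c *s v) = c * D v)"
    by blast
qed

section \<open>Polarization\<close>

text \<open>The points \<open>z\<close> and \<open>w\<close> are \<open>m + \<tau> e\<close> and \<open>m + cnj \<tau> e\<close> at \<open>\<tau> = \<i>\<close>, and for real
  \<open>\<tau>\<close> these two points coincide; so a holomorphic function of \<open>\<tau>\<close> that vanishes on a real interval is evaluated at \<open>\<i>\<close>.\<close>

lemma polarization:
  fixes A :: "complex^'m \<Rightarrow> complex^'m \<Rightarrow> complex"
  assumes W: "open W" "convex W"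
    and hol: "\<And>m e. (\<lambda>\<tau>. A (m + \<tau> *s e) (m + cnj \<tau> *s e)) holomorphic_on
      {\<tau>. m + \<tau> *s e \<in> W \<and> m + cnj \<tau> *s e \<in> W}"
    and diag: "\<And>w. w \<in> W \<Longrightarrow> A w w = 0"
    and zw: "z \<in> W" "w \<in> W"
  shows "A z w = 0"
proof -
  define m where "m = (1/2) *s (z + w)"
  define e where "e = (- \<i> / 2) *s (z - w)"
  have z: "m + \<i> *s e = z" and w: "m + cnj \<i> *s e = w"
    by (simp_all add: m_def e_def vec_eq_iff field_simps)
  have "m = (1/2) *\<^sub>R z + (1/2) *\<^sub>R w"
    by (simp add: m_def vec_eq_iff scaleR_conv_of_real[where 'a=complex] algebra_simps)
  then have mW: "m \<in> W" using convexD[OF W(2) zw, of "1/2" "1/2"] by simp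
  define T where "T = {\<tau>. m + \<tau> *s e \<in> W}"
  have T: "open T" "convex T"
    unfolding T_def by (intro open_line_preimage convex_line_preimage W)+
  have cT: "{\<tau>. m + cnj \<tau> *s e \<in> W} = cnj -` T" by (auto simp: T_def)
  have "open (cnj -` T)" "convex (cnj -` T)"
    using T by (auto intro!: open_vimage continuous_intros convex_linear_vimage bounded_linear.linear[OF bounded_linear_cnj])
  then have T2: "open (T \<inter> cnj -` T)" "connected (T \<inter> cnj -` T)"
    using T by (auto intro!: convex_connected convex_Int)
  have T2_eq: "T \<inter> cnj -` T = {\<tau>. m + \<tau> *s e \<in> W \<and> m + cnj \<tau> *s e \<in> W}"
    by (auto simp: T_def)
  have 0: "0 \<in> T \<inter> cnj -` T" using mW by (simp add: T_def)
  obtain \<epsilon> where \<epsilon>: "\<epsilon> > 0" "ball 0 \<epsilon> \<subseteq> T \<inter> cnj -` T"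
    using T2(1) 0 open_contains_ball by blast
  define U where "U = complex_of_real ` {0<..<\<epsilon>}"
  have "A (m + \<i> *s e) (m + cnj \<i> *s e) = 0"
  proof (rule analytic_continuation[OF hol[of m e, folded T2_eq] T2 _ 0])
    show "U \<subseteq> T \<inter> cnj -` T"
      using \<epsilon>(2) by (force simp: U_def)
    show "0 islimpt U"
      unfolding islimpt_approachable
    proof (intro allI impI)
      fix d :: real assume "d > 0"
      then show "\<exists>x'\<in>U. x' \<noteq> 0 \<and> dist x' 0 < d"
        using \<epsilon>(1) by (intro bexI[of _ "of_real (min d \<epsilon> / 2)"])
          (auto simp: U_def simp del: of_real_divide intro!: imageI)
    qed
    show "\<i> \<in> T \<inter> cnj -` T"
      unfolding T2_eq mem_Collect_eq z w using zw by blast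
    fix \<tau> assume "\<tau> \<in> U"
    with \<open>U \<subseteq> T \<inter> cnj -` T\<close> have "m + \<tau> *s e \<in> W" "cnj \<tau> = \<tau>" by (auto simp: T_def U_def)
    then show "A (m + \<tau> *s e) (m + cnj \<tau> *s e) = 0" using diag by simp
  qed
  then show ?thesis unfolding z w .
qed

section \<open>Directions of approach to a complete intersection\<close>

text \<open>That \<open>g w\<close> is proportional to \<open>u\<close> amounts to \<open>t - 1\<close> equations; the coordinates along the
  zero set give \<open>m - t\<close> further equations, which on the zero set hold only at \<open>p\<close>. These are fewer than
  \<open>m\<close> equations, so they have a common solution on every small sphere around \<open>p\<close>, and this solution
  is not on the zero set.\<close>

lemma zero_set_direction:
  fixes g :: "'t::finite \<Rightarrow> complex^'m::finite \<Rightarrow> complex" and u :: "complex^'t"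
  assumes \<Delta>: "open \<Delta>" and g: "\<And>j. hol_on (g j) \<Delta>"
    and p: "p \<in> \<Delta>" "\<And>j. g j p = 0"
    and sub: "submanifold_at {w \<in> \<Delta>. \<forall>j. g j w = 0} p CARD('t)"
    and u: "u $ i0 \<noteq> 0" and \<epsilon>: "\<epsilon> > 0"
  shows "\<exists>w\<in>\<Delta>. dist w p < \<epsilon> \<and> (\<exists>\<mu>. \<mu> \<noteq> 0 \<and> (\<forall>j. g j w = \<mu> * u $ j))"
proof -
  obtain N V \<phi> \<psi> and J :: "'m set" where N: "open N" "p \<in> N" and hom: "homeomorphism N V \<phi> \<psi>"
    and \<phi>: "hol_map_on \<phi> N" and J: "card J = CARD('t)"
    and im: "\<phi> ` ({w \<in> \<Delta>. \<forall>j. g j w = 0} \<inter> N) = {z \<in> V. \<forall>j\<in>J. z $ j = 0}"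
    using sub unfolding submanifold_at_def by blast
  \<comment> \<open>Indices on the left stand for the coordinates along the zero set, indices on the right for
    proportionality to \<open>u\<close>.\<close>
  define S where "S = Inl ` (- J) \<union> Inr ` (- {i0}) "
  define f where "f = (\<lambda>s w. case s of Inl k \<Rightarrow> \<phi> w $ k - \<phi> p $ k | Inr j \<Rightarrow> u $ i0 * g j w - u $ j * g i0 w)"
  have "card S = card (- J) + card (- {i0})"
    unfolding S_def by (subst card_Un_disjoint) (auto simp: card_image)
  also have "\<dots> < CARD('m)"
    using J card_mono[of UNIV J] zero_less_card_finite[where 'a='t] by (simp add: card_Diff_subset Compl_eq_Diff_UNIV)
  finally have S: "finite S" "card S < CARD('m)" by (auto simp: S_def)
  obtain e where e: "e > 0" "cball p e \<subseteq> N \<inter> \<Delta>"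
    using N \<Delta> p(1) open_contains_cball by (metis IntI open_Int)
  define \<rho> where "\<rho> = min e (\<epsilon> / 2)"
  have \<rho>: "\<rho> > 0" "\<rho> < \<epsilon>" "cball p \<rho> \<subseteq> N \<inter> \<Delta>" using e \<epsilon> by (auto simp: \<rho>_def)
  have "hol_on (f s) (N \<inter> \<Delta>)" for s
  proof (cases s)
    case (Inl k)
    have "hol_on (\<lambda>w. \<phi> w $ k) (N \<inter> \<Delta>)" using \<phi> by (auto simp: hol_map_on_def hol_wrt_def)
    from hol_wrt_add[OF this hol_wrt_const[of _ "- \<phi> p $ k"]] Inl show ?thesis by (simp add: f_def)
  next
    case (Inr j)
    have "hol_on (g j) (N \<inter> \<Delta>)" for j using g by (auto simp: hol_wrt_def)
    then have "hol_on (\<lambda>w. u $ i0 * g j w + (- u $ j) * g i0 w) (N \<inter> \<Delta>)"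
      by (intro hol_wrt_add hol_wrt_mult hol_wrt_const)
    with Inr show ?thesis by (simp add: f_def)
  qed
  moreover have "f s p = 0" for s using p(2) by (auto simp: f_def split: sum.splits)
  ultimately obtain w where w: "dist w p = \<rho>" "\<And>s. s \<in> S \<Longrightarrow> f s w = 0"
    using common_zero_on_sphere[OF S \<rho>(3,1)] by blast
  have wN: "w \<in> N" "w \<in> \<Delta>" using w(1) \<rho>(3) by (auto simp: dist_commute)
  have par: "g j w = (g i0 w / u $ i0) * u $ j" for j
  proof (cases "j = i0")
    case False
    then have "f (Inr j) w = 0" by (intro w(2)) (auto simp: S_def)
    then show ?thesis using u by (simp add: f_def field_simps)
  qed (use u in simp)
  have "g i0 w \<noteq> 0"
  proof
    assume "g i0 w = 0"
    then have "g j w = 0" for j using par[of j] by simp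
    then have "\<phi> w \<in> \<phi> ` ({w \<in> \<Delta>. \<forall>j. g j w = 0} \<inter> N)" "\<phi> p \<in> \<phi> ` ({w \<in> \<Delta>. \<forall>j. g j w = 0} \<inter> N)"
      using wN N p by (intro imageI; simp)+
    then have "\<phi> w $ k = \<phi> p $ k" if "k \<in> J" for k using that unfolding im by simp
    moreover have "\<phi> w $ k = \<phi> p $ k" if "k \<notin> J" for k
      using w(2)[of "Inl k"] that by (simp add: S_def f_def)
    ultimately have "\<phi> w = \<phi> p" by (auto simp: vec_eq_iff)
    then have "w = p" using homeomorphism_apply1[OF hom] wN(1) N(2) by metis
    with w(1) \<rho>(1) show False by simp
  qed
  then have "g i0 w / u $ i0 \<noteq> 0" using u by simp
  then show ?thesis
    using wN(2) w(1) \<rho>(2) par by blast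
qed

section \<open>Kernel bundles in homogeneous coordinates\<close>

text \<open>The frames \<open>sect Kd i\<close> in homogeneous coordinates: the vector depends on the representative \<open>u\<close>
  of a point of projective space, the line that it spans does not.\<close>

definition kernel_comb ::
    "('t::finite \<Rightarrow> complex^'m::finite \<Rightarrow> complex^'m \<Rightarrow> complex) \<Rightarrow> complex^'m \<Rightarrow> complex^'t \<Rightarrow> complex^'m \<Rightarrow> complex"
  where "kernel_comb Kd w u = (\<Sum>j\<in>UNIV. cscale (cnj (u $ j)) (Kd j w))"

lemma kernel_comb_cmult: "kernel_comb Kd w (c *s u) = cscale (cnj c) (kernel_comb Kd w u)"
  by (simp add: kernel_comb_def cfun.scale_sum_right)

lemma sect_proj:
  assumes "u $ i \<noteq> 0"
  shows "sect Kd i (w, proj u) = cscale (inverse (cnj (u $ i))) (kernel_comb Kd w u)"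
proof -
  have "sect Kd i (w, proj u) = cscale (cnj (u $ i / u $ i)) (Kd i w)
      + (\<Sum>j\<in>UNIV - {i}. cscale (cnj (u $ j / u $ i)) (Kd j w))"
    using assms by (simp add: sect_def theta_proj)
  also have "\<dots> = (\<Sum>j\<in>UNIV. cscale (cnj (u $ j / u $ i)) (Kd j w))"
    by (rule sum.remove[symmetric]) auto
  finally show ?thesis
    by (simp add: kernel_comb_def cfun.scale_sum_right divide_inverse mult.commute)
qed

text \<open>The point of the conjugated monoidal transform that corresponds to \<open>(w, \<pi>(u))\<close>.\<close>

definition conj_point :: "complex^'m::finite \<Rightarrow> complex^'t::finite \<Rightarrow> ('m, 't) bpoint"
  where "conj_point w u = (vcnj w, proj (vcnj u))"

lemma conj_pt_conj_point [simp]: "conj_pt (conj_point w u) = (w, proj u)"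
  by (simp add: conj_point_def conj_pt_proj)

lemma in_chart_conj_point [simp]: "in_chart i (snd (conj_point w u)) \<longleftrightarrow> u $ i \<noteq> 0"
  by (simp add: conj_point_def)

lemma monoidal_transform_conj_iff:
  "x \<in> monoidal_transform_conj \<Delta> g \<longleftrightarrow>
    (\<exists>w u. x = conj_point w u \<and> w \<in> \<Delta> \<and> u \<noteq> 0 \<and> (\<forall>i j. u $ i * g j w = u $ j * g i w))"
proof
  assume "x \<in> monoidal_transform_conj \<Delta> g"
  then obtain w u where "x = conj_pt (w, proj u)" "w \<in> \<Delta>" "u \<noteq> 0" "\<forall>i j. u $ i * g j w - u $ j * g i w = 0"
    by (auto simp: monoidal_transform_conj_def monoidal_transform_def)
  then show "\<exists>w u. x = conj_point w u \<and> w \<in> \<Delta> \<and> u \<noteq> 0 \<and> (\<forall>i j. u $ i * g j w = u $ j * g i w)"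
    unfolding conj_pt_proj conj_point_def[symmetric] by force
next
  assume "\<exists>w u. x = conj_point w u \<and> w \<in> \<Delta> \<and> u \<noteq> 0 \<and> (\<forall>i j. u $ i * g j w = u $ j * g i w)"
  then obtain w u where x: "x = conj_pt (w, proj u)"
      and "w \<in> \<Delta>" "u \<noteq> 0" "\<forall>i j. u $ i * g j w = u $ j * g i w"
    unfolding conj_point_def conj_pt_proj[symmetric] by blast
  then have "(w, proj u) \<in> monoidal_transform \<Delta> g" by (auto simp: monoidal_transform_def)
  with x show "x \<in> monoidal_transform_conj \<Delta> g" by (simp add: monoidal_transform_conj_def)
qed

lemma exists_chart: "u \<noteq> 0 \<Longrightarrow> \<exists>i. u $ i \<noteq> 0"
  by (auto simp: vec_eq_iff)

lemma fibre_kernel_bundle: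
  assumes "u \<noteq> 0"
  shows "fibre (kernel_bundle M \<Delta> g Kd) (conj_point w u) = range (\<lambda>c. cscale c (kernel_comb Kd w u))"
proof -
  have "cfun.span {sect Kd i (conj_pt (conj_point w u))} = range (\<lambda>c. cscale c (kernel_comb Kd w u))"
    if i: "u $ i \<noteq> 0" for i
  proof -
    have "range (\<lambda>c. cscale c (kernel_comb Kd w u)) \<subseteq> range (\<lambda>c. cscale (c * inverse (cnj (u $ i))) (kernel_comb Kd w u))"
    proof safe
      fix c
      show "cscale c (kernel_comb Kd w u) \<in> range (\<lambda>c. cscale (c * inverse (cnj (u $ i))) (kernel_comb Kd w u))"
        using i by (intro image_eqI[of _ _ "c * cnj (u $ i)"]) auto
    qed
    moreover have "range (\<lambda>c. cscale (c * inverse (cnj (u $ i))) (kernel_comb Kd w u)) \<subseteq> range (\<lambda>c. cscale c (kernel_comb Kd w u))"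
      by blast
    ultimately show ?thesis
      by (simp add: sect_proj[OF i] cfun.span_singleton cfun.scale_scale subset_antisym)
  qed
  then show ?thesis
    using exists_chart[OF assms] by (auto simp: kernel_bundle_def)
qed

text \<open>What the two modules have in common; \<open>\<Delta>\<close> takes the place of the polydisc.\<close>

locale decomposed_module =
  fixes \<Omega> \<Delta> :: "(complex^'m::finite) set" and M :: "'m hilb"
    and K :: "complex^'m \<Rightarrow> complex^'m \<Rightarrow> complex"
    and g :: "'t::finite \<Rightarrow> complex^'m \<Rightarrow> complex"
    and Kd :: "'t \<Rightarrow> complex^'m \<Rightarrow> complex^'m \<Rightarrow> complex"
  assumes module: "hilbert_module \<Omega> M"
    and kernel: "reproducing_kernel \<Omega> M K"
    and open_\<Delta>: "open \<Delta>" and \<Delta>_sub: "\<Delta> \<subseteq> \<Omega>"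
    and hol_g: "\<And>j. hol_on (g j) \<Delta>"
    and decomposition: "kernel_decomposition M K \<Delta> g Kd"
begin

lemma space: "hilbert_space M"
  by (rule hilbert_module_space[OF module])

lemma antihol: "antihol_into M (Kd j) \<Delta>"
  using decomposition by (simp add: kernel_decomposition_def)

lemma Kd_carr: "w \<in> \<Delta> \<Longrightarrow> Kd j w \<in> carr M"
  using antihol by (rule antihol_into_carr)

lemma comb_carr: "w \<in> \<Delta> \<Longrightarrow> kernel_comb Kd w u \<in> carr M"
  unfolding kernel_comb_def by (intro carr_sum carr_cscale space Kd_carr)

lemma comb_nonzero: "w \<in> \<Delta> \<Longrightarrow> u \<noteq> 0 \<Longrightarrow> kernel_comb Kd w u \<noteq> 0"
proof
  assume w: "w \<in> \<Delta>" and u: "u \<noteq> 0" and 0: "kernel_comb Kd w u = 0"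
  have "(\<Sum>j\<in>UNIV. cscale (c j) (Kd j w)) = 0 \<longrightarrow> (\<forall>j. c j = 0)" for c
    using decomposition w by (simp add: kernel_decomposition_def)
  from this[of "\<lambda>j. cnj (u $ j)"] 0 have "\<forall>j. cnj (u $ j) = 0"
    by (simp add: kernel_comb_def)
  with u show False by (simp add: vec_eq_iff)
qed

lemma kernel_eq_comb: "w \<in> \<Delta> \<Longrightarrow> (\<lambda>z. K z w) = kernel_comb Kd w (\<chi> j. g j w)"
  using decomposition by (simp add: kernel_decomposition_def kernel_comb_def)

lemma kernel_nonzero: "w \<in> \<Delta> \<Longrightarrow> g i w \<noteq> 0 \<Longrightarrow> (\<lambda>z. K z w) \<noteq> 0"
  using comb_nonzero[of w "\<chi> j. g j w"] kernel_eq_comb by (auto simp: vec_eq_iff)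

lemma comb_hconv:
  assumes "w \<in> \<Delta>" "(X \<longlongrightarrow> w) F"
  shows "hconv M (\<lambda>x. kernel_comb Kd (X x) u) (kernel_comb Kd w u) F"
  unfolding kernel_comb_def
  using assms by (intro hconv_sum hconv_cscale tendsto_const space antihol_into_hconv[OF space antihol open_\<Delta>])

text \<open>Otherwise all kernel functions at points of \<open>\<Delta>\<close> would vanish, so that the module would be
  zero, although the vectors \<open>Kd j w\<close> in it are linearly independent.\<close>

lemma exists_nonzero_generator:
  assumes \<Omega>: "open \<Omega>" "connected \<Omega>" and ne: "\<Delta> \<noteq> {}"
  shows "\<exists>w\<in>\<Delta>. \<exists>i. g i w \<noteq> 0"
proof (rule ccontr)
  assume none: "\<not> ?thesis"
  obtain w0 where w0: "w0 \<in> \<Delta>" using ne by blast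
  define f where "f = Kd (SOME j. True) w0"
  have f: "f \<in> carr M" using w0 by (simp add: f_def Kd_carr)
  have "f = 0"
  proof (rule hilbert_module_eqI[OF module \<Omega> open_\<Delta> ne \<Delta>_sub f carr_0[OF space]])
    fix w assume w: "w \<in> \<Delta>"
    have "(\<chi> j. g j w) = 0" using none w by (auto simp: vec_eq_iff)
    then have "(\<lambda>z. K z w) = cscale 0 0"
      using kernel_eq_comb[OF w] kernel_comb_cmult[of Kd w 0 0] by simp
    then have "f w = ip M f 0"
      using reproducing_kernel_ip[OF kernel _ f] w \<Delta>_sub by (metis cfun.scale_zero_left subset_iff)
    then show "f w = 0 w" using ip_cnj[OF space carr_0[OF space] f] ip_0_left[OF space f] by simp
  qed
  moreover have "kernel_comb Kd w0 (axis (SOME j. True) 1) = f"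
    by (simp add: kernel_comb_def f_def axis_def if_distrib[of cnj] if_distrib[of "\<lambda>c. cscale c _"] cong: if_cong)
  moreover have "axis (SOME j. True) (1::complex) \<noteq> (0 :: complex^'t)" by simp
  ultimately show False using comb_nonzero[OF w0] by metis
qed

lemma kernel_eq_double_sum:
  assumes "w \<in> \<Delta>" "z \<in> \<Delta>"
  shows "K z w = (\<Sum>j\<in>UNIV. \<Sum>k\<in>UNIV. cnj (g j w) * g k z * ip M (Kd j w) (Kd k z))"
proof -
  have "K z w = ip M (\<lambda>y. K y w) (\<lambda>y. K y z)"
    using assms \<Delta>_sub by (subst reproducing_kernel_ip[OF kernel]) (auto intro: reproducing_kernel_carr[OF kernel])
  also have "\<dots> = (\<Sum>j\<in>UNIV. cnj (g j w) * ip M (Kd j w) (\<lambda>y. K y z))"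
    unfolding kernel_eq_comb[OF assms(1)] kernel_comb_def
    using assms \<Delta>_sub reproducing_kernel_carr[OF kernel]
    by (subst ip_sum_left) (auto simp: ip_cscale_left carr_cscale Kd_carr space)
  also have "\<dots> = (\<Sum>j\<in>UNIV. cnj (g j w) * (\<Sum>k\<in>UNIV. g k z * ip M (Kd j w) (Kd k z)))"
    unfolding kernel_eq_comb[OF assms(2)] kernel_comb_def
    using assms by (simp add: ip_sum_right ip_cscale_right carr_cscale Kd_carr space)
  finally show ?thesis by (simp add: sum_distrib_left mult.assoc)
qed

lemma kernel_line_holomorphic:
  "(\<lambda>\<tau>. K (m + \<tau> *s e) (m + cnj \<tau> *s e)) holomorphic_on {\<tau>. m + \<tau> *s e \<in> \<Delta> \<and> m + cnj \<tau> *s e \<in> \<Delta>}"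
proof (rule holomorphic_transform)
  let ?T = "{\<tau>. m + \<tau> *s e \<in> \<Delta> \<and> m + cnj \<tau> *s e \<in> \<Delta>}"
  have "(\<lambda>\<tau>. ip M (Kd j (m + cnj \<tau> *s e)) (Kd k (m + \<tau> *s e))) holomorphic_on ?T" for j k
    unfolding holomorphic_on_def
  proof
    fix \<tau> assume "\<tau> \<in> ?T"
    then show "(\<lambda>\<tau>. ip M (Kd j (m + cnj \<tau> *s e)) (Kd k (m + \<tau> *s e))) field_differentiable at \<tau> within ?T"
      by (intro field_differentiable_at_within[OF ip_antihol_field_differentiable[OF space antihol antihol open_\<Delta>]]) auto
  qed
  moreover have "(\<lambda>\<tau>. cnj (g j (m + cnj \<tau> *s e))) holomorphic_on ?T" for j
    by (rule holomorphic_on_subset[OF holomorphic_on_cnj_line[OF hol_g]]) auto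
  moreover have "(\<lambda>\<tau>. g k (m + \<tau> *s e)) holomorphic_on ?T" for k
    by (rule holomorphic_on_subset[OF holomorphic_on_line[OF hol_g]]) auto
  ultimately show "(\<lambda>\<tau>. \<Sum>j\<in>UNIV. \<Sum>k\<in>UNIV. cnj (g j (m + cnj \<tau> *s e)) * g k (m + \<tau> *s e)
      * ip M (Kd j (m + cnj \<tau> *s e)) (Kd k (m + \<tau> *s e))) holomorphic_on ?T"
    by (intro holomorphic_intros)
  fix \<tau> assume "\<tau> \<in> ?T"
  then show "(\<Sum>j\<in>UNIV. \<Sum>k\<in>UNIV. cnj (g j (m + cnj \<tau> *s e)) * g k (m + \<tau> *s e)
      * ip M (Kd j (m + cnj \<tau> *s e)) (Kd k (m + \<tau> *s e))) = K (m + \<tau> *s e) (m + cnj \<tau> *s e)"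
    by (simp add: kernel_eq_double_sum)
qed

end

section \<open>Equivalent bundles give equivalent modules\<close>

lemma has_derivative_vec_lambda:
  fixes f :: "'n::finite \<Rightarrow> 'a::real_normed_vector \<Rightarrow> complex"
  assumes "\<And>j. (f j has_derivative D j) F"
  shows "((\<lambda>x. \<chi> j. f j x) has_derivative (\<lambda>h. \<chi> j. D j h)) F"
proof -
  have "((\<lambda>x. \<Sum>j\<in>UNIV. f j x *s axis j 1) has_derivative (\<lambda>h. \<Sum>j\<in>UNIV. D j h *s axis j 1)) F"
    by (intro has_derivative_sum bounded_linear.has_derivative[OF bounded_linear_cmult_vec] assms)
  then show ?thesis
    using basis_expansion[of "\<chi> j. f j x" for x] basis_expansion[of "\<chi> j. D j h" for h] by simp
qed

lemma hol_on_conj_chart_compose: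
  fixes F :: "(complex^'m::finite) \<times> (complex^'t::finite) \<Rightarrow> complex"
  assumes F: "hol_wrt pscale F N" and q: "\<And>j. hol_on (q j) W"
    and sub: "\<And>w. w \<in> W \<Longrightarrow> (vcnj w, \<chi> j. cnj (q j w)) \<in> N"
  shows "hol_on (\<lambda>w. cnj (F (vcnj w, \<chi> j. cnj (q j w)))) W"
  unfolding hol_wrt_def
proof
  fix w assume w: "w \<in> W"
  have "\<forall>j. \<exists>D. (q j has_derivative D) (at w) \<and> (\<forall>c v. D (c *s v) = c * D v)"
    using q w unfolding hol_wrt_def by blast
  then obtain D where D: "\<And>j. (q j has_derivative D j) (at w)" "\<And>j c v. D j (c *s v) = c * D j v"
    by metis
  obtain E where E: "(F has_derivative E) (at (vcnj w, \<chi> j. cnj (q j w)))" "\<And>c v. E (pscale c v) = c * E v"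
    using F sub[OF w] unfolding hol_wrt_def by metis
  have "((\<lambda>w. (vcnj w, \<chi> j. cnj (q j w))) has_derivative (\<lambda>h. (vcnj h, \<chi> j. cnj (D j h)))) (at w)"
    by (intro has_derivative_Pair has_derivative_vec_lambda bounded_linear_imp_has_derivative[OF bounded_linear_vcnj]
        bounded_linear.has_derivative[OF bounded_linear_cnj] D(1))
  from bounded_linear.has_derivative[OF bounded_linear_cnj has_derivative_compose[OF this E(1)]]
  have "((\<lambda>w. cnj (F (vcnj w, \<chi> j. cnj (q j w)))) has_derivative (\<lambda>h. cnj (E (vcnj h, \<chi> j. cnj (D j h))))) (at w)" .
  moreover have "cnj (E (vcnj (c *s h), \<chi> j. cnj (D j (c *s h)))) = c * cnj (E (vcnj h, \<chi> j. cnj (D j h)))" for c h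
  proof -
    have "(vcnj (c *s h), \<chi> j. cnj (D j (c *s h))) = pscale (cnj c) (vcnj h, \<chi> j. cnj (D j h))"
      by (simp add: pscale_def vcnj_cmult D(2) vec_eq_iff)
    then show ?thesis by (simp add: E(2))
  qed
  ultimately show "\<exists>D. ((\<lambda>w. cnj (F (vcnj w, \<chi> j. cnj (q j w)))) has_derivative D) (at w) \<and> (\<forall>c v. D (c *s v) = c * D v)"
    by blast
qed

lemma hol_fun_onD:
  assumes "hol_fun_on V a" "(z, l) \<in> V" "in_chart i l"
  shows "\<exists>N F. open N \<and> (z, theta i l) \<in> N \<and> hol_wrt pscale F N \<and>
    (\<forall>z' l'. (z', l') \<in> V \<longrightarrow> in_chart i l' \<longrightarrow> (z', theta i l') \<in> N \<longrightarrow> a (z', l') = F (z', theta i l'))"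
proof -
  have "\<exists>N F. open N \<and> (z, theta i l) \<in> N \<and> hol_wrt pscale F N \<and>
    (\<forall>(z', l')\<in>V. in_chart i l' \<and> (z', theta i l') \<in> N \<longrightarrow> a (z', l') = F (z', theta i l'))"
    using bspec[OF assms(1)[unfolded hol_fun_on_def] assms(2)] assms(3) by simp
  then show ?thesis by (elim exE conjE) (rule exI, rule exI, fast)
qed

text \<open>On a ball \<open>W\<close> off the zero set the frames are \<open>K(\<cdot>, w) / cnj (g i w)\<close>, so the isometry of the
  bundles reads \<open>K(w, w) = \<bar>c w\<bar>\<^sup>2 K'(w, w)\<close> with \<open>c\<close> antiholomorphic. Polarization separates the
  two variables.\<close>

lemma module_equivalent_if_bundle_equivalent:
  fixes g :: "'t::finite \<Rightarrow> complex^'m::finite \<Rightarrow> complex"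
  assumes \<Omega>: "open \<Omega>" "connected \<Omega>" and ne: "\<Delta> \<noteq> {}"
    and D: "decomposed_module \<Omega> \<Delta> M K g Kd" and D': "decomposed_module \<Omega> \<Delta> M' K' g Kd'"
    and equiv: "bundle_equivalent (kernel_bundle M \<Delta> g Kd) (kernel_bundle M' \<Delta> g Kd')"
  shows "module_equivalent M M'"
proof -
  interpret A: decomposed_module \<Omega> \<Delta> M K g Kd by fact
  interpret B: decomposed_module \<Omega> \<Delta> M' K' g Kd' by fact
  let ?L = "kernel_bundle M \<Delta> g Kd" and ?L' = "kernel_bundle M' \<Delta> g Kd'"
  obtain w1 i where w1: "w1 \<in> \<Delta>" "g i w1 \<noteq> 0"
    using A.exists_nonzero_generator[OF \<Omega> ne] by blast
  define x where "x = (\<lambda>w. conj_point w (\<chi> j. g j w))"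
  define V where "V = frame_dom ?L i \<inter> frame_dom ?L' i"
  have xV: "x w \<in> V" if w: "w \<in> \<Delta>" "g i w \<noteq> 0" for w
  proof -
    have "(\<chi> j. g j w) \<noteq> 0" using w(2) by (auto simp: vec_eq_iff)
    then have "x w \<in> monoidal_transform_conj \<Delta> g"
      unfolding x_def monoidal_transform_conj_iff using w(1) by (auto intro!: exI[of _ w] exI[of _ "\<chi> j. g j w"])
    with w(2) show ?thesis by (simp add: V_def kernel_bundle_def x_def)
  qed
  obtain \<Phi> where \<Phi>: "\<And>y v v'. y \<in> base ?L \<Longrightarrow> v \<in> fibre ?L y \<Longrightarrow> v' \<in> fibre ?L y \<Longrightarrow>
        metric ?L' y (\<Phi> y v) (\<Phi> y v') = metric ?L y v v'"
    and frames: "\<And>i j. \<exists>a. hol_fun_on (frame_dom ?L i \<inter> frame_dom ?L' j) a \<and>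
      (\<forall>y\<in>frame_dom ?L i \<inter> frame_dom ?L' j. \<Phi> y (frame ?L i y) = cscale (a y) (frame ?L' j y))"
    using equiv unfolding bundle_equivalent_def by blast
  obtain a where a: "hol_fun_on V a" "\<And>y. y \<in> V \<Longrightarrow> \<Phi> y (frame ?L i y) = cscale (a y) (frame ?L' i y)"
    using frames[of i i] unfolding V_def by blast
  \<comment> \<open>Off the zero set \<open>w\<close> is itself a coordinate on the monoidal transform, and \<open>G\<close> expresses
    the affine coordinates by it.\<close>
  define q where "q = (\<lambda>j w. g j w / g i w)"
  define G where "G = (\<lambda>w. (vcnj w, (\<chi> j. cnj (q j w)) :: complex^'t))"
  have theta_x: "theta i (snd (x w)) = (\<chi> j. cnj (q j w))" if "g i w \<noteq> 0" for w
    using that by (simp add: vec_eq_iff x_def conj_point_def theta_proj q_def)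
  have "in_chart i (snd (x w1))" using w1(2) by (simp add: x_def)
  moreover have "x w1 = (vcnj w1, snd (x w1))" by (simp add: x_def conj_point_def)
  ultimately have "\<exists>N F. open N \<and> G w1 \<in> N \<and> hol_wrt pscale F N \<and>
      (\<forall>z l. (z, l) \<in> V \<longrightarrow> in_chart i l \<longrightarrow> (z, theta i l) \<in> N \<longrightarrow> a (z, l) = F (z, theta i l))"
    using hol_fun_onD[OF a(1), of "vcnj w1" "snd (x w1)" i] xV[OF w1]
    unfolding G_def theta_x[OF w1(2), symmetric] by metis
  then obtain N F where N: "open N" "G w1 \<in> N" and F: "hol_wrt pscale F N"
    and aF: "\<And>z l. (z, l) \<in> V \<Longrightarrow> in_chart i l \<Longrightarrow> (z, theta i l) \<in> N \<Longrightarrow> a (z, l) = F (z, theta i l)"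
    by blast
  define \<Delta>i where "\<Delta>i = {w \<in> \<Delta>. g i w \<noteq> 0}"
  have cont_g: "continuous_on \<Delta>i (g j)" for j
    using hol_wrt_imp_continuous_on[OF A.hol_g] by (rule continuous_on_subset) (auto simp: \<Delta>i_def)
  have open_\<Delta>i: "open \<Delta>i"
  proof -
    have "open (\<Delta> \<inter> g i -` (- {0}))"
      by (intro continuous_open_preimage hol_wrt_imp_continuous_on[OF A.hol_g] A.open_\<Delta>) auto
    then show ?thesis by (simp add: \<Delta>i_def vimage_def Int_def)
  qed
  have q_hol: "hol_on (q j) \<Delta>i" for j
    unfolding q_def using A.hol_g by (intro hol_wrt_divide) (auto simp: \<Delta>i_def hol_wrt_def)
  have "continuous_on \<Delta>i G"
    unfolding G_def
    by (intro continuous_intros hol_wrt_imp_continuous_on[OF q_hol]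
        bounded_linear.continuous_on[OF bounded_linear_vcnj])
  then have "open (\<Delta>i \<inter> G -` N)" by (intro continuous_open_preimage open_\<Delta>i N)
  moreover have "w1 \<in> \<Delta>i \<inter> G -` N" using w1 N by (simp add: \<Delta>i_def)
  ultimately obtain r where r: "r > 0" "ball w1 r \<subseteq> \<Delta>i \<inter> G -` N"
    using open_contains_ball by blast
  define W where "W = ball w1 r"
  have W: "open W" "convex W" "W \<noteq> {}" "W \<subseteq> \<Delta>" "W \<subseteq> \<Delta>i"
    using r by (auto simp: W_def \<Delta>i_def)
  have Wg: "w \<in> \<Delta>" "g i w \<noteq> 0" "G w \<in> N" if "w \<in> W" for w using that r by (auto simp: W_def \<Delta>i_def)
  define c where "c = (\<lambda>w. a (x w))"
  have c_eq: "c w = F (G w)" if "w \<in> W" for w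
  proof -
    have "x w = (vcnj w, snd (x w))" by (simp add: x_def conj_point_def)
    moreover have "in_chart i (snd (x w))" using Wg[OF that] by (simp add: x_def)
    ultimately show ?thesis
      using aF[of "vcnj w" "snd (x w)"] xV[OF Wg(1,2)[OF that]] Wg(3)[OF that] theta_x[OF Wg(2)[OF that]]
      by (simp add: c_def G_def)
  qed
  have hol_cF: "hol_on (\<lambda>w. cnj (F (G w))) W"
    unfolding G_def
  proof (rule hol_on_conj_chart_compose[OF F])
    show "hol_on (q j) W" for j using q_hol W(5) by (rule hol_wrt_subset)
    show "(vcnj w, \<chi> j. cnj (q j w)) \<in> N" if "w \<in> W" for w using Wg(3)[OF that] by (simp add: G_def)
  qed
  have diag: "K w w = cnj (c w) * c w * K' w w" and c_nz: "c w \<noteq> 0" if w: "w \<in> W" for w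
  proof -
    have w\<Omega>: "w \<in> \<Omega>" using Wg(1)[OF w] A.\<Delta>_sub by blast
    have u: "(\<chi> j. g j w) \<noteq> 0" "(\<chi> j. g j w) $ i \<noteq> 0" using Wg(2)[OF w] by (auto simp: vec_eq_iff)
    have fr: "frame ?L i (x w) = cscale (inverse (cnj (g i w))) (\<lambda>z. K z w)"
      "frame ?L' i (x w) = cscale (inverse (cnj (g i w))) (\<lambda>z. K' z w)"
      using sect_proj[OF u(2)] A.kernel_eq_comb[OF Wg(1)[OF w]] B.kernel_eq_comb[OF Wg(1)[OF w]]
      by (auto simp: kernel_bundle_def x_def)
    have "x w \<in> base ?L" using xV[OF Wg(1,2)[OF w]] by (simp add: V_def kernel_bundle_def)
    moreover have "frame ?L i (x w) \<in> fibre ?L (x w)"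
      unfolding fr(1) unfolding x_def fibre_kernel_bundle[OF u(1)] A.kernel_eq_comb[OF Wg(1)[OF w]] by blast
    ultimately have "ip M' (\<Phi> (x w) (frame ?L i (x w))) (\<Phi> (x w) (frame ?L i (x w)))
        = ip M (frame ?L i (x w)) (frame ?L i (x w))"
      using \<Phi>[of "x w" "frame ?L i (x w)" "frame ?L i (x w)"] by (simp add: kernel_bundle_def)
    moreover have "\<Phi> (x w) (frame ?L i (x w)) = cscale (c w) (frame ?L' i (x w))"
      using a(2)[OF xV[OF Wg(1,2)[OF w]]] by (simp add: c_def)
    moreover have KM: "(\<lambda>z. K z w) \<in> carr M" "(\<lambda>z. K' z w) \<in> carr M'"
      using w\<Omega> by (auto intro: reproducing_kernel_carr[OF A.kernel] reproducing_kernel_carr[OF B.kernel])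
    ultimately have "ip M (\<lambda>z. K z w) (\<lambda>z. K z w) = c w * cnj (c w) * ip M' (\<lambda>z. K' z w) (\<lambda>z. K' z w)"
      using Wg(2)[OF w] unfolding fr
      by (simp add: ip_cscale_left ip_cscale_right carr_cscale A.space B.space) (simp add: mult_ac)
    then show diag: "K w w = cnj (c w) * c w * K' w w"
      using KM by (simp add: reproducing_kernel_ip[OF A.kernel w\<Omega>] reproducing_kernel_ip[OF B.kernel w\<Omega>])
    have "K w w \<noteq> 0"
      using ip_self_eq_0_iff[OF A.space KM(1)] A.kernel_nonzero[OF Wg(1,2)[OF w]]
      by (simp add: reproducing_kernel_ip[OF A.kernel w\<Omega> KM(1)])
    with diag show "c w \<noteq> 0" by auto
  qed
  \<comment> \<open>The double conjugation displays \<open>F (G w)\<close> as the conjugate of a holomorphic function.\<close>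
  have "K z w - cnj (F (G z)) * cnj (cnj (F (G w))) * K' z w = 0" if "z \<in> W" "w \<in> W" for z w
  proof (rule polarization[OF W(1,2) _ _ that, where A = "\<lambda>z w. K z w - cnj (F (G z)) * cnj (cnj (F (G w))) * K' z w"])
    fix m e :: "complex^'m"
    let ?T = "{\<tau>. m + \<tau> *s e \<in> W \<and> m + cnj \<tau> *s e \<in> W}"
    have "?T \<subseteq> {\<tau>. m + \<tau> *s e \<in> \<Delta> \<and> m + cnj \<tau> *s e \<in> \<Delta>}" using W(4) by auto
    then have "(\<lambda>\<tau>. K (m + \<tau> *s e) (m + cnj \<tau> *s e)) holomorphic_on ?T"
        "(\<lambda>\<tau>. K' (m + \<tau> *s e) (m + cnj \<tau> *s e)) holomorphic_on ?T"
      by (auto intro: holomorphic_on_subset A.kernel_line_holomorphic B.kernel_line_holomorphic)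
    moreover have "(\<lambda>\<tau>. cnj (F (G (m + \<tau> *s e)))) holomorphic_on ?T"
      by (rule holomorphic_on_subset[OF holomorphic_on_line[OF hol_cF]]) auto
    moreover have "(\<lambda>\<tau>. cnj (cnj (F (G (m + cnj \<tau> *s e))))) holomorphic_on ?T"
      by (rule holomorphic_on_subset[OF holomorphic_on_cnj_line[OF hol_cF]]) auto
    ultimately show "(\<lambda>\<tau>. K (m + \<tau> *s e) (m + cnj \<tau> *s e)
        - cnj (F (G (m + \<tau> *s e))) * cnj (cnj (F (G (m + cnj \<tau> *s e)))) * K' (m + \<tau> *s e) (m + cnj \<tau> *s e)) holomorphic_on ?T"
      by (intro holomorphic_intros)
  next
    fix w assume "w \<in> W"
    then show "K w w - cnj (F (G w)) * cnj (cnj (F (G w))) * K' w w = 0"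
      using diag[of w] c_eq[of w] by simp
  qed
  then have "K z w = cnj (c z) * c w * K' z w" if "z \<in> W" "w \<in> W" for z w
    using that c_eq by simp
  moreover have "W \<subseteq> \<Omega>" using W(4) A.\<Delta>_sub by blast
  ultimately show ?thesis
    using module_equivalent_if_kernels_rescaled[OF \<Omega> A.module A.kernel B.module B.kernel W(1,3)] c_nz by blast
qed

section \<open>Equivalent modules give equivalent bundles\<close>

lemma ip_eqI:
  assumes M: "hilbert_space M" and f: "f \<in> carr M" and g: "g \<in> carr M"
    and eq: "\<And>h. h \<in> carr M \<Longrightarrow> ip M h f = ip M h g"
  shows "f = g"
proof -
  have "ip M (f - g) (f - g) = 0"
    using eq[OF carr_diff[OF M f g]] f g by (simp add: ip_diff_right M carr_diff)
  then show ?thesis using ip_self_eq_0_iff[OF M carr_diff[OF M f g]] by simp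
qed

locale module_isometry =
  fixes \<Omega> :: "(complex^'m::finite) set" and M M' :: "'m hilb"
    and U :: "(complex^'m \<Rightarrow> complex) \<Rightarrow> (complex^'m \<Rightarrow> complex)"
  assumes module: "hilbert_module \<Omega> M" and module': "hilbert_module \<Omega> M'"
    and bij: "bij_betw U (carr M) (carr M')"
    and U_add: "\<And>f g. f \<in> carr M \<Longrightarrow> g \<in> carr M \<Longrightarrow> U (f + g) = U f + U g"
    and U_cscale: "\<And>c f. f \<in> carr M \<Longrightarrow> U (cscale c f) = cscale c (U f)"
    and U_ip: "\<And>f g. f \<in> carr M \<Longrightarrow> g \<in> carr M \<Longrightarrow> ip M' (U f) (U g) = ip M f g"
    and U_pmult: "\<And>p f. f \<in> carr M \<Longrightarrow> U (pmult p f) = pmult p (U f)"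
begin

lemma space: "hilbert_space M" and space': "hilbert_space M'"
  using module module' by (auto dest: hilbert_module_space)

lemma U_carr: "f \<in> carr M \<Longrightarrow> U f \<in> carr M'"
  using bij by (auto simp: bij_betw_def)

lemma U_surj: "f' \<in> carr M' \<Longrightarrow> \<exists>f\<in>carr M. f' = U f"
  using bij by (auto simp: bij_betw_def)

lemma U_nonzero: "f \<in> carr M \<Longrightarrow> f \<noteq> 0 \<Longrightarrow> U f \<noteq> 0"
  using U_ip[of f f] ip_self_eq_0_iff[OF space, of f] ip_self_eq_0_iff[OF space' U_carr, of f] by simp

lemma U_diff: "f \<in> carr M \<Longrightarrow> g \<in> carr M \<Longrightarrow> U (f - g) = U f - U g"
  using U_add[of f "cscale (-1) g"] U_cscale[of g "-1"]
  unfolding diff_eq_add_cscale by (simp add: carr_cscale space del: cfun.scale_minus_left)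

lemma U_hconv:
  assumes "hconv M X f F"
  shows "hconv M' (\<lambda>x. U (X x)) (U f) F"
proof -
  have f: "f \<in> carr M" and ev: "\<forall>\<^sub>F x in F. X x \<in> carr M" and lim: "((\<lambda>x. hnorm M (X x - f)) \<longlongrightarrow> 0) F"
    using assms by (auto simp: hconv_def)
  have "\<forall>\<^sub>F x in F. hnorm M (X x - f) = hnorm M' (U (X x) - U f)"
    using ev
  proof eventually_elim
    case (elim x)
    then show ?case
      using f U_ip[of "X x - f" "X x - f"] by (simp add: hnorm_def U_diff carr_diff space)
  qed
  from tendsto_cong[THEN iffD1, OF this lim] show ?thesis
    using f ev by (auto simp: hconv_def U_carr elim: eventually_mono)
qed

text \<open>For polynomials \<open>p\<close> and \<open>q\<close> of the ideal, \<open>p * U q = U (p * q) = q * U p\<close>, and the polynomials \<open>q\<close>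
  are dense. So \<open>U\<close> is multiplication by \<open>U p / p\<close> wherever \<open>p\<close> is not zero.\<close>

lemma U_polynomial_exchange:
  assumes K: "reproducing_kernel \<Omega> M K" and K': "reproducing_kernel \<Omega> M' K'" and w: "w \<in> \<Omega>"
    and I: "completion_of \<Omega> I M" and p: "p \<in> I" and f: "f \<in> carr M"
  shows "peval p w * U f w = f w * U (restr_poly \<Omega> p) w"
proof -
  have rI: "restr_poly \<Omega> q \<in> carr M" if "q \<in> I" for q
    using I that by (simp add: completion_of_def)
  have poly: "peval p w * U (restr_poly \<Omega> q) w = restr_poly \<Omega> q w * U (restr_poly \<Omega> p) w" if q: "q \<in> I" for q
  proof -
    have "pmult p (restr_poly \<Omega> q) = pmult q (restr_poly \<Omega> p)"
      by (auto simp: pmult_def restr_poly_def)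
    then have "pmult p (U (restr_poly \<Omega> q)) = pmult q (U (restr_poly \<Omega> p))"
      using U_pmult[OF rI[OF q], of p] U_pmult[OF rI[OF p], of q] by simp
    from fun_cong[OF this, of w] w show ?thesis by (simp add: pmult_def restr_poly_def)
  qed
  have "\<forall>n. \<exists>q\<in>I. hnorm M (f - restr_poly \<Omega> q) < 1 / Suc n"
    using I f by (simp add: completion_of_def)
  then obtain q where q: "\<And>n. q n \<in> I" "\<And>n. hnorm M (f - restr_poly \<Omega> (q n)) < 1 / Suc n"
    by metis
  have "(\<lambda>n. hnorm M (restr_poly \<Omega> (q n) - f)) \<longlonglongrightarrow> 0"
  proof (rule Lim_null_comparison[OF _ LIMSEQ_Suc[OF lim_1_over_n]])
    have "norm (hnorm M (restr_poly \<Omega> (q n) - f)) \<le> 1 / real (Suc n)" for n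
      using q(2)[of n] hnorm_minus_commute[OF space f rI[OF q(1)]]
        hnorm_nonneg[OF space carr_diff[OF space rI[OF q(1)] f]] by (simp add: less_imp_le)
    then show "\<forall>\<^sub>F n in sequentially. norm (hnorm M (restr_poly \<Omega> (q n) - f)) \<le> 1 / real (Suc n)"
      by simp
  qed
  then have conv: "hconv M (\<lambda>n. restr_poly \<Omega> (q n)) f sequentially"
    using f rI[OF q(1)] by (simp add: hconv_def)
  have "(\<lambda>n. peval p w * U (restr_poly \<Omega> (q n)) w) \<longlonglongrightarrow> peval p w * U f w"
    by (intro tendsto_intros hconv_imp_pointwise[OF space' K' U_hconv[OF conv] w])
  moreover have "(\<lambda>n. peval p w * U (restr_poly \<Omega> (q n)) w) \<longlonglongrightarrow> f w * U (restr_poly \<Omega> p) w"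
    unfolding poly[OF q(1)] by (intro tendsto_intros hconv_imp_pointwise[OF space K conv w])
  ultimately show ?thesis by (rule LIMSEQ_unique)
qed

text \<open>If all polynomials of the ideal vanish at \<open>w\<close>, then the kernel function at \<open>w\<close> is orthogonal to
  a dense subspace.\<close>

lemma exists_polynomial_nonzero_at:
  assumes K: "reproducing_kernel \<Omega> M K" and w: "w \<in> \<Omega>"
    and I: "completion_of \<Omega> I M" and K_nz: "(\<lambda>z. K z w) \<noteq> 0"
  shows "\<exists>p\<in>I. peval p w \<noteq> 0"
proof (rule ccontr)
  assume none: "\<not> ?thesis"
  let ?k = "\<lambda>z. K z w"
  have k: "?k \<in> carr M" by (rule reproducing_kernel_carr[OF K w])
  have k_pos: "hnorm M ?k > 0"
    using hnorm_nonneg[OF space k] hnorm_eq_0_iff[OF space k] K_nz by simp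
  then obtain p where p: "p \<in> I" "hnorm M (?k - restr_poly \<Omega> p) < hnorm M ?k"
    using I k unfolding completion_of_def by blast
  have pM: "restr_poly \<Omega> p \<in> carr M" using I p(1) by (simp add: completion_of_def)
  have "ip M (restr_poly \<Omega> p) ?k = 0"
    unfolding reproducing_kernel_ip[OF K w pM] using none p(1) w by (simp add: restr_poly_def)
  then have "ip M (?k - restr_poly \<Omega> p) ?k = of_real ((hnorm M ?k)\<^sup>2)"
    using k pM by (simp add: ip_diff_left space ip_self)
  then have "cmod (ip M (?k - restr_poly \<Omega> p) ?k) = (hnorm M ?k)\<^sup>2"
    by (simp add: norm_power)
  then have "(hnorm M ?k)\<^sup>2 \<le> hnorm M (?k - restr_poly \<Omega> p) * hnorm M ?k"
    using cauchy_schwarz[OF space carr_diff[OF space k pM] k] by simp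
  then show False using k_pos p(2) by (simp add: power2_eq_square)
qed

text \<open>As \<open>U\<close> acts on values at \<open>w\<close> as multiplication by a scalar, its adjoint maps the kernel function
  at \<open>w\<close> to a multiple of the kernel function at \<open>w\<close>.\<close>

lemma U_kernel:
  assumes K: "reproducing_kernel \<Omega> M K" and K': "reproducing_kernel \<Omega> M' K'" and w: "w \<in> \<Omega>"
    and I: "completion_of \<Omega> I M" and nz: "(\<lambda>z. K z w) \<noteq> 0" "(\<lambda>z. K' z w) \<noteq> 0"
  shows "\<exists>c. U (\<lambda>z. K z w) = cscale c (\<lambda>z. K' z w)"
proof -
  obtain p where p: "p \<in> I" "peval p w \<noteq> 0"
    using exists_polynomial_nonzero_at[OF K w I nz(1)] by blast
  define \<psi> where "\<psi> = U (restr_poly \<Omega> p) w / peval p w"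
  have \<psi>: "U f w = \<psi> * f w" if "f \<in> carr M" for f
    using U_polynomial_exchange[OF K K' w I p(1) that] p(2) by (simp add: \<psi>_def field_simps)
  let ?k = "\<lambda>z. K z w" and ?k' = "\<lambda>z. K' z w"
  have k: "?k \<in> carr M" by (rule reproducing_kernel_carr[OF K w])
  have k': "?k' \<in> carr M'" by (rule reproducing_kernel_carr[OF K' w])
  have "?k' = cscale (cnj \<psi>) (U ?k)"
  proof (rule ip_eqI[OF space' k' carr_cscale[OF space' U_carr[OF k]]])
    fix h assume "h \<in> carr M'"
    then obtain f where f: "f \<in> carr M" "h = U f" using U_surj by blast
    then show "ip M' h ?k' = ip M' h (cscale (cnj \<psi>) (U ?k))"
      using \<psi>[OF f(1)] by (simp add: reproducing_kernel_ip[OF K' w U_carr] ip_cscale_right space' U_carr k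
          U_ip reproducing_kernel_ip[OF K w])
  qed
  moreover from this have "\<psi> \<noteq> 0" using nz(2) by auto
  ultimately have "U ?k = cscale (inverse (cnj \<psi>)) ?k'"
    by (simp add: cfun.scale_scale)
  then show ?thesis by blast
qed

end

text \<open>An isometry of the Hilbert spaces that maps fibres into fibres is automatically holomorphic:
  its coefficient with respect to the frames is a quotient of inner products of antiholomorphic
  vectors with a fixed vector. In particular nothing has to be extended across the exceptional set.\<close>

lemma bundle_equivalent_if_fibrewise:
  fixes g :: "'t::finite \<Rightarrow> complex^'m::finite \<Rightarrow> complex"
  assumes D: "decomposed_module \<Omega> \<Delta> M K g Kd" and D': "decomposed_module \<Omega> \<Delta> M' K' g Kd'"
    and U: "module_isometry \<Omega> M M' U"
    and lines: "\<And>w u. w \<in> \<Delta> \<Longrightarrow> u \<noteq> 0 \<Longrightarrow> (\<And>i j. u $ i * g j w = u $ j * g i w) \<Longrightarrow>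
      \<exists>c. U (kernel_comb Kd w u) = cscale c (kernel_comb Kd' w u)"
  shows "bundle_equivalent (kernel_bundle M \<Delta> g Kd) (kernel_bundle M' \<Delta> g Kd')"
proof -
  interpret A: decomposed_module \<Omega> \<Delta> M K g Kd by fact
  interpret B: decomposed_module \<Omega> \<Delta> M' K' g Kd' by fact
  interpret U: module_isometry \<Omega> M M' U by fact
  let ?L = "kernel_bundle M \<Delta> g Kd" and ?L' = "kernel_bundle M' \<Delta> g Kd'"
  have fibrewise: "bij_betw U (fibre ?L x) (fibre ?L' x) \<and> fibre ?L x \<subseteq> carr M" if x: "x \<in> base ?L" for x
  proof -
    obtain w u where wu: "x = conj_point w u" "w \<in> \<Delta>" "u \<noteq> 0" "\<And>i j. u $ i * g j w = u $ j * g i w"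
      using x by (auto simp: kernel_bundle_def monoidal_transform_conj_iff)
    obtain c where c: "U (kernel_comb Kd w u) = cscale c (kernel_comb Kd' w u)"
      using lines[OF wu(2-4)] by blast
    have SM: "kernel_comb Kd w u \<in> carr M" by (rule A.comb_carr[OF wu(2)])
    have "U (kernel_comb Kd w u) \<noteq> 0"
      by (rule U.U_nonzero[OF SM A.comb_nonzero[OF wu(2,3)]])
    then have "c \<noteq> 0" using c by auto
    have Uc: "U (cscale b (kernel_comb Kd w u)) = cscale (b * c) (kernel_comb Kd' w u)" for b
      by (simp add: U.U_cscale[OF SM] c cfun.scale_scale)
    have "U ` fibre ?L x = fibre ?L' x"
    proof
      show "U ` fibre ?L x \<subseteq> fibre ?L' x"
        by (auto simp: wu(1) fibre_kernel_bundle[OF wu(3)] Uc)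
      show "fibre ?L' x \<subseteq> U ` fibre ?L x"
      proof
        fix v assume "v \<in> fibre ?L' x"
        then obtain b where "v = cscale b (kernel_comb Kd' w u)"
          by (auto simp: wu(1) fibre_kernel_bundle[OF wu(3)])
        then have "v = U (cscale (b / c) (kernel_comb Kd w u))" using \<open>c \<noteq> 0\<close> by (simp add: Uc)
        then show "v \<in> U ` fibre ?L x" by (auto simp: wu(1) fibre_kernel_bundle[OF wu(3)])
      qed
    qed
    moreover have sub: "fibre ?L x \<subseteq> carr M"
      using SM by (auto simp: wu(1) fibre_kernel_bundle[OF wu(3)] intro: carr_cscale A.space)
    moreover have "inj_on U (fibre ?L x)"
      using U.bij sub by (auto simp: bij_betw_def intro: inj_on_subset)
    ultimately show ?thesis by (simp add: bij_betw_def)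
  qed
  have holomorphic: "\<exists>a. hol_fun_on (frame_dom ?L i \<inter> frame_dom ?L' j) a \<and>
      (\<forall>x\<in>frame_dom ?L i \<inter> frame_dom ?L' j. U (frame ?L i x) = cscale (a x) (frame ?L' j x))" for i j
  proof -
    let ?V = "frame_dom ?L i \<inter> frame_dom ?L' j"
    have V: "\<exists>w u. x = conj_point w u \<and> w \<in> \<Delta> \<and> u $ i \<noteq> 0 \<and> u $ j \<noteq> 0 \<and> (\<forall>k l. u $ k * g l w = u $ l * g k w)"
      if "x \<in> ?V" for x
    proof -
      have "x \<in> monoidal_transform_conj \<Delta> g" "in_chart i (snd x)" "in_chart j (snd x)"
        using that by (simp_all add: kernel_bundle_def)
      moreover from this obtain w u where "x = conj_point w u" "w \<in> \<Delta>" "\<forall>k l. u $ k * g l w = u $ l * g k w"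
        unfolding monoidal_transform_conj_iff by blast
      ultimately show ?thesis by (intro exI[of _ w] exI[of _ u]) simp
    qed
    have frames: "frame ?L i (conj_point w u) = cscale (inverse (cnj (u $ i))) (kernel_comb Kd w u)"
      "frame ?L' j (conj_point w u) = cscale (inverse (cnj (u $ j))) (kernel_comb Kd' w u)"
      if "u $ i \<noteq> 0" "u $ j \<noteq> 0" for w u
      using that by (simp_all add: kernel_bundle_def sect_proj)
    have "\<exists>a. U (frame ?L i x) = cscale a (frame ?L' j x)" if x: "x \<in> ?V" for x
    proof -
      obtain w u where wu: "x = conj_point w u" "w \<in> \<Delta>" "u $ i \<noteq> 0" "u $ j \<noteq> 0"
          "\<And>k l. u $ k * g l w = u $ l * g k w"
        using V[OF x] by blast
      then have "u \<noteq> 0" by auto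
      then obtain c where "U (kernel_comb Kd w u) = cscale c (kernel_comb Kd' w u)"
        using lines wu by blast
      then have "U (frame ?L i x) = cscale (inverse (cnj (u $ i)) * c * cnj (u $ j)) (frame ?L' j x)"
        using wu by (simp add: frames U.U_cscale A.comb_carr cfun.scale_scale)
      then show ?thesis by blast
    qed
    then obtain a where a: "\<And>x. x \<in> ?V \<Longrightarrow> U (frame ?L i x) = cscale (a x) (frame ?L' j x)" by metis
    have "hol_fun_on ?V a"
      unfolding hol_fun_on_def
    proof (intro ballI, clarify)
      fix z0 l0 k assume x0: "(z0, l0) \<in> frame_dom ?L i" "(z0, l0) \<in> frame_dom ?L' j" and k0: "in_chart k l0"
      obtain w0 u0 where wu0: "(z0, l0) = conj_point w0 u0" "w0 \<in> \<Delta>" "u0 $ i \<noteq> 0" "u0 $ j \<noteq> 0"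
        using V[of "(z0, l0)"] x0 by blast
      \<comment> \<open>Pairing with the target frame at the given point turns the coefficient into a quotient of
        two functions, \<open>Num\<close> and \<open>Den\<close>, that are defined for all values of the coordinates
        \<open>(z, \<theta>)\<close>, on the monoidal transform or not; \<open>Den\<close> is not zero at the given point.\<close>
      define e where "e = kernel_comb Kd' w0 u0"
      have eM: "e \<in> carr M'" unfolding e_def by (rule B.comb_carr[OF wu0(2)])
      obtain e0 where e0: "e0 \<in> carr M" "e = U e0" using U.U_surj[OF eM] by blast
      define Num where "Num = (\<lambda>x::(complex^'m) \<times> (complex^'t). \<Sum>n\<in>UNIV. (snd x $ n / snd x $ i) * ip M (Kd n (vcnj (fst x))) e0)"
      define Den where "Den = (\<lambda>x::(complex^'m) \<times> (complex^'t). \<Sum>n\<in>UNIV. (snd x $ n / snd x $ j) * ip M' (Kd' n (vcnj (fst x))) e)"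
      define N0 where "N0 = {x :: (complex^'m) \<times> (complex^'t). vcnj (fst x) \<in> \<Delta> \<and> snd x $ i \<noteq> 0 \<and> snd x $ j \<noteq> 0}"
      define N where "N = N0 \<inter> Den -` (- {0})"
      have coord: "hol_wrt pscale (\<lambda>x. snd x $ n) N0" for n
        unfolding hol_wrt_def
        by (intro ballI exI[of _ "\<lambda>h. snd h $ n"])
           (auto simp: pscale_def intro!: bounded_linear_imp_has_derivative bounded_linear_compose[OF bounded_linear_vec_nth bounded_linear_snd])
      have pull: "hol_wrt pscale (\<lambda>x. h (fst x)) N0" if h: "hol_on h {z. vcnj z \<in> \<Delta>}" for h
        unfolding hol_wrt_def
      proof
        fix x assume "x \<in> N0"
        then obtain D where D: "(h has_derivative D) (at (fst x))" "\<And>c v. D (c *s v) = c * D v"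
          using h unfolding hol_wrt_def N0_def by blast
        from has_derivative_compose[OF bounded_linear_imp_has_derivative[OF bounded_linear_fst] D(1)]
        show "\<exists>D. ((\<lambda>x. h (fst x)) has_derivative D) (at x) \<and> (\<forall>c v. D (pscale c v) = c * D v)"
          by (intro exI[of _ "\<lambda>v. D (fst v)"]) (auto simp: pscale_def D(2))
      qed
      have hol: "hol_wrt pscale Num N0" "hol_wrt pscale Den N0"
        unfolding Num_def Den_def
        by (intro hol_wrt_sum hol_wrt_mult hol_wrt_divide coord pull
            ip_antihol_hol_on[OF A.space A.antihol A.open_\<Delta> e0(1)] ip_antihol_hol_on[OF B.space B.antihol A.open_\<Delta> eM];
            simp add: N0_def)+
      have "open N0"
      proof -
        have "open ((\<lambda>x::(complex^'m) \<times> (complex^'t). vcnj (fst x)) -` \<Delta>)"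
          by (intro open_vimage A.open_\<Delta> bounded_linear.continuous_on[OF bounded_linear_vcnj] continuous_intros)
        moreover have "open ((\<lambda>x::(complex^'m) \<times> (complex^'t). snd x $ n) -` (- {0}))" for n
          by (intro open_vimage continuous_intros)
        moreover have "N0 = (\<lambda>x. vcnj (fst x)) -` \<Delta> \<inter> (\<lambda>x. snd x $ i) -` (- {0}) \<inter> (\<lambda>x. snd x $ j) -` (- {0})"
          by (auto simp: N0_def)
        ultimately show ?thesis by auto
      qed
      then have "open N"
        unfolding N_def by (intro continuous_open_preimage hol_wrt_imp_continuous_on[OF hol(2)]) auto
      have chart_values: "Num (z, theta k l) = ip M' (U (frame ?L i (z, l))) e \<and>
          Den (z, theta k l) = ip M' (frame ?L' j (z, l)) e \<and> (z, theta k l) \<in> N0"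
        if x: "(z, l) \<in> ?V" and k: "in_chart k l" for z l
      proof -
        obtain w u where wu: "(z, l) = conj_point w u" "w \<in> \<Delta>" "u $ i \<noteq> 0" "u $ j \<noteq> 0"
          using V[OF x] by blast
        then have zl: "z = vcnj w" "l = proj (vcnj u)" by (auto simp: conj_point_def)
        then have uk: "u $ k \<noteq> 0" using k by simp
        have th: "theta k l $ n = cnj (u $ n / u $ k)" for n
          using uk by (simp add: zl theta_proj)
        have ratio: "theta k l $ n / theta k l $ m = inverse (cnj (u $ m)) * cnj (u $ n)" if "u $ m \<noteq> 0" for n m
          using uk that by (simp add: th field_simps)
        have "ip M' (U (frame ?L i (z, l))) e = ip M (frame ?L i (z, l)) e0"
          unfolding wu(1) frames[OF wu(3,4)] e0(2)
          by (intro U.U_ip carr_cscale A.space A.comb_carr wu(2) e0(1))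
        also have "\<dots> = (\<Sum>n\<in>UNIV. inverse (cnj (u $ i)) * cnj (u $ n) * ip M (Kd n w) e0)"
          unfolding wu(1) frames[OF wu(3,4)] using wu(2) e0(1)
          by (simp add: kernel_comb_def ip_cscale_left ip_sum_left carr_sum carr_cscale A.space A.Kd_carr sum_distrib_left mult.assoc)
        finally have num: "Num (z, theta k l) = ip M' (U (frame ?L i (z, l))) e"
          by (simp only: Num_def fst_conv snd_conv ratio[OF wu(3)] zl(1) vcnj_vcnj)
        have "ip M' (frame ?L' j (z, l)) e = (\<Sum>n\<in>UNIV. inverse (cnj (u $ j)) * cnj (u $ n) * ip M' (Kd' n w) e)"
          unfolding wu(1) frames[OF wu(3,4)] using wu(2) eM
          by (simp add: kernel_comb_def ip_cscale_left ip_sum_left carr_sum carr_cscale B.space B.Kd_carr sum_distrib_left mult.assoc)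
        then have den: "Den (z, theta k l) = ip M' (frame ?L' j (z, l)) e"
          by (simp only: Den_def fst_conv snd_conv ratio[OF wu(4)] zl(1) vcnj_vcnj)
        have "(z, theta k l) \<in> N0"
          using wu uk by (simp add: N0_def th zl(1))
        with num den show ?thesis by blast
      qed
      have frame_carr: "frame ?L' j x \<in> carr M'" if "x \<in> ?V" for x
        using V[OF that] by (auto simp: frames intro!: carr_cscale B.space B.comb_carr)
      have "Den (z0, theta k l0) \<noteq> 0"
      proof -
        have "Den (z0, theta k l0) = ip M' (frame ?L' j (z0, l0)) e"
          using chart_values[OF _ k0] x0 by blast
        also have "\<dots> = inverse (cnj (u0 $ j)) * ip M' e e"
          unfolding wu0(1) frames[OF wu0(3,4)]
          by (simp add: ip_cscale_left[OF B.space eM eM] e_def[symmetric])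
        finally have "Den (z0, theta k l0) = inverse (cnj (u0 $ j)) * ip M' e e" .
        moreover have "e \<noteq> 0" unfolding e_def using wu0 by (intro B.comb_nonzero) auto
        ultimately show ?thesis using wu0(4) ip_self_eq_0_iff[OF B.space eM] by simp
      qed
      then have "(z0, theta k l0) \<in> N" using chart_values[OF _ k0] x0 by (simp add: N_def)
      moreover have "hol_wrt pscale (\<lambda>x. Num x / Den x) N"
        by (intro hol_wrt_divide hol_wrt_subset[OF hol(1)] hol_wrt_subset[OF hol(2)]) (auto simp: N_def)
      moreover have "a (z, l) = Num (z, theta k l) / Den (z, theta k l)"
        if x: "(z, l) \<in> ?V" and k: "in_chart k l" and N: "(z, theta k l) \<in> N" for z l
      proof -
        have "Num (z, theta k l) = a (z, l) * Den (z, theta k l)"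
          using chart_values[OF x k] a[OF x] by (simp add: ip_cscale_left[OF B.space frame_carr[OF x] eM])
        moreover have "Den (z, theta k l) \<noteq> 0" using N by (simp add: N_def)
        ultimately show ?thesis by simp
      qed
      ultimately show "\<exists>N F. open N \<and> (z0, theta k l0) \<in> N \<and> hol_wrt pscale F N \<and>
          (\<forall>(z', l')\<in>?V. in_chart k l' \<and> (z', theta k l') \<in> N \<longrightarrow> a (z', l') = F (z', theta k l'))"
        using \<open>open N\<close> by (intro exI[of _ N] exI[of _ "\<lambda>x. Num x / Den x"]) blast
    qed
    with a show ?thesis by blast
  qed
  have "base ?L = base ?L'" by (simp add: kernel_bundle_def)
  moreover have "\<forall>x\<in>base ?L. bij_betw U (fibre ?L x) (fibre ?L' x) \<and>
      (\<forall>v\<in>fibre ?L x. \<forall>v'\<in>fibre ?L x. U (v + v') = U v + U v') \<and>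
      (\<forall>c. \<forall>v\<in>fibre ?L x. U (cscale c v) = cscale c (U v)) \<and>
      (\<forall>v\<in>fibre ?L x. \<forall>v'\<in>fibre ?L x. metric ?L' x (U v) (U v') = metric ?L x v v')"
  proof
    fix x assume "x \<in> base ?L"
    note fw = fibrewise[OF this]
    have "metric ?L' x = ip M'" "metric ?L x = ip M" by (simp_all add: kernel_bundle_def)
    with fw show "bij_betw U (fibre ?L x) (fibre ?L' x) \<and>
      (\<forall>v\<in>fibre ?L x. \<forall>v'\<in>fibre ?L x. U (v + v') = U v + U v') \<and>
      (\<forall>c. \<forall>v\<in>fibre ?L x. U (cscale c v) = cscale c (U v)) \<and>
      (\<forall>v\<in>fibre ?L x. \<forall>v'\<in>fibre ?L x. metric ?L' x (U v) (U v') = metric ?L x v v')"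
      using U.U_add U.U_cscale U.U_ip by (simp add: subset_iff)
  qed
  ultimately show ?thesis
    unfolding bundle_equivalent_def using holomorphic by (intro conjI exI[of _ "\<lambda>_. U"]) auto
qed

text \<open>Off the zero set the fibres are spanned by kernel functions, which \<open>U\<close> maps to multiples of
  kernel functions. A point \<open>(p, \<pi>(u))\<close> of the exceptional set is a limit of points of the monoidal
  transform off the zero set, even with fixed second coordinate, so the fibre over it is mapped to
  the corresponding fibre by continuity.\<close>

lemma bundle_equivalent_if_module_equivalent:
  fixes g :: "'t::finite \<Rightarrow> complex^'m::finite \<Rightarrow> complex"
  assumes D: "decomposed_module \<Omega> \<Delta> M K g Kd" and D': "decomposed_module \<Omega> \<Delta> M' K' g Kd'"
    and I: "completion_of \<Omega> I M"
    and Z: "singularity_free_codim {w \<in> \<Delta>. \<forall>j. g j w = 0} CARD('t)"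
    and equiv: "module_equivalent M M'"
  shows "bundle_equivalent (kernel_bundle M \<Delta> g Kd) (kernel_bundle M' \<Delta> g Kd')"
proof -
  interpret A: decomposed_module \<Omega> \<Delta> M K g Kd by fact
  interpret B: decomposed_module \<Omega> \<Delta> M' K' g Kd' by fact
  obtain U where "module_isometry \<Omega> M M' U"
    using equiv A.module B.module unfolding module_equivalent_def module_isometry_def by blast
  then interpret U: module_isometry \<Omega> M M' U .
  have off_Z: "\<exists>c. U (kernel_comb Kd w u) = cscale c (kernel_comb Kd' w u)"
    if w: "w \<in> \<Delta>" and \<mu>: "\<mu> \<noteq> 0" "\<And>j. g j w = \<mu> * u $ j" and u: "u \<noteq> 0" for w \<mu> u
  proof -
    have g_u: "(\<chi> j. g j w) = \<mu> *s u" by (simp add: vec_eq_iff \<mu>(2))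
    obtain i where "u $ i \<noteq> 0" using exists_chart[OF u] by blast
    then have "g i w \<noteq> 0" using \<mu> by simp
    then obtain c where "U (\<lambda>z. K z w) = cscale c (\<lambda>z. K' z w)"
      using U.U_kernel[OF A.kernel B.kernel _ I A.kernel_nonzero[OF w] B.kernel_nonzero[OF w]] w A.\<Delta>_sub by blast
    then have "cscale (cnj \<mu>) (U (kernel_comb Kd w u)) = cscale (c * cnj \<mu>) (kernel_comb Kd' w u)"
      unfolding A.kernel_eq_comb[OF w] B.kernel_eq_comb[OF w] g_u kernel_comb_cmult
      by (simp add: U.U_cscale A.comb_carr w)
    then have "cscale (inverse (cnj \<mu>)) (cscale (cnj \<mu>) (U (kernel_comb Kd w u)))
        = cscale (inverse (cnj \<mu>)) (cscale (c * cnj \<mu>) (kernel_comb Kd' w u))" by simp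
    then have "U (kernel_comb Kd w u) = cscale c (kernel_comb Kd' w u)"
      using \<mu>(1) by (simp add: field_simps)
    then show ?thesis by blast
  qed
  have on_Z: "\<exists>c. U (kernel_comb Kd p u) = cscale c (kernel_comb Kd' p u)"
    if p: "p \<in> \<Delta>" "\<And>j. g j p = 0" and u: "u \<noteq> 0" for p u
  proof -
    obtain i0 where i0: "u $ i0 \<noteq> 0" using exists_chart[OF u] by blast
    have "submanifold_at {w \<in> \<Delta>. \<forall>j. g j w = 0} p CARD('t)"
      using Z p by (simp add: singularity_free_codim_def)
    \<comment> \<open>Approach \<open>p\<close> along points at which \<open>u\<close> remains a representative of the direction of \<open>g\<close>.\<close>
    from zero_set_direction[OF A.open_\<Delta> A.hol_g p this i0]
    have "\<exists>w\<in>\<Delta>. dist w p < 1 / Suc n \<and> (\<exists>\<mu>. \<mu> \<noteq> 0 \<and> (\<forall>j. g j w = \<mu> * u $ j))" for n by simp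
    then obtain w where w: "\<And>n. w n \<in> \<Delta>" "\<And>n. dist (w n) p < 1 / Suc n"
        "\<And>n. \<exists>\<mu>. \<mu> \<noteq> 0 \<and> (\<forall>j. g j (w n) = \<mu> * u $ j)" by metis
    have "(\<lambda>n. dist (w n) p) \<longlonglongrightarrow> 0"
      by (rule Lim_null_comparison[OF _ LIMSEQ_Suc[OF lim_1_over_n]])
         (use w(2) in \<open>auto intro!: always_eventually less_imp_le\<close>)
    then have w_lim: "w \<longlonglongrightarrow> p" by (rule tendsto_dist_iff[THEN iffD2])
    have "\<exists>c. U (kernel_comb Kd (w n) u) = cscale c (kernel_comb Kd' (w n) u)" for n
      using w(3)[of n] off_Z[OF w(1) _ _ u] by blast
    then obtain c where c: "\<And>n. U (kernel_comb Kd (w n) u) = cscale (c n) (kernel_comb Kd' (w n) u)" by metis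
    define s s' where "s = kernel_comb Kd p u" and "s' = kernel_comb Kd' p u"
    have sM: "U s \<in> carr M'" "s' \<in> carr M'"
      unfolding s_def s'_def by (intro U.U_carr A.comb_carr B.comb_carr p(1))+
    have conv: "hconv M' (\<lambda>n. U (kernel_comb Kd (w n) u)) (U s) sequentially"
        "hconv M' (\<lambda>n. kernel_comb Kd' (w n) u) s' sequentially"
      unfolding s_def s'_def by (intro U.U_hconv A.comb_hconv B.comb_hconv p(1) w_lim)+
    \<comment> \<open>Proportionality is expressed by products of inner products, which passes to the limit
      without control of the factors \<open>c n\<close>.\<close>
    have eq: "ip M' (U s) e * ip M' s' s' = ip M' (U s) s' * ip M' s' e" if e: "e \<in> carr M'" for e
    proof (rule LIMSEQ_unique)
      have eq_n: "ip M' (U (kernel_comb Kd (w n) u)) e * ip M' (kernel_comb Kd' (w n) u) s'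
          = ip M' (U (kernel_comb Kd (w n) u)) s' * ip M' (kernel_comb Kd' (w n) u) e" for n
        unfolding c using e sM by (simp add: ip_cscale_left B.space B.comb_carr w(1))
      show "(\<lambda>n. ip M' (U (kernel_comb Kd (w n) u)) e * ip M' (kernel_comb Kd' (w n) u) s')
          \<longlonglongrightarrow> ip M' (U s) e * ip M' s' s'"
        by (intro tendsto_mult hconv_ip[OF B.space] conv hconv_const B.space e sM)
      show "(\<lambda>n. ip M' (U (kernel_comb Kd (w n) u)) e * ip M' (kernel_comb Kd' (w n) u) s')
          \<longlonglongrightarrow> ip M' (U s) s' * ip M' s' e"
        unfolding eq_n by (intro tendsto_mult hconv_ip[OF B.space] conv hconv_const B.space e sM)
    qed
    have s'_nz: "ip M' s' s' \<noteq> 0"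
      using ip_self_eq_0_iff[OF B.space sM(2)] B.comb_nonzero[OF p(1) u] by (simp add: s'_def)
    define b where "b = ip M' (U s) s' / ip M' s' s'"
    have "U s = cscale b s'"
    proof (rule ip_eqI[OF B.space sM(1) carr_cscale[OF B.space sM(2)]])
      fix h assume h: "h \<in> carr M'"
      have "ip M' (U s) h = ip M' (cscale b s') h"
        using eq[OF h] s'_nz by (simp add: ip_cscale_left B.space sM h b_def field_simps)
      then show "ip M' h (U s) = ip M' h (cscale b s')"
        using ip_cnj[OF B.space sM(1) h] ip_cnj[OF B.space carr_cscale[OF B.space sM(2)] h] by simp
    qed
    then show ?thesis unfolding s_def s'_def by blast
  qed
  show ?thesis
  proof (rule bundle_equivalent_if_fibrewise[OF D D' \<open>module_isometry \<Omega> M M' U\<close>])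
    fix w and u :: "complex^'t"
    assume w: "w \<in> \<Delta>" and u: "u \<noteq> 0" and par: "\<And>i j. u $ i * g j w = u $ j * g i w"
    obtain i where i: "u $ i \<noteq> 0" using exists_chart[OF u] by blast
    have g_par: "g j w = (g i w / u $ i) * u $ j" for j
      using par[of i j] i by (simp add: field_simps)
    show "\<exists>c. U (kernel_comb Kd w u) = cscale c (kernel_comb Kd' w u)"
    proof (cases "g i w = 0")
      case True
      then have "g j w = 0" for j using g_par[of j] by simp
      then show ?thesis by (rule on_Z[OF w _ u])
    next
      case False
      show ?thesis
      proof (rule off_Z[OF w _ _ u])
        show "g i w / u $ i \<noteq> 0" using False i by simp
      qed (rule g_par)
    qed
  qed
qed

section \<open>The equivalence\<close>

lemma open_polydisc: "open (polydisc w r)"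
proof -
  have "polydisc w r = (\<Inter>j. {z. norm (z $ j - w $ j) < r})"
    by (auto simp: polydisc_def)
  then show ?thesis
    by (auto intro!: open_INT open_Collect_less continuous_intros)
qed

theorem theorem3p3:
  fixes \<Omega> :: "(complex^'m::finite) set"
    and M M' :: "'m hilb"
    and K K' :: "complex^'m \<Rightarrow> complex^'m \<Rightarrow> complex"
    and I :: "'m cpoly set"
    and w0 :: "complex^'m"
    and r :: real
    and g :: "'t::finite \<Rightarrow> complex^'m \<Rightarrow> complex"
    and Kd Kd' :: "'t \<Rightarrow> complex^'m \<Rightarrow> complex^'m \<Rightarrow> complex"
  assumes "open \<Omega>" and "connected \<Omega>" and "bounded \<Omega>"
    and "class_B1 \<Omega> M" and "class_B1 \<Omega> M'"
    and "analytic_dim_le (zero_set \<Omega> M) (int CARD('m) - 2)"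
    and "analytic_dim_le (zero_set \<Omega> M') (int CARD('m) - 2)"
    and "poly_ideal I" and "completion_of \<Omega> I M" and "completion_of \<Omega> I M'"
    and "reproducing_kernel \<Omega> M K" and "reproducing_kernel \<Omega> M' K'"
    and "w0 \<in> zero_set \<Omega> M"
    and "has_quot_dim (stalk M w0) (max_ideal_mult w0 (stalk M w0)) CARD('t)"
    and "minimal_generators w0 (stalk M w0) g"
    and "r > 0" and "polydisc w0 r \<subseteq> \<Omega>"
    and "\<And>j. hol_on (g j) (polydisc w0 r)"
    and "kernel_decomposition M K (polydisc w0 r) g Kd"
    and "kernel_decomposition M' K' (polydisc w0 r) g Kd'"
    and "singularity_free_codim {w \<in> polydisc w0 r. \<forall>j. g j w = 0} CARD('t)"
  shows "module_equivalent M M' \<longleftrightarrow>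
    bundle_equivalent (kernel_bundle M (polydisc w0 r) g Kd) (kernel_bundle M' (polydisc w0 r) g Kd')"
proof -
  let ?\<Delta> = "polydisc w0 r"
  have M: "hilbert_module \<Omega> M" "hilbert_module \<Omega> M'"
    using assms(4,5) by (simp_all add: class_B1_def)
  have ne: "?\<Delta> \<noteq> {}"
    using \<open>r > 0\<close> by (auto simp: polydisc_def intro!: exI[of _ w0])
  have D: "decomposed_module \<Omega> ?\<Delta> M K g Kd"
    by unfold_locales (use M(1) assms open_polydisc in auto)
  have D': "decomposed_module \<Omega> ?\<Delta> M' K' g Kd'"
    by unfold_locales (use M(2) assms open_polydisc in auto)
  show ?thesis
  proof
    assume "module_equivalent M M'"
    then show "bundle_equivalent (kernel_bundle M ?\<Delta> g Kd) (kernel_bundle M' ?\<Delta> g Kd')"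
      by (rule bundle_equivalent_if_module_equivalent[OF D D' \<open>completion_of \<Omega> I M\<close> assms(21)])
  next
    assume "bundle_equivalent (kernel_bundle M ?\<Delta> g Kd) (kernel_bundle M' ?\<Delta> g Kd')"
    then show "module_equivalent M M'"
      by (rule module_equivalent_if_bundle_equivalent[OF \<open>open \<Omega>\<close> \<open>connected \<Omega>\<close> ne D D'])
  qed
qed

end
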